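(* Let $Q\colon L^1(Z,\eta)\to L^1(Z,\eta)$ be a measure-preserving Markov operator on a Lebesgue probability space $(Z,\eta)$ satisfying the following four assumptions. 1. There is a decomposition $Q=VW$, where $V$ and $W$ are measure-preserving Markov operators, such that $Q^*=WV$. 2. For every $n\in\mathbb N$ the equation $Q^n\psi=\psi$ has only constant solutions in $L^2(Z,\eta)$. 3. There exists $m\in\mathbb N$ such that the equation $(Q^* )^mQ^m\psi=\psi$ has only constant solutions in $L^2(Z,\eta)$. 4. There exist a sequence of operators $A_n$ and constants $C,K>0$ and $a,b\in\mathbb N$ such that for all $n\ge m_0:=\lceil a/2\rceil$ and every nonnegative $\varphi\in L^1(Z,\eta)$ $$WQ^{2n-a}\varphi\le C\sum_{j=-b}^{b}(Q^* )^nQ^{n+j}\varphi+A_n\varphi,$$ where $W$ is the operator from assumption 1; the operators $A_n\colon L^1(Z,\eta)\to L^1(Z,\eta)$ map nonnegative functions to nonnegative functions and, for every $p\in[1,\infty]$, map $L^p(Z,\eta)$ to itself with $\|A_n\|_{L^p}\le\alpha_n$, where $\sum_{n=m_0}^\infty\alpha_n\le K$. Then for every function $\varphi\in L\log L(Z,\eta)$ the sequence $Q^n\varphi$ converges almost surely and in $L^1$ to $\int_Z\varphi\,d\eta$ as $n\to\infty$.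
   Context: A measure-preserving Markov operator on $(Z,\eta)$ is a linear operator $R$ on $L^1(Z,\eta)$ which maps nonnegative functions to nonnegative functions, satisfies $R1=1$, and maps each $L^p(Z,\eta)$, $p\in[1,\infty]$, to itself with $\|R\varphi\|_{L^p}\le\|\varphi\|_{L^p}$ (consequently $\int R\varphi\,d\eta=\int\varphi\,d\eta$). $R^*$ denotes the adjoint with respect to the $L^2(Z,\eta)$ inner product (extended to $L^1$). $\varphi\in L\log L(Z,\eta)$ means $\int_Z|\varphi|\log^+|\varphi|\,d\eta<\infty$. In the sum in assumption 4, terms with $n+j<0$ are omitted. *)

theory Defs
  imports "HOL-Probability.Probability" "HOL-Probability.Essential_Supremum"
begin


definition isomorphic_mod_0 :: "'a measure \<Rightarrow> 'b measure \<Rightarrow> bool" where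
  "isomorphic_mod_0 M M' \<longleftrightarrow>
     (\<exists>N \<in> null_sets M. \<exists>N' \<in> null_sets M'. \<exists>f g.
        f \<in> measurable (restrict_space M (space M - N)) (restrict_space M' (space M' - N')) \<and>
        g \<in> measurable (restrict_space M' (space M' - N')) (restrict_space M (space M - N)) \<and>
        (\<forall>x \<in> space M - N. g (f x) = x) \<and>
        (\<forall>y \<in> space M' - N'. f (g y) = y) \<and>
        distr (restrict_space M (space M - N)) (restrict_space M' (space M' - N')) f
          = restrict_space M' (space M' - N'))"

text \<open>
  Rokhlin's definition: up to null sets, an interval with Lebesgue measure together with at most
  countably many atoms. In the model on the real line the interval is \<open>{0..c}\<close> and the
  \<open>i\<close>-th atom, of mass \<open>p i\<close> (possibly 0), sits at the point \<open>i + 2\<close>; when \<open>c \<le> 1\<close> (which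
  is forced by total mass 1) the interval and the atoms do not overlap. Isomorphism is between
  completions, so that both the complete spaces and the standard Borel ones are covered.
\<close>

definition lebesgue_prob_space :: "'a measure \<Rightarrow> bool" where
  "lebesgue_prob_space M \<longleftrightarrow>
     prob_space M \<and>
     (\<exists>(c::real) (p :: nat \<Rightarrow> real) (\<nu> :: real measure).
        0 \<le> c \<and> (\<forall>i. 0 \<le> p i) \<and> sets \<nu> = sets borel \<and>
        (\<forall>B \<in> sets borel.
           emeasure \<nu> B = emeasure lborel (B \<inter> {0..c})
             + (\<Sum>i. ennreal (p i) * indicator B (real i + 2))) \<and>
        isomorphic_mod_0 (completion M) (completion \<nu>))"



text \<open>
  Elements of \<open>L\<^sup>p\<close> are represented by real functions, and equality of elements is equality
  almost everywhere. Only exponents \<open>1 \<le> p \<le> \<infinity>\<close> are used.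
\<close>

definition Lp :: "'a measure \<Rightarrow> ereal \<Rightarrow> ('a \<Rightarrow> real) set" where
  "Lp M p = {f \<in> borel_measurable M.
     if p = \<infinity> then esssup M (\<lambda>x. ereal \<bar>f x\<bar>) < \<infinity>
     else integrable M (\<lambda>x. \<bar>f x\<bar> powr real_of_ereal p)}"

definition Lp_norm :: "'a measure \<Rightarrow> ereal \<Rightarrow> ('a \<Rightarrow> real) \<Rightarrow> real" where
  "Lp_norm M p f =
     (if p = \<infinity> then real_of_ereal (esssup M (\<lambda>x. ereal \<bar>f x\<bar>))
      else (\<integral>x. \<bar>f x\<bar> powr real_of_ereal p \<partial>M) powr (1 / real_of_ereal p))"

definition LlogL :: "'a measure \<Rightarrow> ('a \<Rightarrow> real) set" where
  "LlogL M = {f \<in> borel_measurable M. integrable M (\<lambda>x. \<bar>f x\<bar> * max 0 (ln \<bar>f x\<bar>))}"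

text \<open>
  An operator on \<open>L\<^sup>1\<close> is a map on representatives that respects equality almost everywhere;
  its values outside \<open>L\<^sup>1\<close> are irrelevant.
\<close>

definition L1_linear :: "'a measure \<Rightarrow> (('a \<Rightarrow> real) \<Rightarrow> ('a \<Rightarrow> real)) \<Rightarrow> bool" where
  "L1_linear M T \<longleftrightarrow>
     (\<forall>f \<in> Lp M 1. T f \<in> Lp M 1) \<and>
     (\<forall>f \<in> Lp M 1. \<forall>g \<in> Lp M 1. (AE x in M. f x = g x) \<longrightarrow> (AE x in M. T f x = T g x)) \<and>
     (\<forall>f \<in> Lp M 1. \<forall>g \<in> Lp M 1. AE x in M. T (\<lambda>y. f y + g y) x = T f x + T g x) \<and>
     (\<forall>f \<in> Lp M 1. \<forall>c. AE x in M. T (\<lambda>y. c * f y) x = c * T f x)"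

definition L1_op_eq ::
  "'a measure \<Rightarrow> (('a \<Rightarrow> real) \<Rightarrow> ('a \<Rightarrow> real)) \<Rightarrow> (('a \<Rightarrow> real) \<Rightarrow> ('a \<Rightarrow> real)) \<Rightarrow> bool" where
  "L1_op_eq M S T \<longleftrightarrow> (\<forall>f \<in> Lp M 1. AE x in M. S f x = T f x)"

definition positive_op :: "'a measure \<Rightarrow> (('a \<Rightarrow> real) \<Rightarrow> ('a \<Rightarrow> real)) \<Rightarrow> bool" where
  "positive_op M T \<longleftrightarrow>
     (\<forall>f \<in> Lp M 1. (AE x in M. 0 \<le> f x) \<longrightarrow> (AE x in M. 0 \<le> T f x))"

definition Lp_bounded_by :: "'a measure \<Rightarrow> ereal \<Rightarrow> real \<Rightarrow> (('a \<Rightarrow> real) \<Rightarrow> ('a \<Rightarrow> real)) \<Rightarrow> bool" where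
  "Lp_bounded_by M p B T \<longleftrightarrow>
     (\<forall>f \<in> Lp M p. T f \<in> Lp M p \<and> Lp_norm M p (T f) \<le> B * Lp_norm M p f)"

definition mp_markov_op :: "'a measure \<Rightarrow> (('a \<Rightarrow> real) \<Rightarrow> ('a \<Rightarrow> real)) \<Rightarrow> bool" where
  "mp_markov_op M R \<longleftrightarrow>
     L1_linear M R \<and> positive_op M R \<and>
     (AE x in M. R (\<lambda>_. 1) x = 1) \<and>
     (\<forall>p \<ge> 1. Lp_bounded_by M p 1 R)"

text \<open>
  The adjoint in \<open>L\<^sup>2\<close>, extended to \<open>L\<^sup>1\<close>. The extension is by continuity: since \<open>L\<^sup>2\<close> is dense
  in \<open>L\<^sup>1\<close>, boundedness in the \<open>L\<^sup>1\<close> norm makes \<open>S\<close> unique up to \<open>L1_op_eq\<close>.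
\<close>

definition is_L2_adjoint ::
  "'a measure \<Rightarrow> (('a \<Rightarrow> real) \<Rightarrow> ('a \<Rightarrow> real)) \<Rightarrow> (('a \<Rightarrow> real) \<Rightarrow> ('a \<Rightarrow> real)) \<Rightarrow> bool" where
  "is_L2_adjoint M R S \<longleftrightarrow>
     L1_linear M S \<and>
     (\<exists>B. Lp_bounded_by M 1 B S) \<and>
     (\<forall>f \<in> Lp M 2. S f \<in> Lp M 2) \<and>
     (\<forall>f \<in> Lp M 2. \<forall>g \<in> Lp M 2. (\<integral>x. R f x * g x \<partial>M) = (\<integral>x. f x * S g x \<partial>M))"

definition only_constant_L2_fixed_points ::
  "'a measure \<Rightarrow> (('a \<Rightarrow> real) \<Rightarrow> ('a \<Rightarrow> real)) \<Rightarrow> bool" where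
  "only_constant_L2_fixed_points M T \<longleftrightarrow>
     (\<forall>f \<in> Lp M 2. (AE x in M. T f x = f x) \<longrightarrow> (\<exists>c. AE x in M. f x = c))"

end

theory Submission
  imports Defs
begin

text \<open>
  Why the averages converge. Write \<open>S\<close> for the adjoint of \<open>Q\<close>. Almost sure convergence is reduced, as
  usual, to two facts: a maximal inequality for the powers \<open>Q\<^sup>n\<close> and mean convergence on bounded
  functions. Both have a natural proof on the path space of a Markov chain; here every such argument is
  carried out by duality and positivity, with the operators alone.

  Maximal inequality. The domination hypothesis bounds \<open>W Q\<^bsup>2n-a\<^esup> \<phi>\<close> by finitely many terms \<open>S\<^sup>n Q\<^bsup>n+j\<^esup> \<phi>\<close> plus a
  summable error, and applying \<open>V\<close> gives \<open>Q\<^bsup>2n-a+1\<^esup> \<phi>\<close>; with \<open>Q \<phi>\<close> in place of \<open>\<phi>\<close> the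
  exponents of the other parity are reached. So it is enough to bound
  \<open>sup S\<^sup>n Q\<^sup>n \<phi>\<close>, which is Rota's setting. By duality this supremum is tested against
  \<open>G = \<Sum> S\<^sup>n Q\<^sup>n e\<^sub>n\<close> with \<open>e\<^sub>n \<ge> 0\<close> and \<open>\<Sum> e\<^sub>n \<le> 1\<close>. Such a \<open>G\<close> has an exponential moment bounded by an
  absolute constant (\<open>potential_exp_integral\<close>), and Young's inequality turns this into a bound of the
  mean of the supremum by \<open>\<integral> \<phi> log\<^sup>+ (\<phi> / \<epsilon>)\<close> plus a multiple of \<open>\<epsilon>\<close> (\<open>Rota_maximal\<close>,
  \<open>maximal_LlogL\<close>).

  Mean convergence. \<open>Q\<close> is mixing: \<open>\<integral> Q\<^sup>n f g\<close> tends to \<open>\<integral> f \<integral> g\<close>, because the energies \<open>\<integral> (Q\<^sup>n f)\<^sup>2\<close>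
  decrease and hence \<open>Q\<^sup>n f\<close> is asymptotically fixed by \<open>S\<^sup>m Q\<^sup>m\<close>, whose only fixed points are the
  constants. Strong convergence means that the limit energy is \<open>(\<integral> f)\<^sup>2\<close>. In probabilistic language the
  limit energy of \<open>f \<ge> 0\<close> is the second moment of a random variable that is measurable for the tail of the
  Markov chain, and it has to be shown that the tail is trivial. If some \<open>f\<close> had limit energy \<open>q (\<integral> f)\<^sup>2\<close>
  with \<open>q > 1\<close>, mixing would allow multiplying two distant translates, which squares the ratio \<open>q\<close>; so the
  ratio would be unbounded (\<open>spread_unbounded\<close>), and tail events of small positive probability would
  exist. But the domination hypothesis, in the limit, gives
  \<open>\<integral> \<phi> \<integral> g \<le> C \<Sum> \<integral> Q\<^bsup>n+j\<^esup> \<phi> Q\<^sup>n g\<close> (\<open>product_of_means_le\<close>). This fails when \<open>g\<close> lives on a small tail event and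
  \<open>\<phi>\<close> on the complement of its \<open>2b + 1\<close> translates (\<open>not_spread\<close>).
\<close>

section \<open>Essentially bounded functions\<close>

definition Linf :: "'a measure \<Rightarrow> ('a \<Rightarrow> real) set" where
  "Linf M = {f \<in> borel_measurable M. \<exists>B. AE x in M. \<bar>f x\<bar> \<le> B}"

lemma Lp_1_iff: "f \<in> Lp M 1 \<longleftrightarrow> integrable M f"
  by (auto simp: Lp_def integrable_abs_iff)

lemma Lp_norm_1: "Lp_norm M 1 f = (\<integral>x. \<bar>f x\<bar> \<partial>M)"
  by (simp add: Lp_norm_def)

lemma LinfI: "f \<in> borel_measurable M \<Longrightarrow> AE x in M. \<bar>f x\<bar> \<le> B \<Longrightarrow> f \<in> Linf M"
  by (auto simp: Linf_def)

lemma LinfE: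
  assumes "f \<in> Linf M"
  obtains B where "f \<in> borel_measurable M" "AE x in M. \<bar>f x\<bar> \<le> B" "B > 0"
proof -
  from assms obtain B where "f \<in> borel_measurable M" "AE x in M. \<bar>f x\<bar> \<le> B"
    by (auto simp: Linf_def)
  moreover from this(2) have "AE x in M. \<bar>f x\<bar> \<le> max B 1" by eventually_elim auto
  ultimately show ?thesis by (intro that[of "max B 1"]) auto
qed

lemma Linf_measurable[simp]: "f \<in> Linf M \<Longrightarrow> f \<in> borel_measurable M"
  by (simp add: Linf_def)

lemma Linf_const[intro, simp]: "(\<lambda>_. c) \<in> Linf M"
  by (rule LinfI[where B = "\<bar>c\<bar>"]) auto

lemma Linf_add[intro]:
  assumes "f \<in> Linf M" "g \<in> Linf M" shows "(\<lambda>x. f x + g x) \<in> Linf M"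
proof -
  obtain B C where [measurable]: "f \<in> borel_measurable M" "g \<in> borel_measurable M"
    and B: "AE x in M. \<bar>f x\<bar> \<le> B" and C: "AE x in M. \<bar>g x\<bar> \<le> C"
    using assms by (elim LinfE)
  from B C have "AE x in M. \<bar>f x + g x\<bar> \<le> B + C" by eventually_elim auto
  then show ?thesis by (intro LinfI) auto
qed

lemma Linf_mult[intro]:
  assumes "f \<in> Linf M" "g \<in> Linf M" shows "(\<lambda>x. f x * g x) \<in> Linf M"
proof -
  obtain B C where [measurable]: "f \<in> borel_measurable M" "g \<in> borel_measurable M"
    and B: "AE x in M. \<bar>f x\<bar> \<le> B" and C: "AE x in M. \<bar>g x\<bar> \<le> C"
    using assms by (elim LinfE)
  from B C have "AE x in M. \<bar>f x * g x\<bar> \<le> B * C"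
    by eventually_elim (auto simp: abs_mult intro!: mult_mono)
  then show ?thesis by (intro LinfI) auto
qed

lemma Linf_continuous:
  fixes \<Phi> :: "real \<Rightarrow> real"
  assumes "f \<in> Linf M" and "continuous_on UNIV \<Phi>" shows "(\<lambda>x. \<Phi> (f x)) \<in> Linf M"
proof -
  obtain B where f[measurable]: "f \<in> borel_measurable M" and B: "AE x in M. \<bar>f x\<bar> \<le> B"
    using assms by (elim LinfE)
  have [measurable]: "\<Phi> \<in> borel_measurable borel"
    using assms(2) by (rule borel_measurable_continuous_onI)
  have "compact (\<Phi> ` {-B..B})"
    using continuous_on_subset[OF assms(2)] by (intro compact_continuous_image) auto
  then obtain K where K: "\<And>y. y \<in> \<Phi> ` {-B..B} \<Longrightarrow> norm y \<le> K"
    using compact_imp_bounded bounded_iff by metis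
  from B have "AE x in M. \<bar>\<Phi> (f x)\<bar> \<le> K"
    by eventually_elim (use K in \<open>force simp: abs_le_iff\<close>)
  then show ?thesis by (intro LinfI) auto
qed

lemma Linf_cmult[intro]: "f \<in> Linf M \<Longrightarrow> (\<lambda>x. c * f x) \<in> Linf M"
  by (intro Linf_mult) auto

lemma Linf_uminus[intro]: "f \<in> Linf M \<Longrightarrow> (\<lambda>x. - f x) \<in> Linf M"
  using Linf_cmult[of f M "-1"] by simp

lemma Linf_diff[intro]: "f \<in> Linf M \<Longrightarrow> g \<in> Linf M \<Longrightarrow> (\<lambda>x. f x - g x) \<in> Linf M"
  using Linf_add[of f M "\<lambda>x. - g x"] by auto

lemma Linf_power[intro]: "f \<in> Linf M \<Longrightarrow> (\<lambda>x. f x ^ n) \<in> Linf M"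
  by (induction n) auto

lemma Linf_abs[intro]: "f \<in> Linf M \<Longrightarrow> (\<lambda>x. \<bar>f x\<bar>) \<in> Linf M"
  by (rule Linf_continuous) (auto intro!: continuous_intros)

lemma Linf_max0[intro]: "f \<in> Linf M \<Longrightarrow> (\<lambda>x. max 0 (f x)) \<in> Linf M"
  by (rule Linf_continuous) (auto intro!: continuous_intros)

lemma Linf_exp: "f \<in> Linf M \<Longrightarrow> (\<lambda>x. exp (c * f x)) \<in> Linf M"
  by (rule Linf_continuous[where \<Phi> = "\<lambda>s. exp (c * s)"]) (auto intro!: continuous_intros)

lemma Linf_sum[intro]: "(\<And>i. i \<in> I \<Longrightarrow> f i \<in> Linf M) \<Longrightarrow> (\<lambda>x. \<Sum>i\<in>I. f i x) \<in> Linf M"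
  by (induction I rule: infinite_finite_induct) auto

lemma (in prob_space) Linf_integrable[intro, simp]: "f \<in> Linf M \<Longrightarrow> integrable M f"
  by (erule LinfE, rule integrable_const_bound) auto

lemma (in prob_space) Linf_Lp2: "f \<in> Linf M \<Longrightarrow> f \<in> Lp M 2"
  using Linf_integrable[OF Linf_power[of f M 2]] by (auto simp: Lp_def)

section \<open>Markov operators\<close>

text \<open>
  The preservation of integrals replaces the contraction property in all Lebesgue spaces: the \<open>L\<^sup>1\<close> and
  \<open>L\<^sup>2\<close> contractions needed below follow from it by positivity, and unlike a family of norm bounds it is
  visibly stable under composition and under changes on null sets.
\<close>

definition markov_operator :: "'a measure \<Rightarrow> (('a \<Rightarrow> real) \<Rightarrow> 'a \<Rightarrow> real) \<Rightarrow> bool" where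
  "markov_operator M R \<longleftrightarrow>
     L1_linear M R \<and> positive_op M R \<and> (AE x in M. R (\<lambda>_. 1) x = 1) \<and>
     (\<forall>f. integrable M f \<longrightarrow> (\<integral>x. R f x \<partial>M) = (\<integral>x. f x \<partial>M))"

context prob_space
begin

context
  fixes R assumes R: "markov_operator M R"
begin

lemma markov_integrable[simp, intro]: "integrable M f \<Longrightarrow> integrable M (R f)"
  using R by (auto simp: markov_operator_def L1_linear_def Lp_1_iff)

lemma markov_measurable[measurable (raw)]: "integrable M f \<Longrightarrow> R f \<in> borel_measurable M"
  by (rule borel_measurable_integrable[OF markov_integrable])

lemma markov_cong:
  "integrable M f \<Longrightarrow> integrable M g \<Longrightarrow> AE x in M. f x = g x \<Longrightarrow> AE x in M. R f x = R g x"
  using R by (auto simp: markov_operator_def L1_linear_def Lp_1_iff)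

lemma markov_add:
  "integrable M f \<Longrightarrow> integrable M g \<Longrightarrow> AE x in M. R (\<lambda>y. f y + g y) x = R f x + R g x"
  using R by (auto simp: markov_operator_def L1_linear_def Lp_1_iff)

lemma markov_cmult: "integrable M f \<Longrightarrow> AE x in M. R (\<lambda>y. c * f y) x = c * R f x"
  using R by (auto simp: markov_operator_def L1_linear_def Lp_1_iff)

lemma markov_nonneg: "integrable M f \<Longrightarrow> AE x in M. 0 \<le> f x \<Longrightarrow> AE x in M. 0 \<le> R f x"
  using R by (auto simp: markov_operator_def positive_op_def Lp_1_iff)

lemma markov_integral[simp]: "integrable M f \<Longrightarrow> (\<integral>x. R f x \<partial>M) = (\<integral>x. f x \<partial>M)"
  using R by (auto simp: markov_operator_def)

lemma markov_const: "AE x in M. R (\<lambda>_. c) x = c"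
proof -
  have "AE x in M. R (\<lambda>_. 1) x = 1" using R by (auto simp: markov_operator_def)
  with markov_cmult[of "\<lambda>_. 1" c] show ?thesis by auto
qed

lemma markov_lincomb:
  assumes "integrable M f" "integrable M g"
  shows "AE x in M. R (\<lambda>y. c * f y + d * g y) x = c * R f x + d * R g x"
proof -
  have "AE x in M. R (\<lambda>y. c * f y + d * g y) x = R (\<lambda>y. c * f y) x + R (\<lambda>y. d * g y) x"
    using assms by (intro markov_add) auto
  with markov_cmult[OF assms(1), of c] markov_cmult[OF assms(2), of d] show ?thesis by auto
qed

lemma markov_diff:
  assumes "integrable M f" "integrable M g"
  shows "AE x in M. R (\<lambda>y. f y - g y) x = R f x - R g x"
  using markov_lincomb[OF assms, of 1 "-1"] by simp

lemma markov_affine: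
  assumes "integrable M f" shows "AE x in M. R (\<lambda>y. c * f y + d) x = c * R f x + d"
proof -
  have "AE x in M. R (\<lambda>y. c * f y + d * 1) x = c * R f x + d * R (\<lambda>_. 1) x"
    using assms by (intro markov_lincomb) auto
  with markov_const[of 1] show ?thesis by auto
qed

lemma markov_shift:
  assumes "integrable M f" shows "AE x in M. R (\<lambda>y. f y - d) x = R f x - d"
  using markov_affine[OF assms, of 1 "-d"] by simp

lemma markov_mono:
  assumes "integrable M f" "integrable M g" "AE x in M. f x \<le> g x"
  shows "AE x in M. R f x \<le> R g x"
proof -
  have "AE x in M. 0 \<le> R (\<lambda>y. g y - f y) x" using assms by (intro markov_nonneg) auto
  with markov_diff[OF assms(2,1)] show ?thesis by auto
qed

lemma markov_bounded:
  assumes "f \<in> borel_measurable M" "AE x in M. \<bar>f x\<bar> \<le> B" shows "AE x in M. \<bar>R f x\<bar> \<le> B"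
proof -
  have f: "integrable M f" using assms by (intro integrable_const_bound[where B = B]) auto
  have "AE x in M. R f x \<le> R (\<lambda>_. B) x" using f assms by (intro markov_mono) auto
  moreover have "AE x in M. R (\<lambda>_. - B) x \<le> R f x" using f assms by (intro markov_mono) auto
  ultimately show ?thesis using markov_const[of B] markov_const[of "-B"] by auto
qed

lemma markov_upper:
  assumes "integrable M f" "AE x in M. f x \<le> B" shows "AE x in M. R f x \<le> B"
  using markov_mono[of f "\<lambda>_. B"] assms markov_const[of B] by auto

lemma markov_Linf[intro]:
  assumes "f \<in> Linf M" shows "R f \<in> Linf M"
proof -
  from assms obtain B where B: "f \<in> borel_measurable M" "AE x in M. \<bar>f x\<bar> \<le> B"
    by (elim LinfE)
  have "R f \<in> borel_measurable M" using assms by (intro markov_measurable) auto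
  with markov_bounded[OF B] show ?thesis by (intro LinfI)
qed

lemma markov_abs:
  assumes "integrable M f" shows "AE x in M. \<bar>R f x\<bar> \<le> R (\<lambda>y. \<bar>f y\<bar>) x"
proof -
  have "AE x in M. R f x \<le> R (\<lambda>y. \<bar>f y\<bar>) x" using assms by (intro markov_mono) auto
  moreover have "AE x in M. R (\<lambda>y. (-1) * f y) x \<le> R (\<lambda>y. \<bar>f y\<bar>) x"
    using assms by (intro markov_mono) (auto simp: abs_le_iff)
  ultimately show ?thesis using markov_cmult[OF assms, of "-1"] by auto
qed

lemma markov_L1_contraction:
  assumes "integrable M f" "integrable M g"
  shows "(\<integral>x. \<bar>R f x - R g x\<bar> \<partial>M) \<le> (\<integral>x. \<bar>f x - g x\<bar> \<partial>M)"
proof -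
  have d: "integrable M (\<lambda>x. f x - g x)" using assms by auto
  have "(\<integral>x. \<bar>R f x - R g x\<bar> \<partial>M) \<le> (\<integral>x. R (\<lambda>y. \<bar>f y - g y\<bar>) x \<partial>M)"
    using assms markov_abs[OF d] markov_diff[OF assms] by (intro integral_mono_AE) auto
  also have "\<dots> = (\<integral>x. \<bar>f x - g x\<bar> \<partial>M)" using assms by (intro markov_integral) auto
  finally show ?thesis .
qed

text \<open>
  Positivity gives the inequality for each tangent line separately, outside a null set that depends on
  the line. Countably many lines, those touching at rational points, already determine the convex
  function \<open>\<Phi>\<close>.
\<close>

lemma markov_Jensen:
  fixes \<Phi> D :: "real \<Rightarrow> real"
  assumes f: "f \<in> Linf M" and cont: "continuous_on UNIV \<Phi>" "continuous_on UNIV D"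
    and tangent: "\<And>s t. \<Phi> s + D s * (t - s) \<le> \<Phi> t"
  shows "AE x in M. \<Phi> (R f x) \<le> R (\<lambda>y. \<Phi> (f y)) x"
proof -
  have "AE x in M. \<forall>s\<in>\<rat>. \<Phi> s + D s * (R f x - s) \<le> R (\<lambda>y. \<Phi> (f y)) x"
  proof (subst AE_ball_countable, rule countable_rat, intro ballI)
    fix s :: real
    have "AE x in M. R (\<lambda>y. D s * f y + (\<Phi> s - D s * s)) x \<le> R (\<lambda>y. \<Phi> (f y)) x"
      using f Linf_continuous[OF f cont(1)]
    proof (intro markov_mono AE_I2)
      show "D s * f x + (\<Phi> s - D s * s) \<le> \<Phi> (f x)" for x
        using tangent[of s "f x"] by (simp add: algebra_simps)
    qed auto
    with markov_affine[of f "D s" "\<Phi> s - D s * s"] f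
    show "AE x in M. \<Phi> s + D s * (R f x - s) \<le> R (\<lambda>y. \<Phi> (f y)) x"
      by (auto simp: algebra_simps)
  qed
  then show ?thesis
  proof eventually_elim
    case (elim x)
    have "closed {s. \<Phi> s + D s * (R f x - s) \<le> R (\<lambda>y. \<Phi> (f y)) x}"
      using cont by (intro closed_Collect_le continuous_intros)
    moreover have "\<rat> \<subseteq> {s. \<Phi> s + D s * (R f x - s) \<le> R (\<lambda>y. \<Phi> (f y)) x}" using elim by auto
    ultimately have "closure \<rat> \<subseteq> {s. \<Phi> s + D s * (R f x - s) \<le> R (\<lambda>y. \<Phi> (f y)) x}"
      by (rule closure_minimal[rotated])
    then have "\<Phi> s + D s * (R f x - s) \<le> R (\<lambda>y. \<Phi> (f y)) x" for s
      using Rats_closure_real by blast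
    from this[of "R f x"] show ?case by simp
  qed
qed

lemma markov_Jensen_square:
  assumes "f \<in> Linf M" shows "AE x in M. (R f x)\<^sup>2 \<le> R (\<lambda>y. (f y)\<^sup>2) x"
proof (rule markov_Jensen[OF assms, where D = "\<lambda>s. 2 * s"])
  fix s t :: real
  have "0 \<le> (t - s)\<^sup>2" by simp
  then show "s\<^sup>2 + 2 * s * (t - s) \<le> t\<^sup>2" by (simp add: power2_eq_square algebra_simps)
qed (auto intro!: continuous_intros)

lemma markov_Jensen_exp:
  assumes "f \<in> Linf M" shows "AE x in M. exp (c * R f x) \<le> R (\<lambda>y. exp (c * f y)) x"
proof (rule markov_Jensen[OF assms, where D = "\<lambda>s. c * exp (c * s)"])
  fix s t :: real
  have "exp (c * s) * (1 + (c * t - c * s)) \<le> exp (c * s) * exp (c * t - c * s)"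
    by (intro mult_left_mono exp_ge_add_one_self) auto
  then show "exp (c * s) + c * exp (c * s) * (t - s) \<le> exp (c * t)"
    by (simp add: exp_add[symmetric] algebra_simps)
qed (auto intro!: continuous_intros)

lemma markov_L2_contraction:
  assumes "f \<in> Linf M" shows "(\<integral>x. (R f x)\<^sup>2 \<partial>M) \<le> (\<integral>x. (f x)\<^sup>2 \<partial>M)"
proof -
  have "(\<integral>x. (R f x)\<^sup>2 \<partial>M) \<le> (\<integral>x. R (\<lambda>y. (f y)\<^sup>2) x \<partial>M)"
    using assms markov_Jensen_square[OF assms]
    by (intro integral_mono_AE Linf_integrable Linf_power markov_Linf) auto
  then show ?thesis using assms by (subst (asm) markov_integral) auto
qed

end

lemma markov_operator_id: "markov_operator M (\<lambda>f. f)"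
  by (auto simp: markov_operator_def L1_linear_def positive_op_def)

lemma markov_operator_comp:
  assumes R: "markov_operator M R" and S: "markov_operator M S"
  shows "markov_operator M (R \<circ> S)"
proof -
  have int: "integrable M (R (S f))" "(\<integral>x. R (S f) x \<partial>M) = (\<integral>x. f x \<partial>M)"
    if f: "integrable M f" for f :: "'a \<Rightarrow> real"
    using f R S by auto
  have nonneg: "AE x in M. 0 \<le> R (S f) x"
    if "integrable M f" "AE x in M. 0 \<le> f x" for f :: "'a \<Rightarrow> real"
    using that R S by (intro markov_nonneg[OF R] markov_nonneg[OF S]) auto
  have scale: "AE x in M. R (S (\<lambda>y. c * f y)) x = c * R (S f) x"
    if f: "integrable M f" for f :: "'a \<Rightarrow> real" and c
  proof -
    have "AE x in M. R (S (\<lambda>y. c * f y)) x = R (\<lambda>y. c * S f y) x"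
      using f S by (intro markov_cong[OF R] markov_cmult[OF S]) auto
    with markov_cmult[OF R, of "S f" c] f S show ?thesis by auto
  qed
  have add: "AE x in M. R (S (\<lambda>y. f y + g y)) x = R (S f) x + R (S g) x"
    if f: "integrable M f" and g: "integrable M g" for f g :: "'a \<Rightarrow> real"
  proof -
    have "AE x in M. R (S (\<lambda>y. f y + g y)) x = R (\<lambda>y. S f y + S g y) x"
      using f g S by (intro markov_cong[OF R] markov_add[OF S]) auto
    with markov_add[OF R, of "S f" "S g"] f g S show ?thesis by auto
  qed
  have cong: "AE x in M. R (S f) x = R (S g) x"
    if "integrable M f" "integrable M g" "AE x in M. f x = g x" for f g :: "'a \<Rightarrow> real"
    using that S by (intro markov_cong[OF R] markov_cong[OF S]) auto
  have "AE x in M. R (S (\<lambda>_. 1)) x = R (\<lambda>_. 1) x"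
    using S by (intro markov_cong[OF R] markov_const[OF S]) auto
  with markov_const[OF R, of 1] have one: "AE x in M. R (S (\<lambda>_. 1)) x = 1" by auto
  show ?thesis
    unfolding markov_operator_def L1_linear_def positive_op_def Ball_def Lp_1_iff o_def
    using int nonneg scale add cong one by simp
qed

lemma markov_operator_pow: "markov_operator M R \<Longrightarrow> markov_operator M (R ^^ n)"
  by (induction n) (auto intro: markov_operator_comp simp: markov_operator_id id_def)

end

section \<open>Operators in duality and the maximal inequality of Rota\<close>

definition dual_pair ::
  "'a measure \<Rightarrow> (('a \<Rightarrow> real) \<Rightarrow> 'a \<Rightarrow> real) \<Rightarrow> (('a \<Rightarrow> real) \<Rightarrow> 'a \<Rightarrow> real) \<Rightarrow> bool" where
  "dual_pair M Q S \<longleftrightarrow> markov_operator M Q \<and> markov_operator M S \<and>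
     (\<forall>f\<in>Linf M. \<forall>g\<in>Linf M. (\<integral>x. Q f x * g x \<partial>M) = (\<integral>x. f x * S g x \<partial>M))"

text \<open>
  Up to null sets this is \<open>\<Sum> S\<^sup>n Q\<^sup>n e\<^sub>n\<close> over \<open>n < N\<close>, written in the nested form
  \<open>e\<^sub>0 + S (Q e\<^sub>1 + S (Q\<^sup>2 e\<^sub>2 + \<dots>))\<close>, which is the conditional expectation at time \<open>0\<close> of \<open>\<Sum> (Q\<^sup>n e\<^sub>n)(x\<^sub>n)\<close> along
  the chain with transition operator \<open>S\<close>.
\<close>

primrec potential ::
  "(('a \<Rightarrow> real) \<Rightarrow> 'a \<Rightarrow> real) \<Rightarrow> (('a \<Rightarrow> real) \<Rightarrow> 'a \<Rightarrow> real) \<Rightarrow> nat \<Rightarrow> (nat \<Rightarrow> 'a \<Rightarrow> real) \<Rightarrow> 'a \<Rightarrow> real"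
where
  "potential Q S 0 e = (\<lambda>_. 0)"
| "potential Q S (Suc N) e = (\<lambda>x. e 0 x + S (potential Q S N (\<lambda>i. Q (e (Suc i)))) x)"

text \<open>
  In the same language, the conditional expectation at time \<open>0\<close> of the product of
  \<open>1 + (Q\<^sup>n e\<^sub>n)(x\<^sub>n) / 2\<close> along the chain. It dominates the exponential of a quarter of the potential, and unlike
  that exponential its integral can be computed step by step.
\<close>

primrec path_product ::
  "(('a \<Rightarrow> real) \<Rightarrow> 'a \<Rightarrow> real) \<Rightarrow> (('a \<Rightarrow> real) \<Rightarrow> 'a \<Rightarrow> real) \<Rightarrow> nat \<Rightarrow> (nat \<Rightarrow> 'a \<Rightarrow> real) \<Rightarrow> 'a \<Rightarrow> real"
where
  "path_product Q S 0 e = (\<lambda>_. 1)"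
| "path_product Q S (Suc N) e =
     (\<lambda>x. (1 + e 0 x / 2) * S (path_product Q S N (\<lambda>i. Q (e (Suc i)))) x)"

text \<open>
  Vanishes for \<open>\<psi> \<le> \<epsilon>\<close>; letting the scale \<open>\<epsilon>\<close> vary is what makes maximal bounds arbitrarily small.
\<close>

definition entropy_excess :: "'a measure \<Rightarrow> real \<Rightarrow> ('a \<Rightarrow> real) \<Rightarrow> real" where
  "entropy_excess M \<epsilon> \<psi> = (\<integral>x. \<psi> x * max 0 (ln (\<psi> x / \<epsilon>)) \<partial>M)"

text \<open>
  The Young inequality between \<open>a log a\<close> and the exponential. The scale \<open>\<epsilon>\<close> is free, which later makes
  the maximal inequality small and not only finite; the factor \<open>1/4\<close> is the exponent for which
  the exponential moment below is controlled.
\<close>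

lemma Young_exp:
  fixes a h \<epsilon> :: real
  assumes "a \<ge> 0" "\<epsilon> > 0"
  shows "a * h \<le> 4 * (a * max 0 (ln (a / \<epsilon>)) + \<epsilon> * exp (1 / 4 * h))"
proof (cases "a = 0")
  case False
  then have a: "a > 0" using assms by simp
  define t where "t = h / 4 - ln (a / \<epsilon>)"
  have "a * (1 + t) \<le> a * exp t" by (intro mult_left_mono exp_ge_add_one_self assms)
  also have "a * exp t = \<epsilon> * exp (h / 4)"
    using a assms by (simp add: t_def exp_diff)
  finally have "a * (h / 4) \<le> a * ln (a / \<epsilon>) + \<epsilon> * exp (h / 4)"
    using a by (simp add: t_def algebra_simps)
  also have "a * ln (a / \<epsilon>) \<le> a * max 0 (ln (a / \<epsilon>))" using a by (intro mult_left_mono) auto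
  finally show ?thesis by simp
qed (use assms in auto)

text \<open>
  Linearization of a maximum: \<open>e\<^sub>k\<close> is the indicator of the set on which \<open>X\<^sub>k\<close> is the selected maximum.
\<close>

lemma first_maximum_selection:
  fixes X :: "nat \<Rightarrow> 'a \<Rightarrow> real"
  assumes X: "\<And>k. X k \<in> borel_measurable M"
  shows "\<exists>e. (\<forall>k. e k \<in> borel_measurable M) \<and> (\<forall>k x. 0 \<le> e k x) \<and> (\<forall>k x. e k x \<le> 1) \<and>
    (\<forall>x. (\<Sum>k<N. e k x) \<le> 1) \<and> (\<forall>x. \<forall>k<N. X k x \<le> (\<Sum>k<N. e k x * X k x))"
proof (induction N)
  case 0
  show ?case by (rule exI[of _ "\<lambda>_ _. 0"]) auto
next
  case (Suc N)
  then obtain e where e[measurable]: "\<And>k. e k \<in> borel_measurable M"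
    and e0: "\<And>k x. 0 \<le> e k x" and e1: "\<And>k x. e k x \<le> 1"
    and e: "\<And>x. (\<Sum>k<N. e k x) \<le> 1" "\<And>x k. k < N \<Longrightarrow> X k x \<le> (\<Sum>k<N. e k x * X k x)"
    by blast
  note [measurable] = X
  define s where "s x = (\<Sum>k<N. e k x * X k x)" for x
  have [measurable]: "s \<in> borel_measurable M" unfolding s_def by measurable
  define e' where "e' k x = (if s x < X N x then (if k = N then 1 else 0)
                            else (if k = N then 0 else e k x))" for k x
  have [measurable]: "e' k \<in> borel_measurable M" for k
    unfolding e'_def by measurable
  have sum1: "(\<Sum>k<N. e' k x) = (if s x < X N x then 0 else (\<Sum>k<N. e k x))" for x
    by (auto simp: e'_def intro!: sum.cong sum.neutral)
  have sum2: "(\<Sum>k<N. e' k x * X k x) = (if s x < X N x then 0 else s x)" for x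
    by (auto simp: e'_def s_def intro!: sum.cong sum.neutral)
  show ?case
  proof (intro exI[of _ e'] conjI allI impI)
    show "(\<Sum>k<Suc N. e' k x) \<le> 1" for x using e(1)[of x] by (simp add: sum1) (simp add: e'_def)
    fix x k assume "k < Suc N"
    then show "X k x \<le> (\<Sum>k<Suc N. e' k x * X k x)"
      using e(2)[of k x] by (cases "k = N") (auto simp: sum2, auto simp: e'_def s_def)
  qed (auto simp: e'_def e0 e1)
qed

context prob_space
begin

lemma truncation_tendsto:
  assumes f: "integrable M f"
  shows "(\<lambda>k. \<integral>x. \<bar>f x - max (- real k) (min (real k) (f x))\<bar> \<partial>M) \<longlonglongrightarrow> 0"
proof -
  have [measurable]: "f \<in> borel_measurable M" using f by auto
  have "(\<lambda>k. \<integral>x. \<bar>f x - max (- real k) (min (real k) (f x))\<bar> \<partial>M) \<longlonglongrightarrow> (\<integral>x. 0 \<partial>M)"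
  proof (rule integral_dominated_convergence[where w = "\<lambda>x. \<bar>f x\<bar>"])
    show "AE x in M. (\<lambda>k. \<bar>f x - max (- real k) (min (real k) (f x))\<bar>) \<longlonglongrightarrow> 0"
    proof (rule AE_I2)
      fix x
      obtain K :: nat where "\<bar>f x\<bar> \<le> real K" using real_arch_simple by blast
      then have "\<forall>k\<ge>K. \<bar>f x - max (- real k) (min (real k) (f x))\<bar> = 0" by auto
      then show "(\<lambda>k. \<bar>f x - max (- real k) (min (real k) (f x))\<bar>) \<longlonglongrightarrow> 0"
        by (intro tendsto_eventually) (auto simp: eventually_sequentially)
    qed
    show "AE x in M. norm \<bar>f x - max (- real k) (min (real k) (f x))\<bar> \<le> \<bar>f x\<bar>" for k
      by (rule AE_I2) auto
  qed (use f in auto)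
  then show ?thesis by simp
qed

lemma Linf_truncation:
  assumes "integrable M f" shows "(\<lambda>x. max (- real k) (min (real k) (f x))) \<in> Linf M"
proof -
  have [measurable]: "f \<in> borel_measurable M" using assms by auto
  show ?thesis by (rule LinfI[where B = k]) auto
qed

lemma Linf_entropy_integrable:
  assumes \<psi>: "\<psi> \<in> Linf M" "AE x in M. 0 \<le> \<psi> x" and \<epsilon>: "\<epsilon> > 0"
  shows "integrable M (\<lambda>x. \<psi> x * max 0 (ln (\<psi> x / \<epsilon>)))"
proof -
  obtain B where B: "AE x in M. \<bar>\<psi> x\<bar> \<le> B" "B > 0" using \<psi> by (elim LinfE)
  have [measurable]: "\<psi> \<in> borel_measurable M" using \<psi> by auto
  have "AE x in M. norm (\<psi> x * max 0 (ln (\<psi> x / \<epsilon>))) \<le> B * max 0 (ln (B / \<epsilon>))"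
    using B(1) \<psi>(2)
  proof eventually_elim
    case (elim x)
    have "max 0 (ln (\<psi> x / \<epsilon>)) \<le> max 0 (ln (B / \<epsilon>))" if "\<psi> x > 0"
      using that elim \<epsilon> B(2) by (intro max.mono order_refl) (simp add: divide_right_mono)
    then show ?case using elim B(2) by (cases "\<psi> x = 0") (auto simp: abs_mult intro!: mult_mono)
  qed
  then show ?thesis by (intro integrable_const_bound) auto
qed

text \<open>
  For bounded \<open>f\<close> the contraction in \<open>L\<^sup>1\<close> applied to the nonnegative functions \<open>B + f\<close> and \<open>B - f\<close> gives
  both inequalities; truncation extends the equality to all integrable functions.
\<close>

lemma mp_markov_op_imp_markov_operator:
  assumes "mp_markov_op M R"
  shows "markov_operator M R"
proof -
  have lin: "L1_linear M R" and pos: "positive_op M R" and one: "AE x in M. R (\<lambda>_. 1) x = 1"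
    and "Lp_bounded_by M 1 1 R"
    using assms by (auto simp: mp_markov_op_def)
  then have int: "integrable M (R f)" and contr: "(\<integral>x. \<bar>R f x\<bar> \<partial>M) \<le> (\<integral>x. \<bar>f x\<bar> \<partial>M)"
    if "integrable M f" for f
    using that by (auto simp: Lp_bounded_by_def Lp_1_iff Lp_norm_1)
  have add: "AE x in M. R (\<lambda>y. f y + g y) x = R f x + R g x"
    if "integrable M f" "integrable M g" for f g
    using lin that by (auto simp: L1_linear_def Lp_1_iff)
  have scale: "AE x in M. R (\<lambda>y. c * f y) x = c * R f x" if "integrable M f" for c f
    using lin that by (auto simp: L1_linear_def Lp_1_iff)
  have upper: "(\<integral>x. R f x \<partial>M) \<le> (\<integral>x. f x \<partial>M)" if f: "f \<in> Linf M" for f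
  proof -
    obtain B where B: "AE x in M. \<bar>f x\<bar> \<le> B" using f by (elim LinfE)
    have i: "integrable M f" using f by auto
    have "AE x in M. R (\<lambda>y. f y + B * 1) x = R f x + R (\<lambda>y. B * 1) x"
      by (intro add) (use f in auto)
    moreover have "AE x in M. R (\<lambda>y. B * 1) x = B" using scale[of "\<lambda>_. 1" B] one by auto
    ultimately have "AE x in M. R (\<lambda>y. f y + B * 1) x = R f x + B" by auto
    then have "(\<integral>x. R f x \<partial>M) + B = (\<integral>x. R (\<lambda>y. f y + B * 1) x \<partial>M)"
      using int[OF i] int[of "\<lambda>y. f y + B * 1"] i
      by (subst integral_cong_AE[where g = "\<lambda>x. R f x + B"]) (auto simp: prob_space)
    also have "\<dots> \<le> (\<integral>x. \<bar>R (\<lambda>y. f y + B * 1) x\<bar> \<partial>M)"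
      using int[of "\<lambda>y. f y + B * 1"] i by (intro integral_mono) auto
    also have "\<dots> \<le> (\<integral>x. \<bar>f x + B * 1\<bar> \<partial>M)" using i by (intro contr) auto
    also have "\<dots> = (\<integral>x. f x + B \<partial>M)"
      using i B by (intro integral_cong_AE) auto
    also have "\<dots> = (\<integral>x. f x \<partial>M) + B" using i by (simp add: prob_space)
    finally show ?thesis by simp
  qed
  have bounded: "(\<integral>x. R f x \<partial>M) = (\<integral>x. f x \<partial>M)" if f: "f \<in> Linf M" for f
  proof -
    have "(\<integral>x. R (\<lambda>y. (-1) * f y) x \<partial>M) \<le> (\<integral>x. (-1) * f x \<partial>M)" using f by (intro upper) auto
    also have "(\<integral>x. R (\<lambda>y. (-1) * f y) x \<partial>M) = (\<integral>x. (-1) * R f x \<partial>M)"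
      using scale[of f "-1"] int[of f] int[of "\<lambda>y. (-1) * f y"] f by (intro integral_cong_AE) auto
    finally show ?thesis using upper[OF f] by simp
  qed
  have "(\<integral>x. R f x \<partial>M) = (\<integral>x. f x \<partial>M)" if f: "integrable M f" for f
  proof -
    let ?t = "\<lambda>k x. max (- real k) (min (real k) (f x))"
    have "\<bar>(\<integral>x. R f x \<partial>M) - (\<integral>x. f x \<partial>M)\<bar> \<le> 2 * (\<integral>x. \<bar>f x - ?t k x\<bar> \<partial>M)" for k
    proof -
      define r where "r = (\<lambda>x. f x - ?t k x)"
      have t: "?t k \<in> Linf M" using Linf_truncation[OF f] .
      have r: "integrable M r" using f Linf_integrable[OF t] unfolding r_def by auto
      have "AE x in M. R (\<lambda>y. r y + ?t k y) x = R r x + R (?t k) x" using r t by (intro add) auto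
      then have "AE x in M. R f x = R r x + R (?t k) x" by (simp add: r_def)
      then have "(\<integral>x. R f x \<partial>M) = (\<integral>x. R r x + R (?t k) x \<partial>M)"
        using int[OF r] int[OF f] int[OF Linf_integrable[OF t]] by (intro integral_cong_AE) auto
      also have "\<dots> = (\<integral>x. R r x \<partial>M) + (\<integral>x. ?t k x \<partial>M)"
        using int[OF r] int[OF Linf_integrable[OF t]] bounded[OF t] by simp
      also have "(\<integral>x. ?t k x \<partial>M) = (\<integral>x. f x - r x \<partial>M)" by (simp add: r_def)
      also have "\<dots> = (\<integral>x. f x \<partial>M) - (\<integral>x. r x \<partial>M)" using f r by simp
      finally have "\<bar>(\<integral>x. R f x \<partial>M) - (\<integral>x. f x \<partial>M)\<bar> = \<bar>(\<integral>x. R r x \<partial>M) - (\<integral>x. r x \<partial>M)\<bar>" by simp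
      also have "\<dots> \<le> (\<integral>x. \<bar>R r x\<bar> \<partial>M) + (\<integral>x. \<bar>r x\<bar> \<partial>M)"
        using integral_abs_bound[of M r] integral_abs_bound[of M "R r"] by linarith
      also have "\<dots> \<le> 2 * (\<integral>x. \<bar>r x\<bar> \<partial>M)" using contr[OF r] by simp
      finally show ?thesis by (simp add: r_def)
    qed
    moreover have "(\<lambda>k. 2 * (\<integral>x. \<bar>f x - ?t k x\<bar> \<partial>M)) \<longlonglongrightarrow> 2 * 0"
      by (intro tendsto_intros truncation_tendsto f)
    ultimately have "\<bar>(\<integral>x. R f x \<partial>M) - (\<integral>x. f x \<partial>M)\<bar> \<le> 2 * 0"
      using LIMSEQ_le_const by blast
    then show ?thesis by simp
  qed
  with lin pos one show ?thesis by (auto simp: markov_operator_def)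
qed

lemma markov_operator_cong:
  assumes T: "markov_operator M T" and lin: "L1_linear M R" and eq: "L1_op_eq M R T"
  shows "markov_operator M R"
proof -
  have eq: "AE x in M. R f x = T f x" if "integrable M f" for f
    using eq that by (auto simp: L1_op_eq_def Lp_1_iff)
  have "positive_op M R"
    unfolding positive_op_def
  proof (intro ballI impI)
    fix f assume "f \<in> Lp M 1" "AE x in M. 0 \<le> f x"
    then show "AE x in M. 0 \<le> R f x" using markov_nonneg[OF T, of f] eq[of f] by (auto simp: Lp_1_iff)
  qed
  moreover have "AE x in M. R (\<lambda>_. 1) x = 1" using markov_const[OF T, of 1] eq[of "\<lambda>_. 1"] by auto
  moreover have "(\<integral>x. R f x \<partial>M) = (\<integral>x. f x \<partial>M)" if f: "integrable M f" for f
  proof -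
    have "integrable M (R f)" using lin f by (auto simp: L1_linear_def Lp_1_iff)
    then have "(\<integral>x. R f x \<partial>M) = (\<integral>x. T f x \<partial>M)" using eq[OF f] f T
      by (intro integral_cong_AE) auto
    then show ?thesis using f T by simp
  qed
  ultimately show ?thesis using lin by (auto simp: markov_operator_def)
qed

lemma markov_sum:
  assumes R: "markov_operator M R" and f: "\<And>i. i \<in> I \<Longrightarrow> integrable M (f i)"
  shows "AE x in M. R (\<lambda>y. \<Sum>i\<in>I. f i y) x = (\<Sum>i\<in>I. R (f i) x)"
  using f
proof (induction I rule: infinite_finite_induct)
  case (insert i I)
  have "AE x in M. R (\<lambda>y. f i y + (\<Sum>i\<in>I. f i y)) x = R (f i) x + R (\<lambda>y. \<Sum>i\<in>I. f i y) x"
    using insert by (intro markov_add[OF R]) auto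
  with insert show ?case by auto
qed (use markov_const[OF R, of 0] in auto)

lemma dual_pair_pow:
  assumes "dual_pair M Q S" shows "dual_pair M (Q ^^ n) (S ^^ n)"
proof (induction n)
  case 0
  show ?case by (simp add: dual_pair_def markov_operator_id id_def)
next
  case (Suc n)
  have Q: "markov_operator M Q" and S: "markov_operator M S"
    and adj: "\<And>f g. f \<in> Linf M \<Longrightarrow> g \<in> Linf M \<Longrightarrow> (\<integral>x. Q f x * g x \<partial>M) = (\<integral>x. f x * S g x \<partial>M)"
    using assms by (auto simp: dual_pair_def)
  have "(\<integral>x. (Q ^^ Suc n) f x * g x \<partial>M) = (\<integral>x. f x * (S ^^ Suc n) g x \<partial>M)"
    if fg: "f \<in> Linf M" "g \<in> Linf M" for f g
  proof -
    have "(\<integral>x. (Q ^^ Suc n) f x * g x \<partial>M) = (\<integral>x. (Q ^^ n) f x * S g x \<partial>M)"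
      using fg adj markov_Linf[OF markov_operator_pow[OF Q]] by simp
    also have "\<dots> = (\<integral>x. f x * (S ^^ n) (S g) x \<partial>M)"
      using Suc fg markov_Linf[OF S] by (auto simp: dual_pair_def)
    finally show ?thesis by (simp add: funpow_swap1)
  qed
  then show ?case using markov_operator_pow[OF Q, of "Suc n"] markov_operator_pow[OF S, of "Suc n"]
    unfolding dual_pair_def by blast
qed

context
  fixes Q S assumes QS: "dual_pair M Q S"
begin

lemma dual_markov: "markov_operator M Q" "markov_operator M S"
  using QS by (auto simp: dual_pair_def)

lemma dual_markov_pow: "markov_operator M (Q ^^ n)" "markov_operator M (S ^^ n)"
  using dual_markov markov_operator_pow by auto

lemma dual_adjoint:
  "f \<in> Linf M \<Longrightarrow> g \<in> Linf M \<Longrightarrow> (\<integral>x. Q f x * g x \<partial>M) = (\<integral>x. f x * S g x \<partial>M)"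
  using QS by (auto simp: dual_pair_def)

lemma dual_adjoint_pow:
  "f \<in> Linf M \<Longrightarrow> g \<in> Linf M \<Longrightarrow> (\<integral>x. (Q ^^ n) f x * g x \<partial>M) = (\<integral>x. f x * (S ^^ n) g x \<partial>M)"
  using dual_pair_pow[OF QS, of n] by (auto simp: dual_pair_def)

lemma dual_Linf_pow[intro]:
  "f \<in> Linf M \<Longrightarrow> (Q ^^ n) f \<in> Linf M" "f \<in> Linf M \<Longrightarrow> (S ^^ n) f \<in> Linf M"
  using dual_markov_pow markov_Linf by auto

lemma dual_Linf[intro]:
  "f \<in> Linf M \<Longrightarrow> Q f \<in> Linf M" "f \<in> Linf M \<Longrightarrow> S f \<in> Linf M"
  using dual_markov markov_Linf by auto

lemma potential_Linf: "(\<And>i. e i \<in> Linf M) \<Longrightarrow> potential Q S N e \<in> Linf M"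
  by (induction N arbitrary: e) (simp_all add: Linf_add dual_Linf)

lemma path_product_Linf: "(\<And>i. e i \<in> Linf M) \<Longrightarrow> path_product Q S N e \<in> Linf M"
proof (induction N arbitrary: e)
  case (Suc N)
  have "(\<lambda>x. 1 + (1/2) * e 0 x) \<in> Linf M" using Suc.prems by (intro Linf_add Linf_cmult) auto
  moreover have "path_product Q S N (\<lambda>i. Q (e (Suc i))) \<in> Linf M"
    using Suc.prems by (intro Suc.IH dual_Linf)
  ultimately show ?case by (simp add: Linf_mult dual_Linf)
qed auto

text \<open>
  This is the identity \<open>potential Q S N e = \<Sum> S\<^sup>n Q\<^sup>n e\<^sub>n\<close> in weak form. The weak form avoids an almost
  everywhere bookkeeping of linearity at each level of the recursion.
\<close>

lemma potential_pairing:
  assumes "\<And>i. e i \<in> Linf M" "\<phi> \<in> Linf M"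
  shows "(\<integral>x. \<phi> x * potential Q S N e x \<partial>M) = (\<Sum>n<N. \<integral>x. e n x * (S ^^ n) ((Q ^^ n) \<phi>) x \<partial>M)"
  using assms
proof (induction N arbitrary: e \<phi>)
  case (Suc N)
  let ?e = "\<lambda>i. Q (e (Suc i))"
  have e: "\<And>i. ?e i \<in> Linf M" using Suc.prems by auto
  have P: "potential Q S N ?e \<in> Linf M" using e by (rule potential_Linf)
  have "(\<integral>x. \<phi> x * potential Q S (Suc N) e x \<partial>M)
      = (\<integral>x. e 0 x * \<phi> x + \<phi> x * S (potential Q S N ?e) x \<partial>M)"
    by (simp add: algebra_simps)
  also have "\<dots> = (\<integral>x. e 0 x * \<phi> x \<partial>M) + (\<integral>x. \<phi> x * S (potential Q S N ?e) x \<partial>M)"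
    using Suc.prems P by (intro Bochner_Integration.integral_add Linf_integrable Linf_mult) auto
  also have "(\<integral>x. \<phi> x * S (potential Q S N ?e) x \<partial>M) = (\<integral>x. Q \<phi> x * potential Q S N ?e x \<partial>M)"
    using Suc.prems P by (simp add: dual_adjoint)
  also have "\<dots> = (\<Sum>n<N. \<integral>x. ?e n x * (S ^^ n) ((Q ^^ n) (Q \<phi>)) x \<partial>M)"
    using Suc.prems e by (intro Suc.IH) auto
  also have "\<dots> = (\<Sum>n<N. \<integral>x. e (Suc n) x * (S ^^ Suc n) ((Q ^^ Suc n) \<phi>) x \<partial>M)"
    using Suc.prems by (intro sum.cong refl) (auto simp: dual_adjoint dual_Linf dual_Linf_pow funpow_swap1)
  finally show ?case by (simp add: sum.lessThan_Suc_shift del: sum.lessThan_Suc funpow.simps(2))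
qed auto

lemma path_product_nonneg:
  assumes "\<And>i. e i \<in> Linf M" "\<And>i. AE x in M. 0 \<le> e i x"
  shows "AE x in M. 0 \<le> path_product Q S N e x"
  using assms
proof (induction N arbitrary: e)
  case (Suc N)
  let ?e = "\<lambda>i. Q (e (Suc i))"
  have "AE x in M. 0 \<le> path_product Q S N ?e x"
    using Suc.prems by (intro Suc.IH markov_nonneg[OF dual_markov(1)]) auto
  then have "AE x in M. 0 \<le> S (path_product Q S N ?e) x"
    using Suc.prems by (intro markov_nonneg[OF dual_markov(2)] Linf_integrable path_product_Linf) auto
  with Suc.prems(2)[of 0] show ?case by auto
qed auto

text \<open>
  By Jensen, \<open>exp\<close> may be moved inside each \<open>S\<close>; at every level \<open>exp (t/4) \<le> 1 + t/2\<close> for \<open>0 \<le> t \<le> 1\<close>.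
\<close>

lemma exp_potential_le:
  assumes "\<And>i. e i \<in> Linf M" "\<And>i. AE x in M. 0 \<le> e i x" "\<And>i. AE x in M. e i x \<le> 1"
  shows "AE x in M. exp (1 / 4 * potential Q S N e x) \<le> path_product Q S N e x"
  using assms
proof (induction N arbitrary: e)
  case (Suc N)
  let ?e = "\<lambda>i. Q (e (Suc i))"
  let ?P = "potential Q S N ?e"
  have e: "\<And>i. ?e i \<in> Linf M" using Suc.prems by auto
  have P: "?P \<in> Linf M" using e by (rule potential_Linf)
  have "AE x in M. exp (1 / 4 * ?P x) \<le> path_product Q S N ?e x"
    using Suc.prems e
    by (intro Suc.IH markov_nonneg[OF dual_markov(1)] markov_upper[OF dual_markov(1)]) auto
  then have "AE x in M. S (\<lambda>y. exp (1 / 4 * ?P y)) x \<le> S (path_product Q S N ?e) x"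
    using P e by (intro markov_mono[OF dual_markov(2)] Linf_integrable path_product_Linf
        Linf_exp) auto
  moreover have "AE x in M. exp (1 / 4 * S ?P x) \<le> S (\<lambda>y. exp (1 / 4 * ?P y)) x"
    using P by (rule markov_Jensen_exp[OF dual_markov(2)])
  ultimately show ?case using Suc.prems(2,3)[of 0]
  proof eventually_elim
    case (elim x)
    have "exp (1 / 4 * e 0 x) \<le> 1 + 1 / 4 * e 0 x + (1 / 4 * e 0 x)\<^sup>2"
      using elim by (intro exp_bound) auto
    also have "(1 / 4 * e 0 x)\<^sup>2 \<le> 1 / 4 * e 0 x"
      using elim mult_left_le[of "e 0 x" "e 0 x"] by (simp add: power2_eq_square)
    finally have "exp (1 / 4 * e 0 x) \<le> 1 + e 0 x / 2" by simp
    then have "exp (1 / 4 * e 0 x) * exp (1 / 4 * S ?P x) \<le> (1 + e 0 x / 2) * S (path_product Q S N ?e) x"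
      using elim by (intro mult_mono) auto
    then show ?case by (simp add: exp_add[symmetric] algebra_simps)
  qed
qed auto

text \<open>
  The weight \<open>w\<close> carries the mass of the functions already treated, pushed forward by \<open>Q\<close>. One step
  replaces \<open>w\<close> by \<open>Q (w + e\<^sub>0)\<close> and does not decrease the integral, because
  \<open>(1 + w) (1 + e\<^sub>0 / 2) \<le> 1 + (w + e\<^sub>0)\<close> as long as \<open>w \<le> 1\<close>. When all functions are used up, \<open>1 + w \<le> 2\<close>.
\<close>

lemma path_product_integral:
  assumes "\<And>i. e i \<in> Linf M" "\<And>i. AE x in M. 0 \<le> e i x"
    and "w \<in> Linf M" "AE x in M. 0 \<le> w x" "AE x in M. w x + (\<Sum>i<N. e i x) \<le> 1"
  shows "(\<integral>x. (1 + w x) * path_product Q S N e x \<partial>M) \<le> 2"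
  using assms
proof (induction N arbitrary: e w)
  case 0
  have "(\<integral>x. (1 + w x) * path_product Q S 0 e x \<partial>M) \<le> (\<integral>x. 2 \<partial>M)"
    using 0 by (intro integral_mono_AE) auto
  then show ?case by (simp add: prob_space)
next
  case (Suc N)
  let ?e = "\<lambda>i. Q (e (Suc i))"
  let ?w = "\<lambda>x. w x + e 0 x"
  let ?G = "path_product Q S N ?e"
  have e: "\<And>i. ?e i \<in> Linf M" "\<And>i. AE x in M. 0 \<le> ?e i x"
    using Suc.prems(1,2) by (auto intro!: markov_nonneg[OF dual_markov(1)])
  have G: "?G \<in> Linf M" using e(1) by (rule path_product_Linf)
  have SG: "AE x in M. 0 \<le> S ?G x"
    using path_product_nonneg[OF e] G by (intro markov_nonneg[OF dual_markov(2)]) auto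
  have le1: "AE x in M. w x \<le> 1"
  proof -
    have "AE x in M. \<forall>i. 0 \<le> e i x" using Suc.prems(2) by (simp add: AE_all_countable)
    with Suc.prems(5) show ?thesis
    proof eventually_elim
      case (elim x)
      then have "0 \<le> (\<Sum>i<Suc N. e i x)" by (intro sum_nonneg) auto
      with elim show ?case by linarith
    qed
  qed
  have w: "?w \<in> Linf M" "Q ?w \<in> Linf M" using Suc.prems by auto
  have "(\<integral>x. (1 + w x) * path_product Q S (Suc N) e x \<partial>M) \<le> (\<integral>x. (1 + ?w x) * S ?G x \<partial>M)"
  proof (rule integral_mono_AE)
    show "integrable M (\<lambda>x. (1 + w x) * path_product Q S (Suc N) e x)"
      using Suc.prems by (intro Linf_integrable Linf_mult Linf_add path_product_Linf) auto
    show "integrable M (\<lambda>x. (1 + ?w x) * S ?G x)"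
      using Suc.prems G by (intro Linf_integrable Linf_mult Linf_add) auto
    show "AE x in M. (1 + w x) * path_product Q S (Suc N) e x \<le> (1 + ?w x) * S ?G x"
      using SG le1 Suc.prems(4) Suc.prems(2)[of 0]
    proof eventually_elim
      case (elim x)
      have "w x * e 0 x \<le> 1 * e 0 x" using elim by (intro mult_right_mono) auto
      then have "(1 + w x) * (1 + e 0 x / 2) \<le> 1 + ?w x" by (simp add: algebra_simps)
      then have "((1 + w x) * (1 + e 0 x / 2)) * S ?G x \<le> (1 + ?w x) * S ?G x"
        using elim by (intro mult_right_mono)
      then show ?case by (simp add: mult.assoc)
    qed
  qed
  also have "\<dots> = (\<integral>x. Q (\<lambda>y. ?w y + 1) x * ?G x \<partial>M)"
    using w G Linf_add[OF w(1) Linf_const[of 1]] by (subst dual_adjoint) (auto simp: algebra_simps)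
  also have "\<dots> = (\<integral>x. (1 + Q ?w x) * ?G x \<partial>M)"
  proof (rule integral_cong_AE)
    show "AE x in M. Q (\<lambda>y. ?w y + 1) x * ?G x = (1 + Q ?w x) * ?G x"
      using markov_affine[OF dual_markov(1), of ?w 1 1] w by auto
    have "(\<lambda>x. Q (\<lambda>y. ?w y + 1) x * ?G x) \<in> Linf M" "(\<lambda>x. (1 + Q ?w x) * ?G x) \<in> Linf M"
      using w G Suc.prems by (auto intro!: Linf_mult Linf_add)
    then show "(\<lambda>x. Q (\<lambda>y. ?w y + 1) x * ?G x) \<in> borel_measurable M"
      "(\<lambda>x. (1 + Q ?w x) * ?G x) \<in> borel_measurable M" by (auto dest: Linf_measurable)
  qed
  also have "\<dots> \<le> 2"
  proof (rule Suc.IH[OF e w(2)])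
    show "AE x in M. 0 \<le> Q ?w x"
      using Suc.prems(4) Suc.prems(2)[of 0] w by (intro markov_nonneg[OF dual_markov(1)]) auto
    let ?s = "\<lambda>y. \<Sum>i<N. e (Suc i) y"
    have s: "?s \<in> Linf M" using Suc.prems by auto
    have "AE x in M. Q (\<lambda>y. ?w y + ?s y) x \<le> 1"
      using Suc.prems s by (intro markov_upper[OF dual_markov(1)])
        (auto simp: sum.lessThan_Suc_shift add.assoc simp del: sum.lessThan_Suc)
    moreover have "AE x in M. Q (\<lambda>y. ?w y + ?s y) x = Q ?w x + Q ?s x"
      using w s by (intro markov_add[OF dual_markov(1)]) auto
    moreover have "AE x in M. Q ?s x = (\<Sum>i<N. ?e i x)"
      using Suc.prems by (intro markov_sum[OF dual_markov(1)]) auto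
    ultimately show "AE x in M. Q ?w x + (\<Sum>i<N. ?e i x) \<le> 1" by auto
  qed
  finally show ?case .
qed

lemma potential_exp_integral:
  assumes "\<And>i. e i \<in> Linf M" "\<And>i. AE x in M. 0 \<le> e i x" "\<And>i. AE x in M. e i x \<le> 1"
    and "AE x in M. (\<Sum>i<N. e i x) \<le> 1"
  shows "(\<integral>x. exp (1 / 4 * potential Q S N e x) \<partial>M) \<le> 2"
proof -
  have "(\<integral>x. exp (1 / 4 * potential Q S N e x) \<partial>M) \<le> (\<integral>x. path_product Q S N e x \<partial>M)"
    using assms by (intro integral_mono_AE exp_potential_le Linf_integrable path_product_Linf
        Linf_exp potential_Linf) auto
  also have "\<dots> \<le> 2"
    using path_product_integral[of e "\<lambda>_. 0" N] assms by auto
  finally show ?thesis .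
qed

text \<open>
  The extra powers account for the shifts \<open>j\<close> in the domination hypothesis: \<open>S\<^sup>r\<close> for negative and \<open>Q\<^sup>i\<close>
  for positive \<open>j\<close>. The first is moved onto the functions \<open>e\<^sub>k\<close>, the second onto the potential, whose
  exponential moment it does not increase by Jensen.
\<close>

lemma Rota_linearized:
  assumes e: "\<And>i. e i \<in> Linf M" "\<And>i. AE x in M. 0 \<le> e i x" "\<And>i. AE x in M. e i x \<le> 1"
    "AE x in M. (\<Sum>i<N. e i x) \<le> 1"
    and \<psi>: "\<psi> \<in> Linf M" "AE x in M. 0 \<le> \<psi> x" and \<epsilon>: "\<epsilon> > 0"
  shows "(\<Sum>k<N. \<integral>x. e k x * (S ^^ r) ((S ^^ k) ((Q ^^ k) ((Q ^^ i) \<psi>))) x \<partial>M)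
           \<le> 4 * (entropy_excess M \<epsilon> \<psi> + 2 * \<epsilon>)"
proof -
  define e' where "e' k = (Q ^^ r) (e k)" for k
  have e'L: "\<And>k. e' k \<in> Linf M" unfolding e'_def using e by auto
  have e'0: "\<And>k. AE x in M. 0 \<le> e' k x"
    unfolding e'_def using e by (intro markov_nonneg[OF dual_markov_pow(1)]) auto
  have e'1: "\<And>k. AE x in M. e' k x \<le> 1"
    unfolding e'_def using e by (intro markov_upper[OF dual_markov_pow(1)]) auto
  have e's: "AE x in M. (\<Sum>k<N. e' k x) \<le> 1"
  proof -
    have "AE x in M. (Q ^^ r) (\<lambda>y. \<Sum>k<N. e k y) x = (\<Sum>k<N. e' k x)"
      unfolding e'_def using e by (intro markov_sum[OF dual_markov_pow(1)]) auto
    moreover have "AE x in M. (Q ^^ r) (\<lambda>y. \<Sum>k<N. e k y) x \<le> 1"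
      using e by (intro markov_upper[OF dual_markov_pow(1)]) auto
    ultimately show ?thesis by auto
  qed
  define P where "P = potential Q S N e'"
  have P: "P \<in> Linf M" unfolding P_def using e'L by (rule potential_Linf)
  have expP: "(\<lambda>x. exp (1 / 4 * P x)) \<in> Linf M" "(\<lambda>x. exp (1 / 4 * (S ^^ i) P x)) \<in> Linf M"
    using P by (intro Linf_exp; auto)+
  have ent: "integrable M (\<lambda>x. \<psi> x * max 0 (ln (\<psi> x / \<epsilon>)))"
    using \<psi> \<epsilon> by (rule Linf_entropy_integrable)
  have "(\<Sum>k<N. \<integral>x. e k x * (S ^^ r) ((S ^^ k) ((Q ^^ k) ((Q ^^ i) \<psi>))) x \<partial>M)
      = (\<Sum>k<N. \<integral>x. e' k x * (S ^^ k) ((Q ^^ k) ((Q ^^ i) \<psi>)) x \<partial>M)"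
    unfolding e'_def using e \<psi> by (intro sum.cong refl dual_adjoint_pow[symmetric]) auto
  also have "\<dots> = (\<integral>x. (Q ^^ i) \<psi> x * P x \<partial>M)"
    unfolding P_def using \<psi> e'L by (intro potential_pairing[symmetric]) auto
  also have "\<dots> = (\<integral>x. \<psi> x * (S ^^ i) P x \<partial>M)"
    using \<psi> P by (intro dual_adjoint_pow) auto
  also have "\<dots> \<le> (\<integral>x. 4 * (\<psi> x * max 0 (ln (\<psi> x / \<epsilon>)) + \<epsilon> * exp (1 / 4 * (S ^^ i) P x)) \<partial>M)"
  proof (rule integral_mono_AE)
    show "integrable M (\<lambda>x. \<psi> x * (S ^^ i) P x)"
      using \<psi> P by (intro Linf_integrable Linf_mult) auto
    show "integrable M (\<lambda>x. 4 * (\<psi> x * max 0 (ln (\<psi> x / \<epsilon>)) + \<epsilon> * exp (1 / 4 * (S ^^ i) P x)))"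
      using ent Linf_integrable[OF expP(2)] by auto
    show "AE x in M. \<psi> x * (S ^^ i) P x
            \<le> 4 * (\<psi> x * max 0 (ln (\<psi> x / \<epsilon>)) + \<epsilon> * exp (1 / 4 * (S ^^ i) P x))"
      using \<psi>(2) by eventually_elim (rule Young_exp, use \<epsilon> in auto)
  qed
  also have "\<dots> = 4 * (entropy_excess M \<epsilon> \<psi> + \<epsilon> * (\<integral>x. exp (1 / 4 * (S ^^ i) P x) \<partial>M))"
    using ent Linf_integrable[OF expP(2)] by (simp add: entropy_excess_def)
  also have "(\<integral>x. exp (1 / 4 * (S ^^ i) P x) \<partial>M) \<le> (\<integral>x. (S ^^ i) (\<lambda>y. exp (1 / 4 * P y)) x \<partial>M)"
    using expP P by (intro integral_mono_AE markov_Jensen_exp[OF dual_markov_pow(2)] Linf_integrable) auto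
  also have "\<dots> = (\<integral>x. exp (1 / 4 * P x) \<partial>M)"
    using expP by (intro markov_integral[OF dual_markov_pow(2)]) auto
  also have "\<dots> \<le> 2" unfolding P_def by (rule potential_exp_integral[OF e'L e'0 e'1 e's])
  finally show ?thesis using \<epsilon> by (simp add: mult.commute)
qed

lemma Rota_maximal:
  assumes \<psi>: "\<psi> \<in> Linf M" "AE x in M. 0 \<le> \<psi> x" and \<epsilon>: "\<epsilon> > 0"
  shows "\<exists>Z\<in>Linf M. (\<forall>k<N. \<forall>x. (S ^^ r) ((S ^^ k) ((Q ^^ k) ((Q ^^ i) \<psi>))) x \<le> Z x) \<and>
           (\<integral>x. Z x \<partial>M) \<le> 4 * (entropy_excess M \<epsilon> \<psi> + 2 * \<epsilon>)"
proof -
  let ?X = "\<lambda>k. (S ^^ r) ((S ^^ k) ((Q ^^ k) ((Q ^^ i) \<psi>)))"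
  have X: "\<And>k. ?X k \<in> Linf M" using \<psi> by auto
  then have "\<And>k. ?X k \<in> borel_measurable M" by auto
  from first_maximum_selection[of ?X, OF this, where N = N]
  obtain e where e: "\<And>k. e k \<in> borel_measurable M" "\<And>k x. 0 \<le> e k x" "\<And>k x. e k x \<le> 1"
    "\<And>x. (\<Sum>k<N. e k x) \<le> 1" "\<And>x k. k < N \<Longrightarrow> ?X k x \<le> (\<Sum>k<N. e k x * ?X k x)"
    by blast
  have eL: "\<And>k. e k \<in> Linf M" using e by (intro LinfI[where B = 1]) auto
  let ?Z = "\<lambda>x. \<Sum>k<N. e k x * ?X k x"
  have "?Z \<in> Linf M" using eL X by (intro Linf_sum Linf_mult)
  moreover have "(\<integral>x. ?Z x \<partial>M) = (\<Sum>k<N. \<integral>x. e k x * ?X k x \<partial>M)"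
    using eL X by (intro Bochner_Integration.integral_sum Linf_integrable Linf_mult)
  moreover have "\<dots> \<le> 4 * (entropy_excess M \<epsilon> \<psi> + 2 * \<epsilon>)"
    using e eL \<psi> \<epsilon> by (intro Rota_linearized) auto
  ultimately show ?thesis using e(5) by (intro bexI[of _ ?Z]) auto
qed

end

end

section \<open>Energy, mixing and nonconstant tail variables\<close>

context prob_space
begin

lemma square_integral_le:
  assumes "f \<in> Linf M" shows "(\<integral>x. f x \<partial>M)\<^sup>2 \<le> (\<integral>x. (f x)\<^sup>2 \<partial>M)"
proof -
  let ?\<mu> = "\<integral>x. f x \<partial>M"
  have "0 \<le> (\<integral>x. (f x - ?\<mu>)\<^sup>2 \<partial>M)" by (rule integral_nonneg_AE) simp
  also have "\<dots> = (\<integral>x. (f x)\<^sup>2 - 2 * ?\<mu> * f x + ?\<mu>\<^sup>2 \<partial>M)" by (simp add: power2_diff algebra_simps)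
  also have "\<dots> = (\<integral>x. (f x)\<^sup>2 \<partial>M) - 2 * ?\<mu> * ?\<mu> + ?\<mu>\<^sup>2"
    using assms Linf_integrable[OF Linf_power[OF assms, of 2]] by (simp add: prob_space)
  finally show ?thesis by (simp add: power2_eq_square)
qed

lemma L1_le_sqrt_L2:
  assumes "f \<in> Linf M" shows "(\<integral>x. \<bar>f x\<bar> \<partial>M) \<le> sqrt (\<integral>x. (f x)\<^sup>2 \<partial>M)"
  using square_integral_le[OF Linf_abs[OF assms]] by (simp add: real_le_rsqrt)

lemma abs_integral_mult_le:
  assumes f: "f \<in> Linf M" and g: "g \<in> Linf M" "AE x in M. \<bar>g x\<bar> \<le> B"
  shows "\<bar>\<integral>x. f x * g x \<partial>M\<bar> \<le> B * (\<integral>x. \<bar>f x\<bar> \<partial>M)"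
proof -
  have "\<bar>\<integral>x. f x * g x \<partial>M\<bar> \<le> (\<integral>x. \<bar>f x * g x\<bar> \<partial>M)" by (rule integral_abs_bound)
  also have "\<dots> \<le> (\<integral>x. B * \<bar>f x\<bar> \<partial>M)"
  proof (rule integral_mono_AE)
    show "AE x in M. \<bar>f x * g x\<bar> \<le> B * \<bar>f x\<bar>"
      using g(2) by eventually_elim (simp add: abs_mult mult.commute[of B] mult_left_mono)
  qed (use f g in \<open>auto intro!: Linf_integrable\<close>)
  finally show ?thesis by simp
qed

text \<open>
  If \<open>R\<close> is given by a kernel, \<open>R (f\<^sup>2) - (R f)\<^sup>2\<close> is the pointwise variance of \<open>f\<close>, and the variance of a product
  \<open>u v\<close> is at most its second moment about the constant \<open>c d\<close>, where \<open>c\<close> and \<open>d\<close> are the means of \<open>u\<close> and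
  \<open>v\<close>. Without a kernel the constants must be fixed before \<open>R\<close> is applied; rational ones suffice by
  continuity.
\<close>

lemma markov_product_variance:
  assumes R: "markov_operator M R" and u: "u \<in> Linf M" and v: "v \<in> Linf M"
    and uB: "AE x in M. \<bar>u x\<bar> \<le> B" and vB: "AE x in M. \<bar>v x\<bar> \<le> B"
  shows "(\<integral>x. (u x * v x)\<^sup>2 \<partial>M) - (\<integral>x. (R (\<lambda>x. u x * v x) x)\<^sup>2 \<partial>M) \<le>
    2 * B\<^sup>2 * (((\<integral>x. (u x)\<^sup>2 \<partial>M) - (\<integral>x. (R u x)\<^sup>2 \<partial>M)) + ((\<integral>x. (v x)\<^sup>2 \<partial>M) - (\<integral>x. (R v x)\<^sup>2 \<partial>M)))"
proof -
  let ?uv = "\<lambda>x. u x * v x"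
  let ?sq = "\<lambda>(f :: 'a \<Rightarrow> real) x. (f x)\<^sup>2"
  have uv: "?uv \<in> Linf M" using u v by (rule Linf_mult)
  have sq: "?sq u \<in> Linf M" "?sq v \<in> Linf M" "?sq ?uv \<in> Linf M"
    using u v uv by (auto intro: Linf_power)
  have R_quadratic: "AE x in M. R (\<lambda>y. \<alpha> * (f y)\<^sup>2 + (\<beta> * f y + \<gamma>)) x = \<alpha> * R (?sq f) x + (\<beta> * R f x + \<gamma>)"
    if f: "f \<in> Linf M" for f \<alpha> \<beta> \<gamma>
  proof -
    have "AE x in M. R (\<lambda>y. \<alpha> * (f y)\<^sup>2 + (\<beta> * f y + \<gamma>)) x
        = R (\<lambda>y. \<alpha> * (f y)\<^sup>2) x + R (\<lambda>y. \<beta> * f y + \<gamma>) x"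
      using f by (intro markov_add[OF R] Linf_integrable) (auto intro!: Linf_power Linf_cmult Linf_add)
    with markov_cmult[OF R Linf_integrable[OF Linf_power[OF f, of 2]], of \<alpha>]
      markov_affine[OF R Linf_integrable[OF f], of \<beta> \<gamma>]
    show ?thesis by eventually_elim simp
  qed
  let ?lhs = "\<lambda>x c d. R (?sq ?uv) x - 2 * (c * d) * R ?uv x + (c * d)\<^sup>2"
  let ?rhs = "\<lambda>x c d. 2 * B\<^sup>2 * (R (?sq u) x - 2 * c * R u x + c\<^sup>2)
                + 2 * c\<^sup>2 * (R (?sq v) x - 2 * d * R v x + d\<^sup>2)"
  have rational: "AE x in M. ?lhs x c d \<le> ?rhs x c d" for c d
  proof -
    let ?g = "\<lambda>y. 2 * B\<^sup>2 * (u y)\<^sup>2 + ((- 4 * B\<^sup>2 * c) * u y + 2 * B\<^sup>2 * c\<^sup>2)"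
    let ?h = "\<lambda>y. 2 * c\<^sup>2 * (v y)\<^sup>2 + ((- 4 * c\<^sup>2 * d) * v y + 2 * c\<^sup>2 * d\<^sup>2)"
    have gh: "?g \<in> Linf M" "?h \<in> Linf M"
      using u v by (auto intro!: Linf_power Linf_cmult Linf_add)
    have "AE x in M. R (\<lambda>y. 1 * (?uv y)\<^sup>2 + ((- 2 * (c * d)) * ?uv y + (c * d)\<^sup>2)) x \<le> R (\<lambda>y. ?g y + ?h y) x"
    proof (rule markov_mono[OF R])
      show "AE y in M. 1 * (?uv y)\<^sup>2 + ((- 2 * (c * d)) * ?uv y + (c * d)\<^sup>2) \<le> ?g y + ?h y"
        using vB
      proof eventually_elim
        case (elim y)
        have "\<bar>v y\<bar>\<^sup>2 \<le> B\<^sup>2" using elim by (intro power_mono) auto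
        then have 1: "(u y - c)\<^sup>2 * (v y)\<^sup>2 \<le> (u y - c)\<^sup>2 * B\<^sup>2" by (intro mult_left_mono) auto
        have 2: "0 \<le> ((u y - c) * v y - c * (v y - d))\<^sup>2" by simp
        have "1 * (?uv y)\<^sup>2 + ((- 2 * (c * d)) * ?uv y + (c * d)\<^sup>2)
            = 2 * ((u y - c)\<^sup>2 * (v y)\<^sup>2) + 2 * c\<^sup>2 * (v y - d)\<^sup>2 - ((u y - c) * v y - c * (v y - d))\<^sup>2"
          by algebra
        also have "\<dots> \<le> 2 * ((u y - c)\<^sup>2 * B\<^sup>2) + 2 * c\<^sup>2 * (v y - d)\<^sup>2" using 1 2 by linarith
        also have "\<dots> = ?g y + ?h y" by algebra
        finally show ?case .
      qed
    qed (use uv gh in \<open>auto intro!: Linf_integrable Linf_power Linf_cmult Linf_add\<close>)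
    moreover have "AE x in M. R (\<lambda>y. ?g y + ?h y) x = R ?g x + R ?h x"
      using gh by (intro markov_add[OF R] Linf_integrable)
    ultimately show ?thesis
      using R_quadratic[OF u, of "2 * B\<^sup>2" "- 4 * B\<^sup>2 * c" "2 * B\<^sup>2 * c\<^sup>2"]
        R_quadratic[OF v, of "2 * c\<^sup>2" "- 4 * c\<^sup>2 * d" "2 * c\<^sup>2 * d\<^sup>2"]
        R_quadratic[OF uv, of 1 "- 2 * (c * d)" "(c * d)\<^sup>2"]
      by eventually_elim (simp add: algebra_simps)
  qed
  have "AE x in M. \<forall>c\<in>\<rat>. \<forall>d\<in>\<rat>. ?lhs x c d \<le> ?rhs x c d"
    using rational by (simp add: AE_ball_countable countable_rat)
  then have pointwise: "AE x in M. R (?sq ?uv) x - (R ?uv x)\<^sup>2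
      \<le> 2 * B\<^sup>2 * ((R (?sq u) x - (R u x)\<^sup>2) + (R (?sq v) x - (R v x)\<^sup>2))"
    using markov_bounded[OF R Linf_measurable[OF u] uB] markov_Jensen_square[OF R v]
  proof eventually_elim
    case (elim x)
    let ?T = "{p. ?lhs x (fst p) (snd p) \<le> ?rhs x (fst p) (snd p)}"
    have "closed ?T" by (intro closed_Collect_le continuous_intros)
    moreover have "\<rat> \<times> \<rat> \<subseteq> ?T" using elim(1) by auto
    ultimately have "closure (\<rat> \<times> \<rat>) \<subseteq> ?T" by (rule closure_minimal[rotated])
    then have sub: "UNIV \<subseteq> ?T" unfolding closure_Times Rats_closure_real by simp
    have "(R u x, R v x) \<in> ?T" by (rule subsetD[OF sub UNIV_I])
    then have le: "?lhs x (R u x) (R v x) \<le> ?rhs x (R u x) (R v x)" by simp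
    have "\<bar>R u x\<bar>\<^sup>2 \<le> B\<^sup>2" using elim by (intro power_mono) auto
    then have 1: "(R u x)\<^sup>2 * (R (?sq v) x - (R v x)\<^sup>2) \<le> B\<^sup>2 * (R (?sq v) x - (R v x)\<^sup>2)"
      using elim by (intro mult_right_mono) auto
    have 2: "0 \<le> (R ?uv x - R u x * R v x)\<^sup>2" by simp
    have "?lhs x (R u x) (R v x) = R (?sq ?uv) x - (R ?uv x)\<^sup>2 + (R ?uv x - R u x * R v x)\<^sup>2"
      by algebra
    moreover have "?rhs x (R u x) (R v x)
        = 2 * (B\<^sup>2 * (R (?sq u) x - (R u x)\<^sup>2)) + 2 * ((R u x)\<^sup>2 * (R (?sq v) x - (R v x)\<^sup>2))"
      by algebra
    ultimately have "R (?sq ?uv) x - (R ?uv x)\<^sup>2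
        \<le> 2 * (B\<^sup>2 * (R (?sq u) x - (R u x)\<^sup>2)) + 2 * (B\<^sup>2 * (R (?sq v) x - (R v x)\<^sup>2))"
      using le 1 2 by linarith
    then show ?case by (simp add: algebra_simps)
  qed
  have defect_L: "(\<lambda>x. R (?sq f) x - (R f x)\<^sup>2) \<in> Linf M" if "f \<in> Linf M" for f
    using that by (intro Linf_diff Linf_power markov_Linf[OF R])
  have defect: "(\<integral>x. R (?sq f) x - (R f x)\<^sup>2 \<partial>M) = (\<integral>x. (f x)\<^sup>2 \<partial>M) - (\<integral>x. (R f x)\<^sup>2 \<partial>M)"
    if f: "f \<in> Linf M" for f
  proof -
    have "integrable M (R (?sq f))" "integrable M (?sq (R f))"
      using f by (auto intro!: Linf_integrable markov_Linf[OF R] Linf_power)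
    then show ?thesis
      using markov_integral[OF R Linf_integrable[OF Linf_power[OF f, of 2]]] by simp
  qed
  have "(\<integral>x. R (?sq ?uv) x - (R ?uv x)\<^sup>2 \<partial>M)
      \<le> (\<integral>x. 2 * B\<^sup>2 * ((R (?sq u) x - (R u x)\<^sup>2) + (R (?sq v) x - (R v x)\<^sup>2)) \<partial>M)"
    by (intro integral_mono_AE pointwise Linf_integrable Linf_mult Linf_const Linf_add defect_L u v uv)
  also have "\<dots> = 2 * B\<^sup>2 * ((\<integral>x. R (?sq u) x - (R u x)\<^sup>2 \<partial>M) + (\<integral>x. R (?sq v) x - (R v x)\<^sup>2 \<partial>M))"
    using Linf_integrable[OF defect_L[OF u]] Linf_integrable[OF defect_L[OF v]]
    by (subst integral_mult_right_zero, subst Bochner_Integration.integral_add) auto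
  finally show ?thesis unfolding defect[OF u] defect[OF v] defect[OF uv] .
qed

text \<open>
  A uniform bound makes completeness elementary: a subsequence with summable mean increments converges
  almost everywhere, and dominated convergence identifies its limit in the mean square.
\<close>

lemma bounded_L2_complete:
  fixes g :: "nat \<Rightarrow> 'a \<Rightarrow> real"
  assumes g: "\<And>n. g n \<in> borel_measurable M" "\<And>n. AE x in M. \<bar>g n x\<bar> \<le> B"
    and Cauchy: "\<And>e. e > 0 \<Longrightarrow> \<exists>N. \<forall>n\<ge>N. \<forall>k\<ge>N. (\<integral>x. (g n x - g k x)\<^sup>2 \<partial>M) < e"
  shows "\<exists>h\<in>Linf M. (\<lambda>n. \<integral>x. (g n x - h x)\<^sup>2 \<partial>M) \<longlonglongrightarrow> 0"
proof -
  note [measurable] = g(1)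
  have gL: "g n \<in> Linf M" for n using g by (intro LinfI)
  have "\<forall>i. \<exists>N. \<forall>n\<ge>N. \<forall>k\<ge>N. (\<integral>x. (g n x - g k x)\<^sup>2 \<partial>M) < (1/4)^i"
    by (intro allI Cauchy) simp
  from choice[OF this] obtain N where
    N: "\<And>i n k. n \<ge> N i \<Longrightarrow> k \<ge> N i \<Longrightarrow> (\<integral>x. (g n x - g k x)\<^sup>2 \<partial>M) < (1/4)^i" by blast
  \<comment> \<open>The summand \<open>i\<close> makes the subsequence unbounded even if the indices \<open>N j\<close> are not.\<close>
  define r where "r i = i + (\<Sum>j\<le>i. N j)" for i
  have r1: "N i \<le> r i" for i unfolding r_def by (auto intro!: trans_le_add2 member_le_sum)
  have r2: "N i \<le> r (Suc i)" for i using r1[of i] by (simp add: r_def)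
  let ?d = "\<lambda>i x. \<bar>g (r (Suc i)) x - g (r i) x\<bar>"
  have dL: "?d i \<in> Linf M" for i by (intro Linf_abs Linf_diff gL)
  have d: "(\<integral>x. ?d i x \<partial>M) \<le> (1/2)^i" for i
  proof -
    have "(\<integral>x. ?d i x \<partial>M) \<le> sqrt (\<integral>x. (g (r (Suc i)) x - g (r i) x)\<^sup>2 \<partial>M)"
      using gL by (intro L1_le_sqrt_L2) auto
    also have "\<dots> \<le> sqrt ((1/4)^i)" using N[OF r2 r1] by (intro real_sqrt_le_mono) (rule less_imp_le)
    also have "\<dots> = (1/2)^i" by (simp add: real_sqrt_power real_sqrt_divide)
    finally show ?thesis .
  qed
  have "(\<integral>\<^sup>+x. (\<Sum>i. ennreal (?d i x)) \<partial>M) = (\<Sum>i. \<integral>\<^sup>+x. ennreal (?d i x) \<partial>M)"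
    by (intro nn_integral_suminf) simp
  also have "\<dots> = (\<Sum>i. ennreal (\<integral>x. ?d i x \<partial>M))"
    using dL by (subst nn_integral_eq_integral) (auto intro: Linf_integrable)
  also have "\<dots> \<le> (\<Sum>i. ennreal ((1/2)^i))" using d by (intro suminf_le ennreal_leI) auto
  also have "\<dots> = ennreal (\<Sum>i. (1/2)^i)" by (intro suminf_ennreal2) (auto intro: summable_geometric)
  also have "\<dots> < \<infinity>" by simp
  finally have fin: "(\<integral>\<^sup>+x. (\<Sum>i. ennreal (?d i x)) \<partial>M) \<noteq> \<infinity>" by simp
  have "AE x in M. (\<Sum>i. ennreal (?d i x)) \<noteq> \<infinity>"
    by (rule nn_integral_PInf_AE[OF _ fin]) simp
  then have conv: "AE x in M. convergent (\<lambda>i. g (r i) x)"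
  proof eventually_elim
    case (elim x)
    then have "summable (\<lambda>i. ?d i x)" by (intro summable_suminf_not_top) auto
    then have "summable (\<lambda>i. g (r (Suc i)) x - g (r i) x)" by (rule summable_rabs_cancel)
    then have "convergent (\<lambda>n. \<Sum>i<n. g (r (Suc i)) x - g (r i) x)" by (rule summable_iff_convergent[THEN iffD1])
    then have "convergent (\<lambda>n. (g (r n) x - g (r 0) x))" by (simp add: sum_lessThan_telescope[of "\<lambda>n. g (r n) x"])
    then have "convergent (\<lambda>n. (g (r n) x - g (r 0) x) + g (r 0) x)"
      by (intro convergent_add convergent_const)
    then show ?case by simp
  qed
  define h where "h x = lim (\<lambda>i. g (r i) x)" for x
  have hm[measurable]: "h \<in> borel_measurable M" unfolding h_def by measurable
  have lim: "AE x in M. (\<lambda>i. g (r i) x) \<longlonglongrightarrow> h x"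
    using conv by eventually_elim (simp add: h_def convergent_LIMSEQ_iff)
  have gB: "AE x in M. \<forall>n. \<bar>g n x\<bar> \<le> B" using g(2) by (simp add: AE_all_countable)
  have hB: "AE x in M. \<bar>h x\<bar> \<le> B"
    using lim gB
  proof eventually_elim
    case (elim x)
    have "(\<lambda>i. \<bar>g (r i) x\<bar>) \<longlonglongrightarrow> \<bar>h x\<bar>" using elim by (intro tendsto_rabs)
    then show ?case by (rule LIMSEQ_le_const2) (use elim in blast)
  qed
  have h: "h \<in> Linf M" using hm hB by (rule LinfI)
  moreover have "(\<lambda>n. \<integral>x. (g n x - h x)\<^sup>2 \<partial>M) \<longlonglongrightarrow> 0"
  proof (rule LIMSEQ_I)
    fix e :: real assume e: "e > 0"
    then have "(0::real) < e / 2" by simp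
    from Cauchy[OF this] obtain N0 where N0: "\<And>n k. n \<ge> N0 \<Longrightarrow> k \<ge> N0 \<Longrightarrow>
      (\<integral>x. (g n x - g k x)\<^sup>2 \<partial>M) < e / 2" by blast
    have "norm ((\<integral>x. (g n x - h x)\<^sup>2 \<partial>M) - 0) < e" if n: "n \<ge> N0" for n
    proof -
      have "(\<lambda>k. \<integral>x. (g n x - g (r (k + N0)) x)\<^sup>2 \<partial>M) \<longlonglongrightarrow> (\<integral>x. (g n x - h x)\<^sup>2 \<partial>M)"
      proof (rule integral_dominated_convergence[where w = "\<lambda>_. (2 * B)\<^sup>2"])
        show "AE x in M. (\<lambda>k. (g n x - g (r (k + N0)) x)\<^sup>2) \<longlonglongrightarrow> (g n x - h x)\<^sup>2"
          using lim by eventually_elim (intro tendsto_intros, rule LIMSEQ_ignore_initial_segment)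
        show "AE x in M. norm ((g n x - g (r (k + N0)) x)\<^sup>2) \<le> (2 * B)\<^sup>2" for k
          using gB
        proof eventually_elim
          case (elim x)
          have "\<bar>g n x\<bar> \<le> B" "\<bar>g (r (k + N0)) x\<bar> \<le> B" using elim by auto
          then have "\<bar>g n x - g (r (k + N0)) x\<bar> \<le> 2 * B" by linarith
          then have "\<bar>g n x - g (r (k + N0)) x\<bar>\<^sup>2 \<le> (2 * B)\<^sup>2" by (intro power_mono) auto
          then show ?case by simp
        qed
      qed auto
      moreover have "\<exists>K. \<forall>k\<ge>K. (\<integral>x. (g n x - g (r (k + N0)) x)\<^sup>2 \<partial>M) \<le> e / 2"
        using N0[OF n] by (intro exI[of _ 0]) (auto simp: r_def intro: less_imp_le)
      ultimately have "(\<integral>x. (g n x - h x)\<^sup>2 \<partial>M) \<le> e / 2" by (blast intro: LIMSEQ_le_const2)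
      moreover have "0 \<le> (\<integral>x. (g n x - h x)\<^sup>2 \<partial>M)" by (rule integral_nonneg_AE) simp
      ultimately show ?thesis using e by simp
    qed
    then show "\<exists>no. \<forall>n\<ge>no. norm ((\<integral>x. (g n x - h x)\<^sup>2 \<partial>M) - 0) < e" by blast
  qed
  ultimately show ?thesis by blast
qed

lemma self_dual_pow_pairing:
  assumes T: "dual_pair M T T" and g: "g \<in> Linf M"
  shows "(\<integral>x. (T ^^ n) g x * (T ^^ k) g x \<partial>M) = (\<integral>x. (T ^^ (n + k)) g x * g x \<partial>M)"
proof -
  have "(\<integral>x. (T ^^ k) ((T ^^ n) g) x * g x \<partial>M) = (\<integral>x. (T ^^ n) g x * (T ^^ k) g x \<partial>M)"
    by (intro dual_adjoint_pow[OF T] dual_Linf_pow(1)[OF T] g)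
  moreover have "(T ^^ k) ((T ^^ n) g) = (T ^^ (n + k)) g"
    by (subst add.commute) (simp add: funpow_add)
  ultimately show ?thesis by simp
qed

definition energy :: "(('a \<Rightarrow> real) \<Rightarrow> 'a \<Rightarrow> real) \<Rightarrow> ('a \<Rightarrow> real) \<Rightarrow> nat \<Rightarrow> real" where
  "energy Q f n = (\<integral>x. ((Q ^^ n) f x)\<^sup>2 \<partial>M)"

text \<open>
  For \<open>f \<ge> 0\<close> the predicate says that the tail variable attached to \<open>f\<close> has second moment at least \<open>q\<close>
  times the square of its mean; it is nonconstant as soon as \<open>q > 1\<close>.
\<close>

definition spread :: "(('a \<Rightarrow> real) \<Rightarrow> 'a \<Rightarrow> real) \<Rightarrow> ('a \<Rightarrow> real) \<Rightarrow> real \<Rightarrow> bool" where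
  "spread Q f q \<longleftrightarrow> f \<in> Linf M \<and> (AE x in M. 0 \<le> f x) \<and> 0 < (\<integral>x. f x \<partial>M) \<and>
     (\<forall>n. q * (\<integral>x. f x \<partial>M)\<^sup>2 \<le> energy Q f n)"

context
  fixes Q S assumes dual: "dual_pair M Q S"
begin

lemma energy_decseq: assumes "f \<in> Linf M" shows "decseq (energy Q f)"
  unfolding decseq_Suc_iff energy_def
  using markov_L2_contraction[OF dual_markov(1)[OF dual] dual_Linf_pow(1)[OF dual assms]] by simp

lemma energy_convergent:
  assumes "f \<in> Linf M" obtains L where "energy Q f \<longlonglongrightarrow> L"
  using decseq_convergent[OF energy_decseq[OF assms], of 0] by (auto simp: energy_def)

lemma energy_Cauchy:
  assumes f: "f \<in> Linf M" and \<eta>: "\<eta> > 0"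
  shows "\<exists>k. \<forall>k'\<ge>k. \<forall>N. energy Q f k' - energy Q f (k' + N) \<le> \<eta>"
proof -
  obtain L where L: "energy Q f \<longlonglongrightarrow> L" by (rule energy_convergent[OF f])
  have "\<exists>k. \<forall>n\<ge>k. \<bar>energy Q f n - L\<bar> < \<eta> / 2" using LIMSEQ_D[OF L, of "\<eta> / 2"] \<eta> by simp
  then obtain k where k: "\<And>n. n \<ge> k \<Longrightarrow> \<bar>energy Q f n - L\<bar> < \<eta> / 2" by blast
  have "energy Q f k' - energy Q f (k' + N) \<le> \<eta>" if "k' \<ge> k" for k' N
    using k[of k'] k[of "k' + N"] that unfolding abs_less_iff by simp
  then show ?thesis by blast
qed

text \<open>
  The decreasing energy is bounded below by \<open>\<mu>\<^sup>2\<close>, and the absence of spread forces it to reach this bound in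
  the limit; the difference is the mean square distance of \<open>Q\<^sup>n f\<close> from \<open>\<mu>\<close>.
\<close>

lemma mean_convergence_nonneg:
  assumes f: "f \<in> Linf M" "AE x in M. 0 \<le> f x" and no: "\<And>q. q > 1 \<Longrightarrow> \<not> spread Q f q"
  shows "(\<lambda>n. \<integral>x. \<bar>(Q ^^ n) f x - (\<integral>z. f z \<partial>M)\<bar> \<partial>M) \<longlonglongrightarrow> 0"
proof -
  define \<mu> where "\<mu> = (\<integral>x. f x \<partial>M)"
  have L: "(Q ^^ n) f \<in> Linf M" for n using f(1) by (rule dual_Linf_pow(1)[OF dual])
  have int: "(\<integral>x. (Q ^^ n) f x \<partial>M) = \<mu>" for n
    unfolding \<mu>_def using f by (intro markov_integral[OF dual_markov_pow(1)[OF dual]]) auto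
  have "\<mu> \<ge> 0" unfolding \<mu>_def using f by (intro integral_nonneg_AE)
  have energy_ge: "\<mu>\<^sup>2 \<le> energy Q f n" for n
    unfolding energy_def using square_integral_le[OF L[of n]] by (simp add: int)
  have defect: "(\<integral>x. ((Q ^^ n) f x - \<mu>)\<^sup>2 \<partial>M) = energy Q f n - \<mu>\<^sup>2" for n
  proof -
    have "(\<integral>x. ((Q ^^ n) f x - \<mu>)\<^sup>2 \<partial>M) = (\<integral>x. ((Q ^^ n) f x)\<^sup>2 - 2 * \<mu> * (Q ^^ n) f x + \<mu>\<^sup>2 \<partial>M)"
      by (simp add: power2_diff algebra_simps)
    also have "\<dots> = energy Q f n - 2 * \<mu> * \<mu> + \<mu>\<^sup>2"
      using Linf_integrable[OF Linf_power[OF L[of n], of 2]] Linf_integrable[OF L[of n]]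
      by (simp add: energy_def int prob_space)
    finally show ?thesis by (simp add: power2_eq_square)
  qed
  show ?thesis
  proof (cases "\<mu> = 0")
    case True
    have "(\<integral>x. \<bar>(Q ^^ n) f x\<bar> \<partial>M) = 0" for n
    proof -
      have "AE x in M. 0 \<le> (Q ^^ n) f x"
        using f by (intro markov_nonneg[OF dual_markov_pow(1)[OF dual]]) auto
      then have "(\<integral>x. \<bar>(Q ^^ n) f x\<bar> \<partial>M) = (\<integral>x. (Q ^^ n) f x \<partial>M)"
        using Linf_measurable[OF L[of n]] by (intro integral_cong_AE) auto
      then show ?thesis using int True by simp
    qed
    then show ?thesis using True by (simp add: \<mu>_def[symmetric])
  next
    case False
    then have \<mu>: "\<mu> > 0" using \<open>\<mu> \<ge> 0\<close> by simp
    have "energy Q f \<longlonglongrightarrow> \<mu>\<^sup>2"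
    proof (rule LIMSEQ_I)
      fix r :: real assume r: "r > 0"
      define q where "q = 1 + r / \<mu>\<^sup>2"
      have q: "q > 1" "q * \<mu>\<^sup>2 = \<mu>\<^sup>2 + r" using r \<mu> by (auto simp: q_def field_simps)
      then obtain N where N: "energy Q f N < \<mu>\<^sup>2 + r"
        using no[OF q(1)] f \<mu> by (auto simp: spread_def \<mu>_def[symmetric] not_le)
      have "norm (energy Q f n - \<mu>\<^sup>2) < r" if "n \<ge> N" for n
        using decseqD[OF energy_decseq[OF f(1)] that] N energy_ge[of n] by simp
      then show "\<exists>no. \<forall>n\<ge>no. norm (energy Q f n - \<mu>\<^sup>2) < r" by blast
    qed
    then have "(\<lambda>n. sqrt (energy Q f n - \<mu>\<^sup>2)) \<longlonglongrightarrow> sqrt (\<mu>\<^sup>2 - \<mu>\<^sup>2)" by (intro tendsto_intros)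
    then have lim: "(\<lambda>n. sqrt (energy Q f n - \<mu>\<^sup>2)) \<longlonglongrightarrow> 0" by simp
    have "(\<lambda>n. \<integral>x. \<bar>(Q ^^ n) f x - \<mu>\<bar> \<partial>M) \<longlonglongrightarrow> 0"
    proof (rule Lim_null_comparison[OF _ lim], intro always_eventually allI)
      fix n
      have "(\<integral>x. \<bar>(Q ^^ n) f x - \<mu>\<bar> \<partial>M) \<le> sqrt (energy Q f n - \<mu>\<^sup>2)"
        using L1_le_sqrt_L2[OF Linf_diff[OF L[of n] Linf_const[of \<mu>]]] by (simp add: defect)
      moreover have "0 \<le> (\<integral>x. \<bar>(Q ^^ n) f x - \<mu>\<bar> \<partial>M)" by (rule integral_nonneg_AE) simp
      ultimately show "norm (\<integral>x. \<bar>(Q ^^ n) f x - \<mu>\<bar> \<partial>M) \<le> sqrt (energy Q f n - \<mu>\<^sup>2)" by simp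
    qed
    then show ?thesis by (simp add: \<mu>_def)
  qed
qed

context
  fixes m assumes fixed: "only_constant_L2_fixed_points M ((S ^^ m) \<circ> (Q ^^ m))"
begin

abbreviation (input) "T \<equiv> (S ^^ m) \<circ> (Q ^^ m)"

lemma T_dual: "dual_pair M T T"
  unfolding dual_pair_def
proof (intro conjI ballI)
  show "markov_operator M T" "markov_operator M T"
    by (intro markov_operator_comp dual_markov_pow[OF dual])+
  fix f g assume fg: "f \<in> Linf M" "g \<in> Linf M"
  note L = dual_Linf_pow[OF dual]
  have "(\<integral>x. f x * T g x \<partial>M) = (\<integral>x. (Q ^^ m) f x * (Q ^^ m) g x \<partial>M)"
    using fg by (simp add: dual_adjoint_pow[OF dual] L)
  also have "\<dots> = (\<integral>x. g x * T f x \<partial>M)"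
    using fg by (subst mult.commute) (simp add: dual_adjoint_pow[OF dual] L)
  finally show "(\<integral>x. T f x * g x \<partial>M) = (\<integral>x. f x * T g x \<partial>M)" by (simp add: mult.commute)
qed

lemma T_quadratic: "f \<in> Linf M \<Longrightarrow> (\<integral>x. T f x * f x \<partial>M) = (\<integral>x. ((Q ^^ m) f x)\<^sup>2 \<partial>M)"
  using dual_adjoint_pow[OF dual, of f "(Q ^^ m) f" m] dual_Linf_pow[OF dual]
  by (simp add: power2_eq_square mult.commute)

lemma T_pow_Linf: "f \<in> Linf M \<Longrightarrow> (T ^^ n) f \<in> Linf M"
  by (rule dual_Linf_pow(1)[OF T_dual])

lemmas T_pow_pairing = self_dual_pow_pairing[OF T_dual]

text \<open>
  \<open>T = S\<^sup>m Q\<^sup>m\<close> is a positive contraction on \<open>L\<^sup>2\<close>, so \<open>c\<^sub>n = \<integral> (T\<^sup>n g) g\<close> decreases, and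
  \<open>\<integral> (T\<^sup>n g - T\<^sup>k g)\<^sup>2 = c\<^bsub>2n\<^esub> - 2 c\<^bsub>n+k\<^esub> + c\<^bsub>2k\<^esub>\<close> tends to \<open>0\<close>. The limit is fixed by \<open>T\<close>, hence constant.
\<close>

lemma mean_ergodic:
  assumes g: "g \<in> Linf M"
  shows "(\<lambda>n. \<integral>x. ((T ^^ n) g x - (\<integral>z. g z \<partial>M))\<^sup>2 \<partial>M) \<longlonglongrightarrow> 0"
proof -
  note L = T_pow_Linf[OF g]
  define c where "c n = (\<integral>x. (T ^^ n) g x * g x \<partial>M)" for n
  have even: "c (2 * n) = (\<integral>x. ((T ^^ n) g x)\<^sup>2 \<partial>M)" for n
    using T_pow_pairing[OF g, of n n] by (simp add: c_def power2_eq_square mult_2)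
  have odd: "c (2 * n + 1) = (\<integral>x. ((Q ^^ m) ((T ^^ n) g) x)\<^sup>2 \<partial>M)" for n
    using T_pow_pairing[OF g, of "Suc n" n] T_quadratic[OF L[of n]] by (simp add: c_def mult_2)
  have "c (Suc i) \<le> c i" for i
  proof (cases "even i")
    case True
    then obtain n where "i = 2 * n" by auto
    then show ?thesis using even[of n] odd[of n] markov_L2_contraction[OF dual_markov_pow(1)[OF dual] L[of n], of m]
      by simp
  next
    case False
    then obtain n where n: "i = 2 * n + 1" by (auto elim: oddE)
    have "(\<integral>x. ((S ^^ m) ((Q ^^ m) ((T ^^ n) g)) x)\<^sup>2 \<partial>M) \<le> (\<integral>x. ((Q ^^ m) ((T ^^ n) g) x)\<^sup>2 \<partial>M)"
      by (intro markov_L2_contraction dual_markov_pow[OF dual] dual_Linf_pow[OF dual] L)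
    then show ?thesis using even[of "Suc n"] odd[of n] by (simp add: n)
  qed
  then have dec: "decseq c" by (simp add: decseq_Suc_iff)
  have c0: "0 \<le> c i" for i
  proof (cases "even i")
    case True
    then obtain n where "i = 2 * n" by auto
    then show ?thesis using even[of n] by simp
  next
    case False
    then obtain n where n: "i = 2 * n + 1" by (auto elim: oddE)
    then show ?thesis using odd[of n] by simp
  qed
  obtain l where l: "c \<longlonglongrightarrow> l" using decseq_convergent[OF dec, of 0] c0 by blast
  have diff: "(\<integral>x. ((T ^^ n) g x - (T ^^ k) g x)\<^sup>2 \<partial>M) = c (2 * n) - 2 * c (n + k) + c (2 * k)" for n k
  proof -
    have "(\<integral>x. ((T ^^ n) g x - (T ^^ k) g x)\<^sup>2 \<partial>M)
        = (\<integral>x. ((T ^^ n) g x)\<^sup>2 - 2 * ((T ^^ n) g x * (T ^^ k) g x) + ((T ^^ k) g x)\<^sup>2 \<partial>M)"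
      by (simp add: power2_diff algebra_simps)
    also have "\<dots> = (\<integral>x. ((T ^^ n) g x)\<^sup>2 \<partial>M) - 2 * (\<integral>x. (T ^^ n) g x * (T ^^ k) g x \<partial>M)
        + (\<integral>x. ((T ^^ k) g x)\<^sup>2 \<partial>M)"
      using Linf_integrable[OF Linf_power[OF L[of n], of 2]] Linf_integrable[OF Linf_power[OF L[of k], of 2]]
        Linf_integrable[OF Linf_mult[OF L[of n] L[of k]]] by simp
    finally show ?thesis by (simp only: even) (simp only: c_def T_pow_pairing[OF g])
  qed
  obtain B where B: "AE x in M. \<bar>g x\<bar> \<le> B" using g by (elim LinfE)
  have "\<exists>h\<in>Linf M. (\<lambda>n. \<integral>x. ((T ^^ n) g x - h x)\<^sup>2 \<partial>M) \<longlonglongrightarrow> 0"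
  proof (rule bounded_L2_complete)
    show "(T ^^ n) g \<in> borel_measurable M" for n using L by (rule Linf_measurable)
    show "AE x in M. \<bar>(T ^^ n) g x\<bar> \<le> B" for n
      using g B by (intro markov_bounded[OF dual_markov_pow(1)[OF T_dual]]) auto
    fix e :: real assume "e > 0"
    then obtain N where N: "\<And>n. n \<ge> N \<Longrightarrow> \<bar>c n - l\<bar> < e / 4"
      using LIMSEQ_D[OF l, of "e / 4"] by auto
    have "(\<integral>x. ((T ^^ n) g x - (T ^^ k) g x)\<^sup>2 \<partial>M) < e" if "n \<ge> N" "k \<ge> N" for n k
      using N[of "2 * n"] N[of "n + k"] N[of "2 * k"] that unfolding diff abs_less_iff by simp
    then show "\<exists>N. \<forall>n\<ge>N. \<forall>k\<ge>N. (\<integral>x. ((T ^^ n) g x - (T ^^ k) g x)\<^sup>2 \<partial>M) < e" by blast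
  qed
  then obtain h where h: "h \<in> Linf M" and lim: "(\<lambda>n. \<integral>x. ((T ^^ n) g x - h x)\<^sup>2 \<partial>M) \<longlonglongrightarrow> 0"
    by blast
  have Ph: "T h \<in> Linf M" using h by (rule dual_Linf(1)[OF T_dual])
  have fix_h: "AE x in M. T h x = h x"
  proof -
    have le: "(\<integral>x. (T h x - h x)\<^sup>2 \<partial>M) \<le> 2 * (\<integral>x. ((T ^^ n) g x - h x)\<^sup>2 \<partial>M)
        + 2 * (\<integral>x. ((T ^^ Suc n) g x - h x)\<^sup>2 \<partial>M)" for n
    proof -
      have i1: "integrable M (\<lambda>x. ((T ^^ n) g x - h x)\<^sup>2)" for n
        using L h by (intro Linf_integrable Linf_power Linf_diff)
      have i2: "integrable M (\<lambda>x. (T h x - T ((T ^^ n) g) x)\<^sup>2)"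
        using dual_Linf(1)[OF T_dual] L h by (intro Linf_integrable Linf_power Linf_diff) blast+
      have "(\<integral>x. (T h x - h x)\<^sup>2 \<partial>M)
          \<le> (\<integral>x. 2 * (T h x - T ((T ^^ n) g) x)\<^sup>2 + 2 * ((T ^^ Suc n) g x - h x)\<^sup>2 \<partial>M)"
      proof (rule integral_mono)
        show "(T h x - h x)\<^sup>2 \<le> 2 * (T h x - T ((T ^^ n) g) x)\<^sup>2 + 2 * ((T ^^ Suc n) g x - h x)\<^sup>2" for x
          using sum_squares_bound[of "T h x - T ((T ^^ n) g) x" "(T ^^ Suc n) g x - h x"]
          by (simp add: power2_eq_square algebra_simps)
      qed (use i1[of "Suc n"] i2 Ph h in \<open>auto intro!: Linf_integrable Linf_power\<close>)
      also have "\<dots> = 2 * (\<integral>x. (T h x - T ((T ^^ n) g) x)\<^sup>2 \<partial>M) + 2 * (\<integral>x. ((T ^^ Suc n) g x - h x)\<^sup>2 \<partial>M)"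
        using i1[of "Suc n"] i2 by simp
      also have "(\<integral>x. (T h x - T ((T ^^ n) g) x)\<^sup>2 \<partial>M) = (\<integral>x. (T (\<lambda>y. h y - (T ^^ n) g y) x)\<^sup>2 \<partial>M)"
      proof (rule integral_cong_AE)
        show "AE x in M. (T h x - T ((T ^^ n) g) x)\<^sup>2 = (T (\<lambda>y. h y - (T ^^ n) g y) x)\<^sup>2"
          using markov_diff[OF dual_markov(1)[OF T_dual] Linf_integrable[OF h] Linf_integrable[OF L[of n]]]
          by eventually_elim simp
        have "T (\<lambda>y. h y - (T ^^ n) g y) \<in> Linf M"
          using L h by (intro dual_Linf(1)[OF T_dual] Linf_diff)
        then show "(\<lambda>x. (T (\<lambda>y. h y - (T ^^ n) g y) x)\<^sup>2) \<in> borel_measurable M" by (intro Linf_measurable Linf_power)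
      qed (use i2 in auto)
      also have "\<dots> \<le> (\<integral>x. (h x - (T ^^ n) g x)\<^sup>2 \<partial>M)"
        using L h by (intro markov_L2_contraction[OF dual_markov(1)[OF T_dual]] Linf_diff)
      finally show ?thesis by (simp only: power2_commute)
    qed
    have "(\<lambda>n. 2 * (\<integral>x. ((T ^^ n) g x - h x)\<^sup>2 \<partial>M) + 2 * (\<integral>x. ((T ^^ Suc n) g x - h x)\<^sup>2 \<partial>M))
        \<longlonglongrightarrow> 2 * 0 + 2 * 0"
      by (intro tendsto_intros lim LIMSEQ_Suc[OF lim])
    then have "(\<integral>x. (T h x - h x)\<^sup>2 \<partial>M) \<le> 2 * 0 + 2 * 0"
      by (rule LIMSEQ_le_const) (use le in blast)
    moreover have "0 \<le> (\<integral>x. (T h x - h x)\<^sup>2 \<partial>M)" by (rule integral_nonneg_AE) simp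
    ultimately have zero: "(\<integral>x. (T h x - h x)\<^sup>2 \<partial>M) = 0" by linarith
    have "integrable M (\<lambda>x. (T h x - h x)\<^sup>2)"
      using Ph h by (intro Linf_integrable Linf_power Linf_diff)
    then have "AE x in M. (T h x - h x)\<^sup>2 = 0"
      by (rule integral_nonneg_eq_0_iff_AE[THEN iffD1, OF _ _ zero]) simp
    then show ?thesis by eventually_elim simp
  qed
  obtain k where k: "AE x in M. h x = k"
    using fixed fix_h Linf_Lp2[OF h] unfolding only_constant_L2_fixed_points_def by blast
  have lim_k: "(\<lambda>n. \<integral>x. ((T ^^ n) g x - k)\<^sup>2 \<partial>M) \<longlonglongrightarrow> 0"
  proof -
    have "(\<integral>x. ((T ^^ n) g x - h x)\<^sup>2 \<partial>M) = (\<integral>x. ((T ^^ n) g x - k)\<^sup>2 \<partial>M)" for n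
    proof (rule integral_cong_AE)
      show "AE x in M. ((T ^^ n) g x - h x)\<^sup>2 = ((T ^^ n) g x - k)\<^sup>2" using k by eventually_elim simp
    qed (use Linf_measurable[OF L[of n]] Linf_measurable[OF h] in \<open>auto\<close>)
    with lim show ?thesis by simp
  qed
  have "k = (\<integral>z. g z \<partial>M)"
  proof -
    have "((\<integral>z. g z \<partial>M) - k)\<^sup>2 \<le> (\<integral>x. ((T ^^ n) g x - k)\<^sup>2 \<partial>M)" for n
    proof -
      have "(\<integral>x. (T ^^ n) g x - k \<partial>M) = (\<integral>z. g z \<partial>M) - k"
        using L[of n] g markov_integral[OF dual_markov_pow(1)[OF T_dual], of g n] by (simp add: prob_space)
      then show ?thesis
        using square_integral_le[of "\<lambda>x. (T ^^ n) g x - k"] L[of n] by (simp add: Linf_diff)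
    qed
    then have "((\<integral>z. g z \<partial>M) - k)\<^sup>2 \<le> 0"
      by (intro LIMSEQ_le_const[OF lim_k]) blast
    then show ?thesis by simp
  qed
  with lim_k show ?thesis by simp
qed

text \<open>
  Along the orbit \<open>u\<^sub>n = Q\<^sup>n f\<close> the defect \<open>\<integral> (T u\<^sub>n - u\<^sub>n)\<^sup>2\<close> is at most the loss of energy between \<open>n\<close> and
  \<open>n + m\<close> and tends to \<open>0\<close>. Therefore \<open>g\<close> may be replaced by \<open>T\<^sup>i g\<close> in \<open>\<integral> u\<^sub>n g\<close>, and \<open>T\<^sup>i g\<close> is close to \<open>\<integral> g\<close>.
\<close>

lemma powers_mixing:
  assumes f: "f \<in> Linf M" and g: "g \<in> Linf M"
  shows "(\<lambda>n. \<integral>x. (Q ^^ n) f x * g x \<partial>M) \<longlonglongrightarrow> (\<integral>x. f x \<partial>M) * (\<integral>x. g x \<partial>M)"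
proof -
  define u where "u n = (Q ^^ n) f" for n
  have u: "u n \<in> Linf M" for n unfolding u_def using f by (rule dual_Linf_pow(1)[OF dual])
  have Pu: "T (u n) \<in> Linf M" for n using u by (rule dual_Linf(1)[OF T_dual])
  obtain B where B: "AE x in M. \<bar>f x\<bar> \<le> B" "B > 0" using f by (elim LinfE)
  have uB: "AE x in M. \<bar>u n x\<bar> \<le> B" for n
    unfolding u_def using f B by (intro markov_bounded[OF dual_markov_pow(1)[OF dual]]) auto
  obtain B' where B': "AE x in M. \<bar>g x\<bar> \<le> B'" "B' > 0" using g by (elim LinfE)
  have gB: "AE x in M. \<bar>(T ^^ i) g x\<bar> \<le> B'" for i
    using g B' by (intro markov_bounded[OF dual_markov_pow(1)[OF T_dual]]) auto
  have defect: "(\<integral>x. (T (u n) x - u n x)\<^sup>2 \<partial>M) \<le> energy Q f n - energy Q f (n + m)" for n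
  proof -
    have e: "energy Q f (n + m) = (\<integral>x. ((Q ^^ m) (u n) x)\<^sup>2 \<partial>M)"
      by (simp add: energy_def u_def add.commute[of n] funpow_add)
    have "(\<integral>x. (T (u n) x - u n x)\<^sup>2 \<partial>M) = (\<integral>x. (T (u n) x)\<^sup>2 - 2 * (T (u n) x * u n x) + (u n x)\<^sup>2 \<partial>M)"
      by (simp add: power2_diff algebra_simps)
    also have "\<dots> = (\<integral>x. (T (u n) x)\<^sup>2 \<partial>M) - 2 * (\<integral>x. T (u n) x * u n x \<partial>M) + energy Q f n"
      using Linf_integrable[OF Linf_power[OF Pu[of n], of 2]] Linf_integrable[OF Linf_power[OF u[of n], of 2]]
        Linf_integrable[OF Linf_mult[OF Pu[of n] u[of n]]] by (simp add: energy_def u_def)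
    also have "(\<integral>x. T (u n) x * u n x \<partial>M) = energy Q f (n + m)"
      using T_quadratic[OF u] e by simp
    also have "(\<integral>x. (T (u n) x)\<^sup>2 \<partial>M) \<le> energy Q f (n + m)"
      unfolding e using markov_L2_contraction[OF dual_markov_pow(2)[OF dual] dual_Linf_pow(1)[OF dual u]] by simp
    finally show ?thesis by simp
  qed
  obtain l where l: "energy Q f \<longlonglongrightarrow> l" by (rule energy_convergent[OF f])
  have "(\<lambda>n. sqrt (energy Q f n - energy Q f (n + m))) \<longlonglongrightarrow> sqrt (l - l)"
    by (intro tendsto_intros l LIMSEQ_ignore_initial_segment)
  then have defect0: "(\<lambda>n. B' * sqrt (energy Q f n - energy Q f (n + m))) \<longlonglongrightarrow> 0"
    by (auto intro: tendsto_mult_right_zero)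
  have step: "(\<lambda>n. (\<integral>x. u n x * (T ^^ i) g x \<partial>M) - (\<integral>x. u n x * (T ^^ Suc i) g x \<partial>M)) \<longlonglongrightarrow> 0" for i
  proof (rule Lim_null_comparison[OF _ defect0], intro always_eventually allI)
    fix n
    have gi: "(T ^^ i) g \<in> Linf M" using g by (rule T_pow_Linf)
    have "(\<integral>x. u n x * (T ^^ Suc i) g x \<partial>M) = (\<integral>x. T (u n) x * (T ^^ i) g x \<partial>M)"
      using dual_adjoint[OF T_dual u gi] by simp
    then have "(\<integral>x. u n x * (T ^^ i) g x \<partial>M) - (\<integral>x. u n x * (T ^^ Suc i) g x \<partial>M)
        = - (\<integral>x. (T (u n) x - u n x) * (T ^^ i) g x \<partial>M)"
      using Linf_integrable[OF Linf_mult[OF u[of n] gi]] Linf_integrable[OF Linf_mult[OF Pu[of n] gi]]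
      by (simp add: left_diff_distrib)
    then have "norm ((\<integral>x. u n x * (T ^^ i) g x \<partial>M) - (\<integral>x. u n x * (T ^^ Suc i) g x \<partial>M))
        \<le> B' * (\<integral>x. \<bar>T (u n) x - u n x\<bar> \<partial>M)"
      using abs_integral_mult_le[OF Linf_diff[OF Pu[of n] u[of n]] gi gB] by simp
    also have "\<dots> \<le> B' * sqrt (energy Q f n - energy Q f (n + m))"
    proof (rule mult_left_mono)
      have "(\<integral>x. \<bar>T (u n) x - u n x\<bar> \<partial>M) \<le> sqrt (\<integral>x. (T (u n) x - u n x)\<^sup>2 \<partial>M)"
        by (intro L1_le_sqrt_L2 Linf_diff Pu u)
      also have "\<dots> \<le> sqrt (energy Q f n - energy Q f (n + m))" using defect by (rule real_sqrt_le_mono)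
      finally show "(\<integral>x. \<bar>T (u n) x - u n x\<bar> \<partial>M) \<le> sqrt (energy Q f n - energy Q f (n + m))" .
    qed (use B' in simp)
    finally show "norm ((\<integral>x. u n x * (T ^^ i) g x \<partial>M) - (\<integral>x. u n x * (T ^^ Suc i) g x \<partial>M))
        \<le> B' * sqrt (energy Q f n - energy Q f (n + m))" .
  qed
  have steps: "(\<lambda>n. (\<integral>x. u n x * g x \<partial>M) - (\<integral>x. u n x * (T ^^ i) g x \<partial>M)) \<longlonglongrightarrow> 0" for i
  proof (induction i)
    case (Suc i)
    have "(r - s) + (s - t) = r - t" for r s t :: real by simp
    then show ?case using tendsto_add_zero[OF Suc step[of i]] by (simp only:)
  qed simp
  let ?I = "\<integral>z. g z \<partial>M"
  have last: "\<bar>(\<integral>x. u n x * (T ^^ i) g x \<partial>M) - (\<integral>x. f x \<partial>M) * ?I\<bar>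
      \<le> B * sqrt (\<integral>x. ((T ^^ i) g x - ?I)\<^sup>2 \<partial>M)" for n i
  proof -
    have gi: "(T ^^ i) g \<in> Linf M" using g by (rule T_pow_Linf)
    then have d: "(\<lambda>x. (T ^^ i) g x - ?I) \<in> Linf M" by auto
    have "(\<integral>x. u n x \<partial>M) = (\<integral>x. f x \<partial>M)"
      unfolding u_def using f by (intro markov_integral[OF dual_markov_pow(1)[OF dual]]) auto
    then have "(\<integral>x. (T ^^ i) g x * u n x \<partial>M) - ?I * (\<integral>x. f x \<partial>M) = (\<integral>x. ((T ^^ i) g x - ?I) * u n x \<partial>M)"
      using Linf_integrable[OF Linf_mult[OF gi u[of n]]] Linf_integrable[OF u[of n]]
      by (simp add: left_diff_distrib)
    then have "(\<integral>x. u n x * (T ^^ i) g x \<partial>M) - (\<integral>x. f x \<partial>M) * ?I = (\<integral>x. ((T ^^ i) g x - ?I) * u n x \<partial>M)"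
      by (simp only: mult.commute)
    also have "\<bar>\<dots>\<bar> \<le> B * (\<integral>x. \<bar>(T ^^ i) g x - ?I\<bar> \<partial>M)"
      using d u uB by (rule abs_integral_mult_le)
    also have "\<dots> \<le> B * sqrt (\<integral>x. ((T ^^ i) g x - ?I)\<^sup>2 \<partial>M)"
      using B(2) by (intro mult_left_mono L1_le_sqrt_L2 d) (rule less_imp_le)
    finally show ?thesis .
  qed
  have "(\<lambda>i. B * sqrt (\<integral>x. ((T ^^ i) g x - ?I)\<^sup>2 \<partial>M)) \<longlonglongrightarrow> B * sqrt 0"
    by (intro tendsto_intros mean_ergodic g)
  then have tail: "(\<lambda>i. B * sqrt (\<integral>x. ((T ^^ i) g x - ?I)\<^sup>2 \<partial>M)) \<longlonglongrightarrow> 0" by simp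
  have "(\<lambda>n. \<integral>x. u n x * g x \<partial>M) \<longlonglongrightarrow> (\<integral>x. f x \<partial>M) * ?I"
  proof (rule LIMSEQ_I)
    fix e :: real assume e: "e > 0"
    then obtain i where i: "B * sqrt (\<integral>x. ((T ^^ i) g x - ?I)\<^sup>2 \<partial>M) < e / 2"
      using order_tendstoD(2)[OF tail, of "e / 2"] by (auto simp: eventually_sequentially)
    obtain N where N: "\<And>n. n \<ge> N \<Longrightarrow> \<bar>(\<integral>x. u n x * g x \<partial>M) - (\<integral>x. u n x * (T ^^ i) g x \<partial>M)\<bar> < e / 2"
      using LIMSEQ_D[OF steps[of i] half_gt_zero[OF e]] unfolding diff_zero real_norm_def by blast
    have "norm ((\<integral>x. u n x * g x \<partial>M) - (\<integral>x. f x \<partial>M) * ?I) < e" if "n \<ge> N" for n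
      using N[OF that] last[of n i] i unfolding real_norm_def by linarith
    then show "\<exists>no. \<forall>n\<ge>no. norm ((\<integral>x. u n x * g x \<partial>M) - (\<integral>x. f x \<partial>M) * ?I) < e" by blast
  qed
  then show ?thesis by (simp add: u_def)
qed

text \<open>
  For large \<open>k\<close> the operators \<open>Q\<^sup>N\<close> act almost multiplicatively on \<open>u\<^sub>0 = Q\<^sup>k f\<close>, since their variance is bounded by
  the remaining loss of energy \<open>\<eta>\<close>. With \<open>u\<^sub>n = Q\<^sup>n u\<^sub>0\<close>, mixing makes the mean of \<open>u\<^sub>n u\<^sub>0\<close> close to
  \<open>\<mu>\<^sup>2\<close> and the mean of \<open>u\<^sub>n\<^sup>2 u\<^sub>0\<^sup>2\<close> close to the square of the energy, at least \<open>(q \<mu>\<^sup>2)\<^sup>2\<close>. So \<open>u\<^sub>n u\<^sub>0\<close> has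
  ratio nearly \<open>q\<^sup>2\<close>; the value \<open>q (q + 1) / 2 < q\<^sup>2\<close> leaves room for the errors.
\<close>

lemma spread_square:
  assumes f: "spread Q f q" and q: "q > 1"
  shows "\<exists>f'. spread Q f' (q * (q + 1) / 2)"
proof -
  define \<mu> where "\<mu> = (\<integral>x. f x \<partial>M)"
  have fL: "f \<in> Linf M" and f0: "AE x in M. 0 \<le> f x" and \<mu>: "\<mu> > 0"
    and fq: "\<And>n. q * \<mu>\<^sup>2 \<le> energy Q f n"
    using f by (auto simp: spread_def \<mu>_def)
  obtain B where B: "AE x in M. \<bar>f x\<bar> \<le> B" "B > 0" using fL by (elim LinfE)
  \<comment> \<open>\<open>gap\<close> is \<open>(q\<^sup>2 - q (q + 1) / 2) \<mu>\<^sup>4\<close>; the errors below add up to \<open>5 B\<^sup>2 \<eta>\<close>.\<close>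
  define gap where "gap = \<mu>^4 * (q * (q - 1) / 2)"
  have gap: "gap > 0" using \<mu> q by (simp add: gap_def)
  define \<eta> where "\<eta> = gap / (10 * B\<^sup>2)"
  have \<eta>: "\<eta> > 0" "5 * B\<^sup>2 * \<eta> < gap" using gap B by (auto simp: \<eta>_def field_simps)
  obtain k where k: "\<And>k' N. k' \<ge> k \<Longrightarrow> energy Q f k' - energy Q f (k' + N) \<le> \<eta>"
    using energy_Cauchy[OF fL \<eta>(1)] by blast
  define u where "u n = (Q ^^ (k + n)) f" for n
  have u: "u n \<in> Linf M" for n unfolding u_def using fL by (rule dual_Linf_pow(1)[OF dual])
  have u0: "AE x in M. 0 \<le> u n x" for n
    unfolding u_def using fL f0 by (intro markov_nonneg[OF dual_markov_pow(1)[OF dual]]) auto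
  have uB: "AE x in M. \<bar>u n x\<bar> \<le> B" for n
    unfolding u_def using fL B by (intro markov_bounded[OF dual_markov_pow(1)[OF dual]]) auto
  have u_int: "(\<integral>x. u n x \<partial>M) = \<mu>" for n
    unfolding u_def \<mu>_def using fL by (intro markov_integral[OF dual_markov_pow(1)[OF dual]]) auto
  have Qu: "(Q ^^ N) (u n) = u (n + N)" for N n
    unfolding u_def by (metis add.assoc add.commute comp_apply funpow_add)
  have u_energy: "(\<integral>x. (u n x)\<^sup>2 \<partial>M) = energy Q f (k + n)" for n
    by (simp add: u_def energy_def)
  have defect: "(\<integral>x. (u n x)\<^sup>2 \<partial>M) - (\<integral>x. ((Q ^^ N) (u n) x)\<^sup>2 \<partial>M) \<le> \<eta>" for n N
    unfolding Qu u_energy using k[of "k + n" N] by (simp add: add.assoc)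
  have usq: "(\<lambda>x. (u n x)\<^sup>2) \<in> Linf M" for n using u by (rule Linf_power)
  define q' where "q' = q * (q + 1) / 2"
  have "(\<lambda>n. (\<integral>x. (Q ^^ n) (\<lambda>y. (u 0 y)\<^sup>2) x * (u 0 x)\<^sup>2 \<partial>M) - q' * (\<integral>x. (Q ^^ n) (u 0) x * u 0 x \<partial>M)\<^sup>2)
      \<longlonglongrightarrow> energy Q f k * energy Q f k - q' * (\<mu> * \<mu>)\<^sup>2"
    using powers_mixing[OF usq usq, of 0 0] powers_mixing[OF u u, of 0 0]
    by (intro tendsto_intros) (simp_all add: u_energy u_int)
  moreover have "energy Q f k * energy Q f k - q' * (\<mu> * \<mu>)\<^sup>2 > 5 * B\<^sup>2 * \<eta>"
  proof -
    have "(q * \<mu>\<^sup>2) * (q * \<mu>\<^sup>2) \<le> energy Q f k * energy Q f k"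
      using q by (intro mult_mono fq) (auto simp: energy_def)
    moreover have "(q * \<mu>\<^sup>2) * (q * \<mu>\<^sup>2) - q' * (\<mu> * \<mu>)\<^sup>2 = gap"
      unfolding gap_def q'_def by (simp add: power2_eq_square power4_eq_xxxx field_simps)
    ultimately show ?thesis using \<eta>(2) by linarith
  qed
  ultimately have ev1: "eventually (\<lambda>n. (\<integral>x. (Q ^^ n) (\<lambda>y. (u 0 y)\<^sup>2) x * (u 0 x)\<^sup>2 \<partial>M)
      - q' * (\<integral>x. (Q ^^ n) (u 0) x * u 0 x \<partial>M)\<^sup>2 > 5 * B\<^sup>2 * \<eta>) sequentially"
    by (rule order_tendstoD(1))
  have "(\<lambda>n. \<integral>x. (Q ^^ n) (u 0) x * u 0 x \<partial>M) \<longlonglongrightarrow> \<mu> * \<mu>"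
    using powers_mixing[OF u u, of 0 0] by (simp add: u_int)
  then have ev2: "eventually (\<lambda>n. (\<integral>x. (Q ^^ n) (u 0) x * u 0 x \<partial>M) > 0) sequentially"
    using \<mu> by (intro order_tendstoD(1)[where y = "\<mu> * \<mu>"]) auto
  obtain n where n: "(\<integral>x. (Q ^^ n) (\<lambda>y. (u 0 y)\<^sup>2) x * (u 0 x)\<^sup>2 \<partial>M)
      - q' * (\<integral>x. (Q ^^ n) (u 0) x * u 0 x \<partial>M)\<^sup>2 > 5 * B\<^sup>2 * \<eta>"
      "(\<integral>x. (Q ^^ n) (u 0) x * u 0 x \<partial>M) > 0"
    using eventually_happens[OF eventually_conj[OF ev1 ev2]] by auto
  define v where "v x = u n x * u 0 x" for x
  have v: "v \<in> Linf M" unfolding v_def using u u by (rule Linf_mult)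
  have v0: "AE x in M. 0 \<le> v x" using u0[of n] u0[of 0] by eventually_elim (simp add: v_def)
  have v_int: "(\<integral>x. v x \<partial>M) = (\<integral>x. (Q ^^ n) (u 0) x * u 0 x \<partial>M)" by (simp add: v_def Qu)
  have "q' * (\<integral>x. v x \<partial>M)\<^sup>2 \<le> energy Q v N" for N
  proof -
    have "(\<integral>x. (v x)\<^sup>2 \<partial>M) - energy Q v N \<le> 2 * B\<^sup>2 *
        (((\<integral>x. (u n x)\<^sup>2 \<partial>M) - (\<integral>x. ((Q ^^ N) (u n) x)\<^sup>2 \<partial>M)) +
         ((\<integral>x. (u 0 x)\<^sup>2 \<partial>M) - (\<integral>x. ((Q ^^ N) (u 0) x)\<^sup>2 \<partial>M)))"
      unfolding v_def energy_def
      by (rule markov_product_variance[OF dual_markov_pow(1)[OF dual] u u uB uB])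
    also have "\<dots> \<le> 2 * B\<^sup>2 * (\<eta> + \<eta>)" by (intro mult_left_mono add_mono defect) simp
    finally have 1: "(\<integral>x. (v x)\<^sup>2 \<partial>M) - energy Q v N \<le> 4 * B\<^sup>2 * \<eta>" by simp
    let ?w = "(Q ^^ n) (\<lambda>y. (u 0 y)\<^sup>2)"
    have w: "?w \<in> Linf M" using usq by (rule dual_Linf_pow(1)[OF dual])
    have "(\<integral>x. ?w x * (u 0 x)\<^sup>2 \<partial>M) - (\<integral>x. (v x)\<^sup>2 \<partial>M) = (\<integral>x. (?w x - (u n x)\<^sup>2) * (u 0 x)\<^sup>2 \<partial>M)"
      using Linf_integrable[OF Linf_mult[OF w usq[of 0]]] Linf_integrable[OF Linf_mult[OF usq[of n] usq[of 0]]]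
      by (simp add: v_def left_diff_distrib power_mult_distrib)
    also have "\<dots> \<le> (\<integral>x. B\<^sup>2 * (?w x - (u n x)\<^sup>2) \<partial>M)"
    proof (rule integral_mono_AE)
      have J: "AE x in M. (u n x)\<^sup>2 \<le> ?w x"
        using markov_Jensen_square[OF dual_markov_pow(1)[OF dual] u, of n 0] by (simp add: Qu)
      then show "AE x in M. (?w x - (u n x)\<^sup>2) * (u 0 x)\<^sup>2 \<le> B\<^sup>2 * (?w x - (u n x)\<^sup>2)"
        using uB[of 0]
      proof eventually_elim
        case (elim x)
        have "\<bar>u 0 x\<bar>\<^sup>2 \<le> B\<^sup>2" using elim by (intro power_mono) auto
        then have "(?w x - (u n x)\<^sup>2) * (u 0 x)\<^sup>2 \<le> (?w x - (u n x)\<^sup>2) * B\<^sup>2"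
          using elim by (intro mult_left_mono) auto
        then show ?case by (simp add: mult.commute)
      qed
    qed (use w usq in \<open>intro Linf_integrable Linf_mult Linf_diff Linf_const; blast\<close>)+
    also have "\<dots> = B\<^sup>2 * ((\<integral>x. ?w x \<partial>M) - (\<integral>x. (u n x)\<^sup>2 \<partial>M))"
      using Linf_integrable[OF w] Linf_integrable[OF usq[of n]] by simp
    also have "(\<integral>x. ?w x \<partial>M) = (\<integral>x. (u 0 x)\<^sup>2 \<partial>M)"
      using usq by (intro markov_integral[OF dual_markov_pow(1)[OF dual]]) auto
    also have "B\<^sup>2 * ((\<integral>x. (u 0 x)\<^sup>2 \<partial>M) - (\<integral>x. (u n x)\<^sup>2 \<partial>M)) \<le> B\<^sup>2 * \<eta>"
      using defect[of 0 n] by (intro mult_left_mono) (auto simp: Qu)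
    finally show ?thesis using 1 n(1) unfolding v_int by linarith
  qed
  then have "spread Q v q'" unfolding spread_def using v v0 n(2) by (simp add: v_int)
  then show ?thesis unfolding q'_def by blast
qed

lemma spread_mono: "spread Q f q \<Longrightarrow> q' \<le> q \<Longrightarrow> spread Q f q'"
  unfolding spread_def by (meson mult_right_mono order_trans zero_le_power2)

lemma spread_unbounded:
  assumes f: "spread Q f q" and q: "q > 1"
  shows "\<exists>f'. spread Q f' D"
proof -
  define s where "s = (q + 1) / 2"
  have s: "s > 1" using q by (simp add: s_def)
  have grow: "\<exists>f'. spread Q f' (q * s ^ r)" for r
  proof (induction r)
    case 0
    show ?case using f by auto
  next
    case (Suc r)
    then obtain f' where f': "spread Q f' (q * s ^ r)" by blast
    have "1 \<le> s ^ r" using s by simp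
    then have ge: "q \<le> q * s ^ r" using q by simp
    with q have "q * s ^ r > 1" by linarith
    from spread_square[OF f' this]
    obtain f'' where f'': "spread Q f'' (q * s ^ r * (q * s ^ r + 1) / 2)" by blast
    have "q * s ^ r * s \<le> q * s ^ r * ((q * s ^ r + 1) / 2)"
      using ge q by (intro mult_left_mono) (auto simp: s_def)
    then have "spread Q f'' (q * s ^ Suc r)" using f'' by (elim spread_mono) (simp add: mult_ac)
    then show ?case by blast
  qed
  obtain r where "D < s ^ r" using real_arch_pow[OF s] by blast
  also have "s ^ r \<le> q * s ^ r" using q s by simp
  finally show ?thesis using grow[of r] spread_mono by (meson less_imp_le)
qed

end

end

end

section \<open>The maximal inequality for the powers\<close>

text \<open>
  The maximal function is replaced by a dominating \<open>Z\<close> for each finite window, so that no measurability or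
  integrability of suprema has to be discussed elsewhere; monotone convergence passes to infinite windows.
\<close>

lemma (in prob_space) AE_and_mean_tendsto_0:
  fixes Y :: "nat \<Rightarrow> 'a \<Rightarrow> real"
  assumes int: "\<And>n. integrable M (Y n)" and nonneg: "\<And>n x. 0 \<le> Y n x"
    and dom: "\<And>\<delta>. \<delta> > 0 \<Longrightarrow> \<exists>k. \<forall>N. \<exists>Z. integrable M Z \<and>
                (AE x in M. \<forall>n<N. Y (k + n) x \<le> Z x) \<and> (\<integral>x. Z x \<partial>M) \<le> \<delta>"
  shows "AE x in M. (\<lambda>n. Y n x) \<longlonglongrightarrow> 0" and "(\<lambda>n. \<integral>x. Y n x \<partial>M) \<longlonglongrightarrow> 0"
proof -
  have [measurable]: "Y n \<in> borel_measurable M" for n using int by auto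
  let ?L = "\<lambda>x. limsup (\<lambda>n. ennreal (Y n x))"
  have "(\<integral>\<^sup>+x. ?L x \<partial>M) \<le> 0 + ennreal \<delta>" if \<delta>: "\<delta> > 0" for \<delta>
  proof -
    from dom[OF \<delta>] obtain k where k: "\<And>N. \<exists>Z. integrable M Z \<and>
                (AE x in M. \<forall>n<N. Y (k + n) x \<le> Z x) \<and> (\<integral>x. Z x \<partial>M) \<le> \<delta>" by blast
    let ?G = "\<lambda>N x. SUP n\<in>{..N}. ennreal (Y (k + n) x)"
    have "?L x \<le> (SUP N. ?G N x)" for x
    proof -
      have "?L x \<le> (SUP n\<in>{k..}. ennreal (Y n x))" unfolding limsup_INF_SUP by (rule INF_lower) simp
      also have "\<dots> \<le> (SUP N. ?G N x)"
      proof (rule SUP_least)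
        fix n assume "n \<in> {k..}"
        then have "ennreal (Y n x) \<le> ?G (n - k) x" by (intro SUP_upper2[of "n - k"]) auto
        then show "ennreal (Y n x) \<le> (SUP N. ?G N x)" by (rule SUP_upper2[OF UNIV_I])
      qed
      finally show ?thesis .
    qed
    then have "(\<integral>\<^sup>+x. ?L x \<partial>M) \<le> (\<integral>\<^sup>+x. (SUP N. ?G N x) \<partial>M)" by (intro nn_integral_mono)
    also have "\<dots> = (SUP N. \<integral>\<^sup>+x. ?G N x \<partial>M)"
      by (intro nn_integral_monotone_convergence_SUP)
        (auto simp: incseq_def le_fun_def intro!: SUP_subset_mono)
    also have "\<dots> \<le> ennreal \<delta>"
    proof (rule SUP_least)
      fix N
      from k[of "Suc N"] obtain Z where Z: "integrable M Z"
        "AE x in M. \<forall>n<Suc N. Y (k + n) x \<le> Z x" "(\<integral>x. Z x \<partial>M) \<le> \<delta>" by blast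
      have "(\<integral>\<^sup>+x. ?G N x \<partial>M) \<le> (\<integral>\<^sup>+x. ennreal (Z x) \<partial>M)"
        using Z(2) by (intro nn_integral_mono_AE) (auto elim!: eventually_mono intro!: SUP_least ennreal_leI)
      also have "\<dots> = ennreal (\<integral>x. Z x \<partial>M)"
      proof (rule nn_integral_eq_integral[OF Z(1)])
        show "AE x in M. 0 \<le> Z x"
          using Z(2) by eventually_elim (use nonneg order_trans in \<open>blast intro: order_trans\<close>)
      qed
      also have "\<dots> \<le> ennreal \<delta>" using Z(3) by (rule ennreal_leI)
      finally show "(\<integral>\<^sup>+x. ?G N x \<partial>M) \<le> ennreal \<delta>" .
    qed
    finally show ?thesis by simp
  qed
  then have "(\<integral>\<^sup>+x. ?L x \<partial>M) \<le> 0" by (rule ennreal_le_epsilon)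
  then have "(\<integral>\<^sup>+x. ?L x \<partial>M) = 0" by simp
  then have "AE x in M. ?L x = 0" by (subst (asm) nn_integral_0_iff_AE) auto
  then show "AE x in M. (\<lambda>n. Y n x) \<longlonglongrightarrow> 0"
  proof eventually_elim
    case (elim x)
    then have "(\<lambda>n. ennreal (Y n x)) \<longlonglongrightarrow> ennreal 0"
      by (simp add: tendsto_0_if_Limsup_eq_0_ennreal)
    then show ?case by (rule tendsto_ennrealD) (auto simp: nonneg)
  qed
  show "(\<lambda>n. \<integral>x. Y n x \<partial>M) \<longlonglongrightarrow> 0"
  proof (rule LIMSEQ_I)
    fix r :: real assume "r > 0"
    then obtain k where k: "\<And>N. \<exists>Z. integrable M Z \<and>
        (AE x in M. \<forall>n<N. Y (k + n) x \<le> Z x) \<and> (\<integral>x. Z x \<partial>M) \<le> r / 2"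
      using dom[of "r / 2"] by auto
    have "norm ((\<integral>x. Y n x \<partial>M) - 0) < r" if "n \<ge> k" for n
    proof -
      from k[of "Suc (n - k)"] obtain Z where Z: "integrable M Z"
        "AE x in M. \<forall>m<Suc (n - k). Y (k + m) x \<le> Z x" "(\<integral>x. Z x \<partial>M) \<le> r / 2" by blast
      from Z(2) have "AE x in M. Y n x \<le> Z x"
      proof eventually_elim
        case (elim x)
        then have "Y (k + (n - k)) x \<le> Z x" by blast
        with that show ?case by simp
      qed
      then have "(\<integral>x. Y n x \<partial>M) \<le> (\<integral>x. Z x \<partial>M)" using int Z by (intro integral_mono_AE)
      moreover have "0 \<le> (\<integral>x. Y n x \<partial>M)" using nonneg by (intro integral_nonneg_AE) auto
      ultimately show ?thesis using Z(3) \<open>r > 0\<close> by simp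
    qed
    then show "\<exists>no. \<forall>n\<ge>no. norm ((\<integral>x. Y n x \<partial>M) - 0) < r" by blast
  qed
qed

text \<open>
  The relations between the operators, written for integrable representatives; \<open>S\<close> is the adjoint of \<open>Q\<close>.
\<close>

locale dominated_markov = prob_space M for M :: "'a measure" +
  fixes Q S V W :: "('a \<Rightarrow> real) \<Rightarrow> 'a \<Rightarrow> real"
    and A :: "nat \<Rightarrow> ('a \<Rightarrow> real) \<Rightarrow> 'a \<Rightarrow> real"
    and \<alpha> :: "nat \<Rightarrow> real" and C K :: real and a b m0 :: nat
  assumes dual: "dual_pair M Q S"
    and V: "markov_operator M V" and W: "markov_operator M W"
    and Q_VW: "\<And>f. integrable M f \<Longrightarrow> AE x in M. Q f x = V (W f) x"
    and S_WV: "\<And>f. integrable M f \<Longrightarrow> AE x in M. S f x = W (V f) x"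
    and m0: "a \<le> 2 * m0" and C: "C > 0" and K: "K \<ge> 0"
    and A_integrable: "\<And>n f. n \<ge> m0 \<Longrightarrow> integrable M f \<Longrightarrow> integrable M (A n f)"
    and A_nonneg: "\<And>n f. n \<ge> m0 \<Longrightarrow> integrable M f \<Longrightarrow> AE x in M. 0 \<le> f x \<Longrightarrow> AE x in M. 0 \<le> A n f x"
    and A_norm: "\<And>n f. n \<ge> m0 \<Longrightarrow> integrable M f \<Longrightarrow>
                   (\<integral>x. \<bar>A n f x\<bar> \<partial>M) \<le> \<alpha> n * (\<integral>x. \<bar>f x\<bar> \<partial>M)"
    and \<alpha>_summable: "summable (\<lambda>n. \<alpha> (n + m0))"
    and \<alpha>_le: "(\<Sum>n. \<alpha> (n + m0)) \<le> K"
    and domination: "\<And>n f. n \<ge> m0 \<Longrightarrow> integrable M f \<Longrightarrow> AE x in M. 0 \<le> f x \<Longrightarrow>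
           AE x in M. W ((Q ^^ (2 * n - a)) f) x
              \<le> C * (\<Sum>j \<in> {j \<in> {- int b..int b}. 0 \<le> int n + j}.
                        (S ^^ n) ((Q ^^ nat (int n + j)) f) x) + A n f x"
begin

lemmas Q = dual_markov(1)[OF dual] and S = dual_markov(2)[OF dual]
  and Q_pow = dual_markov_pow(1)[OF dual] and S_pow = dual_markov_pow(2)[OF dual]
  and Q_pow_Linf = dual_Linf_pow(1)[OF dual] and S_pow_Linf = dual_Linf_pow(2)[OF dual]

lemma \<alpha>_nonneg: "n \<ge> m0 \<Longrightarrow> 0 \<le> \<alpha> n"
proof -
  assume "n \<ge> m0"
  then have "(\<integral>x. \<bar>A n (\<lambda>_. 1) x\<bar> \<partial>M) \<le> \<alpha> n * (\<integral>x. \<bar>1\<bar> \<partial>M)" by (intro A_norm) auto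
  moreover have "0 \<le> (\<integral>x. \<bar>A n (\<lambda>_. 1) x\<bar> \<partial>M)"
    by (rule integral_nonneg_AE) simp
  ultimately have "0 \<le> \<alpha> n * (\<integral>x. \<bar>1\<bar> \<partial>M)" by (rule order_trans[rotated])
  then show ?thesis by (simp add: prob_space)
qed

lemma \<alpha>_partial_sum: "(\<Sum>n<N. \<alpha> (n + m0)) \<le> K"
  using sum_le_suminf[OF \<alpha>_summable, of "{..<N}"] \<alpha>_nonneg \<alpha>_le by auto

text \<open>
  The index \<open>j\<close> of the domination hypothesis contributes the terms \<open>S\<^sup>n Q\<^bsup>n+j\<^esup>\<close>. With \<open>r = max 0 (- j)\<close> each of them is
  \<open>S\<^sup>r (S\<^sup>k Q\<^sup>k) Q\<^bsup>j+r\<^esup>\<close> for \<open>k = n - r\<close>, so one maximal function of Rota type per \<open>j\<close> suffices. Applying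
  \<open>V\<close> to the resulting bound of \<open>W Q\<^bsup>2n-a\<^esup>\<close> gives a bound for \<open>Q\<^bsup>2n-a+1\<^esup>\<close>; the parameter \<open>i\<close> serves to reach both
  parities of the exponent.
\<close>

lemma maximal_one_parity:
  assumes \<phi>: "\<phi> \<in> Linf M" "AE x in M. 0 \<le> \<phi> x" and \<epsilon>: "\<epsilon> > 0"
  shows "\<exists>Z. integrable M Z \<and> (AE x in M. 0 \<le> Z x) \<and>
    (AE x in M. \<forall>n<N. (Q ^^ (2 * (n + m0) - a + 1 + i)) \<phi> x \<le> Z x) \<and>
    (\<integral>x. Z x \<partial>M) \<le> C * (2 * b + 1) * (4 * (entropy_excess M \<epsilon> \<phi> + 2 * \<epsilon>)) + K * (\<integral>x. \<phi> x \<partial>M)"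
proof -
  define \<psi> where "\<psi> = (Q ^^ i) \<phi>"
  have \<psi>: "\<psi> \<in> Linf M" "AE x in M. 0 \<le> \<psi> x"
    unfolding \<psi>_def using \<phi> Q_pow_Linf markov_nonneg[OF Q_pow Linf_integrable] by blast+
  have int\<psi>: "(\<integral>x. \<bar>\<psi> x\<bar> \<partial>M) = (\<integral>x. \<phi> x \<partial>M)"
  proof -
    have "(\<integral>x. \<bar>\<psi> x\<bar> \<partial>M) = (\<integral>x. \<psi> x \<partial>M)"
      using \<psi> by (intro integral_cong_AE) (auto dest: Linf_measurable)
    then show ?thesis using \<phi> unfolding \<psi>_def by (simp add: markov_integral[OF Q_pow])
  qed
  let ?I = "{- int b..int b}" and ?N = "Suc (N + m0)"
  let ?B = "4 * (entropy_excess M \<epsilon> \<phi> + 2 * \<epsilon>)"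
  let ?X = "\<lambda>j k. (S ^^ nat (- j)) ((S ^^ k) ((Q ^^ k) ((Q ^^ (nat j + i)) \<phi>)))"
  have "\<forall>j. \<exists>Z. Z \<in> Linf M \<and> (\<forall>k<?N. \<forall>x. ?X j k x \<le> Z x) \<and> (\<integral>x. Z x \<partial>M) \<le> ?B"
    using Rota_maximal[OF dual \<phi> \<epsilon>, of ?N] by blast
  then obtain Z where Z: "\<And>j. Z j \<in> Linf M" "\<And>j k x. k < ?N \<Longrightarrow> ?X j k x \<le> Z j x"
    "\<And>j. (\<integral>x. Z j x \<partial>M) \<le> ?B"
    by metis
  have Z0: "AE x in M. 0 \<le> Z j x" for j
  proof -
    have "AE x in M. 0 \<le> ?X j 0 x"
      using \<phi> by (intro markov_nonneg[OF S_pow] markov_nonneg[OF Q_pow] Linf_integrable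
          Q_pow_Linf S_pow_Linf)
    then show ?thesis by eventually_elim (use Z(2)[of 0 j] in \<open>auto intro: order_trans\<close>)
  qed
  define Y where "Y x = C * (\<Sum>j\<in>?I. Z j x) + (\<Sum>n<N. A (n + m0) \<psi> x)" for x
  have A: "integrable M (A (n + m0) \<psi>)" "AE x in M. 0 \<le> A (n + m0) \<psi> x" for n
    by (intro A_integrable A_nonneg Linf_integrable \<psi> le_add2)+
  have Y: "integrable M Y"
    unfolding Y_def using Z(1) A by auto
  have Z0': "AE x in M. \<forall>j\<in>?I. 0 \<le> Z j x" using Z0 by (intro AE_finite_allI) auto
  have A0': "AE x in M. \<forall>n. 0 \<le> A (n + m0) \<psi> x" using A(2) by (simp add: AE_all_countable)
  have Y0: "AE x in M. 0 \<le> Y x"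
    using Z0' A0' unfolding Y_def
    by eventually_elim (use C in \<open>auto intro!: add_nonneg_nonneg mult_nonneg_nonneg sum_nonneg\<close>)
  have step: "AE x in M. (Q ^^ (2 * (n + m0) - a + 1 + i)) \<phi> x \<le> V Y x" if n: "n < N" for n
  proof -
    let ?g = "(Q ^^ (2 * (n + m0) - a)) \<psi>"
    have g: "?g \<in> Linf M" using \<psi> by (auto intro: Q_pow_Linf)
    have "AE x in M. W ?g x \<le> C * (\<Sum>j \<in> {j \<in> ?I. 0 \<le> int (n + m0) + j}.
                        (S ^^ (n + m0)) ((Q ^^ nat (int (n + m0) + j)) \<psi>) x) + A (n + m0) \<psi> x"
      using \<psi> by (intro domination) auto
    then have "AE x in M. W ?g x \<le> Y x"
      using Z0' A0'
    proof eventually_elim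
      case (elim x)
      have termwise: "(S ^^ (n + m0)) ((Q ^^ nat (int (n + m0) + j)) \<psi>) x \<le> Z j x"
        if j: "0 \<le> int (n + m0) + j" for j
      proof -
        have "nat (- j) + (n + m0 - nat (- j)) = n + m0" using j by auto
        then have "(S ^^ (n + m0)) f = (S ^^ nat (- j)) ((S ^^ (n + m0 - nat (- j))) f)" for f
          by (metis comp_apply funpow_add)
        moreover have "nat (int (n + m0) + j) + i = (n + m0 - nat (- j)) + (nat j + i)" using j by auto
        then have "(Q ^^ nat (int (n + m0) + j)) \<psi>
            = (Q ^^ (n + m0 - nat (- j))) ((Q ^^ (nat j + i)) \<phi>)"
          unfolding \<psi>_def by (metis comp_apply funpow_add)
        ultimately show ?thesis using Z(2)[of "n + m0 - nat (- j)" j x] n by simp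
      qed
      have "(\<Sum>j \<in> {j \<in> ?I. 0 \<le> int (n + m0) + j}. (S ^^ (n + m0)) ((Q ^^ nat (int (n + m0) + j)) \<psi>) x)
          \<le> (\<Sum>j \<in> {j \<in> ?I. 0 \<le> int (n + m0) + j}. Z j x)"
        by (intro sum_mono termwise) auto
      also have "\<dots> \<le> (\<Sum>j\<in>?I. Z j x)" using elim by (intro sum_mono2) auto
      finally have "C * (\<Sum>j \<in> {j \<in> ?I. 0 \<le> int (n + m0) + j}.
          (S ^^ (n + m0)) ((Q ^^ nat (int (n + m0) + j)) \<psi>) x) \<le> C * (\<Sum>j\<in>?I. Z j x)"
        using C by (intro mult_left_mono) auto
      moreover have "A (n + m0) \<psi> x \<le> (\<Sum>n<N. A (n + m0) \<psi> x)"
        using elim n by (intro member_le_sum) auto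
      ultimately show ?case using elim(1) unfolding Y_def by linarith
    qed
    then have "AE x in M. V (W ?g) x \<le> V Y x"
      using g Y by (intro markov_mono[OF V] markov_integrable[OF W]) auto
    moreover have "AE x in M. Q ?g x = V (W ?g) x" using g by (intro Q_VW) auto
    moreover have "Q ?g = (Q ^^ (2 * (n + m0) - a + 1 + i)) \<phi>"
      unfolding \<psi>_def by (simp add: funpow_add)
    ultimately show ?thesis by auto
  qed
  have "(\<integral>x. V Y x \<partial>M) = (\<integral>x. Y x \<partial>M)" using Y by (rule markov_integral[OF V])
  also have "\<dots> = C * (\<Sum>j\<in>?I. \<integral>x. Z j x \<partial>M) + (\<Sum>n<N. \<integral>x. A (n + m0) \<psi> x \<partial>M)"
    unfolding Y_def using Z(1) A by (simp add: Bochner_Integration.integral_sum)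
  also have "\<dots> \<le> C * (\<Sum>j\<in>?I. ?B) + (\<Sum>n<N. \<alpha> (n + m0) * (\<integral>x. \<phi> x \<partial>M))"
  proof (intro add_mono mult_left_mono sum_mono Z(3))
    fix n
    have "(\<integral>x. A (n + m0) \<psi> x \<partial>M) \<le> (\<integral>x. \<bar>A (n + m0) \<psi> x\<bar> \<partial>M)"
      using A by (intro integral_mono) auto
    also have "\<dots> \<le> \<alpha> (n + m0) * (\<integral>x. \<bar>\<psi> x\<bar> \<partial>M)" using \<psi> by (intro A_norm) auto
    finally show "(\<integral>x. A (n + m0) \<psi> x \<partial>M) \<le> \<alpha> (n + m0) * (\<integral>x. \<phi> x \<partial>M)"
      unfolding int\<psi> .
  qed (use C in auto)
  also have "C * (\<Sum>j\<in>?I. ?B) = C * (2 * b + 1) * ?B" by simp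
  also have "(\<Sum>n<N. \<alpha> (n + m0) * (\<integral>x. \<phi> x \<partial>M)) \<le> K * (\<integral>x. \<phi> x \<partial>M)"
    unfolding sum_distrib_right[symmetric]
    using \<phi> by (intro mult_right_mono \<alpha>_partial_sum integral_nonneg_AE)
  finally have "(\<integral>x. V Y x \<partial>M) \<le> C * (2 * b + 1) * ?B + K * (\<integral>x. \<phi> x \<partial>M)" by simp
  moreover have "AE x in M. \<forall>n\<in>{..<N}. (Q ^^ (2 * (n + m0) - a + 1 + i)) \<phi> x \<le> V Y x"
    using step by (intro AE_finite_allI) auto
  ultimately show ?thesis
    using Y Y0 markov_nonneg[OF V Y Y0] markov_integrable[OF V Y] by (intro exI[of _ "V Y"]) auto
qed

text \<open>
  Where \<open>\<phi> > 3 \<epsilon>\<close>, the logarithm of \<open>\<phi> / \<epsilon>\<close> exceeds \<open>1\<close>, since \<open>exp 1 \<le> 3\<close>.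
\<close>

lemma integral_le_entropy_excess:
  assumes \<phi>: "integrable M \<phi>" "AE x in M. 0 \<le> \<phi> x" and \<epsilon>: "\<epsilon> > 0"
    and ent: "integrable M (\<lambda>x. \<phi> x * max 0 (ln (\<phi> x / \<epsilon>)))"
  shows "(\<integral>x. \<phi> x \<partial>M) \<le> entropy_excess M \<epsilon> \<phi> + 3 * \<epsilon>"
proof -
  have "(\<integral>x. \<phi> x \<partial>M) \<le> (\<integral>x. \<phi> x * max 0 (ln (\<phi> x / \<epsilon>)) + 3 * \<epsilon> \<partial>M)"
  proof (rule integral_mono_AE)
    show "AE x in M. \<phi> x \<le> \<phi> x * max 0 (ln (\<phi> x / \<epsilon>)) + 3 * \<epsilon>"
      using \<phi>(2)
    proof eventually_elim
      case (elim x)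
      show ?case
      proof (cases "\<phi> x \<le> 3 * \<epsilon>")
        case False
        then have "exp 1 \<le> \<phi> x / \<epsilon>" 
          using exp_le \<epsilon> by (subst le_divide_eq) (auto intro: order_trans[OF mult_right_mono[OF exp_le]])
        then have "1 \<le> ln (\<phi> x / \<epsilon>)"
          by (metis exp_gt_zero exp_le_cancel_iff exp_ln order_less_le_trans)
        then have "\<phi> x * 1 \<le> \<phi> x * max 0 (ln (\<phi> x / \<epsilon>))" using elim by (intro mult_left_mono) auto
        then show ?thesis using \<epsilon> by simp
      next
        case True
        have "0 \<le> \<phi> x * max 0 (ln (\<phi> x / \<epsilon>))" using elim by auto
        with True show ?thesis by simp
      qed
    qed
  qed (use \<phi> ent in auto)
  then show ?thesis using ent by (simp add: entropy_excess_def prob_space)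
qed

definition maximal_const :: real where
  "maximal_const = 16 * (C * (2 * b + 1)) + 6 * K + 1"

lemma maximal_const_pos: "maximal_const > 0"
  unfolding maximal_const_def using C K by (auto intro!: add_nonneg_pos)

lemma entropy_excess_nonneg:
  assumes "AE x in M. 0 \<le> \<phi> x" shows "0 \<le> entropy_excess M \<epsilon> \<phi>"
  unfolding entropy_excess_def
proof (rule integral_nonneg_AE)
  show "AE x in M. 0 \<le> \<phi> x * max 0 (ln (\<phi> x / \<epsilon>))"
    using assms by eventually_elim auto
qed

lemma maximal_bounded:
  assumes \<phi>: "\<phi> \<in> Linf M" "AE x in M. 0 \<le> \<phi> x" and \<epsilon>: "\<epsilon> > 0"
  shows "\<exists>Z. integrable M Z \<and> (AE x in M. \<forall>n<N. (Q ^^ (2 * m0 - a + 1 + n)) \<phi> x \<le> Z x) \<and>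
    (\<integral>x. Z x \<partial>M) \<le> maximal_const * (entropy_excess M \<epsilon> \<phi> + \<epsilon>)"
proof -
  let ?L = "entropy_excess M \<epsilon> \<phi>"
  let ?B = "C * (2 * b + 1) * (4 * (?L + 2 * \<epsilon>)) + K * (\<integral>x. \<phi> x \<partial>M)"
  obtain Y where Y: "integrable M Y" "AE x in M. 0 \<le> Y x"
    "AE x in M. \<forall>n<N. (Q ^^ (2 * (n + m0) - a + 1 + 0)) \<phi> x \<le> Y x" "(\<integral>x. Y x \<partial>M) \<le> ?B"
    using maximal_one_parity[OF \<phi> \<epsilon>, of N 0] by blast
  obtain Z where Z: "integrable M Z" "AE x in M. 0 \<le> Z x"
    "AE x in M. \<forall>n<N. (Q ^^ (2 * (n + m0) - a + 1 + 1)) \<phi> x \<le> Z x" "(\<integral>x. Z x \<partial>M) \<le> ?B"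
    using maximal_one_parity[OF \<phi> \<epsilon>, of N 1] by blast
  have "AE x in M. \<forall>n<N. (Q ^^ (2 * m0 - a + 1 + n)) \<phi> x \<le> Y x + Z x"
    using Y(2) Z(2) Y(3) Z(3)
  proof eventually_elim
    case (elim x)
    show ?case
    proof (intro allI impI)
      fix n assume n: "n < N"
      then have half: "n div 2 < N" by auto
      show "(Q ^^ (2 * m0 - a + 1 + n)) \<phi> x \<le> Y x + Z x"
      proof (cases "even n")
        case True
        then have eq: "2 * m0 - a + 1 + n = 2 * (n div 2 + m0) - a + 1 + 0" using m0 by presburger
        have "(Q ^^ (2 * m0 - a + 1 + n)) \<phi> x \<le> Y x"
          unfolding eq by (rule elim(3)[rule_format, OF half])
        then show ?thesis by (rule add_increasing2[OF elim(2)])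
      next
        case False
        then obtain q where q: "n = 2 * q + 1" by (rule oddE)
        then have eq: "2 * m0 - a + 1 + n = 2 * (n div 2 + m0) - a + 1 + 1" using m0 by auto
        have "(Q ^^ (2 * m0 - a + 1 + n)) \<phi> x \<le> Z x"
          unfolding eq by (rule elim(4)[rule_format, OF half])
        then show ?thesis by (rule add_increasing[OF elim(1)])
      qed
    qed
  qed
  moreover have "(\<integral>x. Y x + Z x \<partial>M) \<le> maximal_const * (?L + \<epsilon>)"
  proof -
    have L: "0 \<le> ?L" using \<phi> by (intro entropy_excess_nonneg)
    have "(\<integral>x. \<phi> x \<partial>M) \<le> ?L + 3 * \<epsilon>"
      using \<phi> \<epsilon> by (intro integral_le_entropy_excess Linf_entropy_integrable) auto
    then have "K * (\<integral>x. \<phi> x \<partial>M) \<le> K * (?L + 3 * \<epsilon>)" using K by (rule mult_left_mono)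
    moreover have "(\<integral>x. Y x + Z x \<partial>M) \<le> ?B + ?B"
      using Y(1,4) Z(1,4) by (subst Bochner_Integration.integral_add) (auto intro: add_mono)
    moreover have "0 \<le> (C * (2 * b + 1)) * ?L" "0 \<le> K * ?L" using C K L by auto
    moreover have "?B + ?B = 8 * ((C * (2 * b + 1)) * ?L) + 16 * ((C * (2 * b + 1)) * \<epsilon>)
        + 2 * (K * (\<integral>x. \<phi> x \<partial>M))"
      by (simp add: algebra_simps)
    moreover have "maximal_const * (?L + \<epsilon>) = 16 * ((C * (2 * b + 1)) * ?L) + 16 * ((C * (2 * b + 1)) * \<epsilon>)
        + 6 * (K * ?L) + 6 * (K * \<epsilon>) + ?L + \<epsilon>"
      by (simp add: maximal_const_def algebra_simps)
    moreover have "K * (?L + 3 * \<epsilon>) = K * ?L + 3 * (K * \<epsilon>)" by (simp add: algebra_simps)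
    ultimately show ?thesis using L \<epsilon> by linarith
  qed
  ultimately show ?thesis using Y(1) Z(1) by (intro exI[of _ "\<lambda>x. Y x + Z x"]) auto
qed

text \<open>
  The bounded case is applied to a truncation of \<open>\<phi>\<close> so close to \<open>\<phi>\<close> in \<open>L\<^sup>1\<close>, depending on the length \<open>N\<close> of the
  window, that the \<open>N\<close> differences together cost at most \<open>\<epsilon>\<close>.
\<close>

lemma maximal_LlogL:
  assumes \<phi>: "integrable M \<phi>" "AE x in M. 0 \<le> \<phi> x" and \<epsilon>: "\<epsilon> > 0"
    and ent: "integrable M (\<lambda>x. \<phi> x * max 0 (ln (\<phi> x / \<epsilon>)))"
  shows "\<exists>Z. integrable M Z \<and> (AE x in M. \<forall>n<N. (Q ^^ (2 * m0 - a + 1 + n)) \<phi> x \<le> Z x) \<and>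
    (\<integral>x. Z x \<partial>M) \<le> maximal_const * (entropy_excess M \<epsilon> \<phi> + \<epsilon>) + \<epsilon>"
proof -
  define d where "d = 2 * m0 - a + 1"
  define t where "t k x = max (- real k) (min (real k) (\<phi> x))" for k x
  have "(\<lambda>k. real N * (\<integral>x. \<bar>\<phi> x - t k x\<bar> \<partial>M)) \<longlonglongrightarrow> real N * 0"
    unfolding t_def by (intro tendsto_intros truncation_tendsto \<phi>)
  then have "eventually (\<lambda>k. real N * (\<integral>x. \<bar>\<phi> x - t k x\<bar> \<partial>M) < \<epsilon>) sequentially"
    using \<epsilon> by (intro order_tendstoD(2)[where y = "real N * 0"]) auto
  then obtain k where k: "real N * (\<integral>x. \<bar>\<phi> x - t k x\<bar> \<partial>M) < \<epsilon>"
    by (auto simp: eventually_sequentially)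
  have tL: "t k \<in> Linf M" unfolding t_def by (rule Linf_truncation[OF \<phi>(1)])
  have t0: "AE x in M. 0 \<le> t k x" using \<phi>(2) by eventually_elim (auto simp: t_def)
  have excess: "entropy_excess M \<epsilon> (t k) \<le> entropy_excess M \<epsilon> \<phi>"
    unfolding entropy_excess_def
  proof (rule integral_mono_AE)
    show "AE x in M. t k x * max 0 (ln (t k x / \<epsilon>)) \<le> \<phi> x * max 0 (ln (\<phi> x / \<epsilon>))"
      using \<phi>(2) t0
    proof eventually_elim
      case (elim x)
      have le: "t k x \<le> \<phi> x" using elim by (auto simp: t_def)
      show ?case
      proof (cases "t k x = 0")
        case False
        then have "t k x > 0" using elim by simp
        then have "ln (t k x / \<epsilon>) \<le> ln (\<phi> x / \<epsilon>)" using le \<epsilon> by (simp add: divide_right_mono)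
        then show ?thesis using le elim by (intro mult_mono max.mono) auto
      qed (use elim in simp)
    qed
  qed (use ent Linf_entropy_integrable[OF tL t0 \<epsilon>] in auto)
  from maximal_bounded[OF tL t0 \<epsilon>, of N] obtain Z where Z: "integrable M Z"
    "AE x in M. \<forall>n<N. (Q ^^ (d + n)) (t k) x \<le> Z x"
    "(\<integral>x. Z x \<partial>M) \<le> maximal_const * (entropy_excess M \<epsilon> (t k) + \<epsilon>)"
    unfolding d_def by blast
  let ?D = "\<lambda>n x. \<bar>(Q ^^ (d + n)) \<phi> x - (Q ^^ (d + n)) (t k) x\<bar>"
  let ?Z = "\<lambda>x. Z x + (\<Sum>n<N. ?D n x)"
  have D: "integrable M (?D n)" for n
    using markov_integrable[OF Q_pow \<phi>(1)] markov_integrable[OF Q_pow Linf_integrable[OF tL]] by auto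
  have "AE x in M. \<forall>n<N. (Q ^^ (d + n)) \<phi> x \<le> ?Z x"
    using Z(2)
  proof eventually_elim
    case (elim x)
    show ?case
    proof (intro allI impI)
      fix n assume n: "n < N"
      then have "?D n x \<le> (\<Sum>n<N. ?D n x)" by (intro member_le_sum) auto
      moreover have "(Q ^^ (d + n)) (t k) x \<le> Z x" using elim n by blast
      ultimately show "(Q ^^ (d + n)) \<phi> x \<le> ?Z x" by linarith
    qed
  qed
  moreover have "(\<integral>x. ?Z x \<partial>M) \<le> maximal_const * (entropy_excess M \<epsilon> \<phi> + \<epsilon>) + \<epsilon>"
  proof -
    have "(\<integral>x. ?Z x \<partial>M) = (\<integral>x. Z x \<partial>M) + (\<Sum>n<N. \<integral>x. ?D n x \<partial>M)"
      using Z(1) D by (simp add: Bochner_Integration.integral_sum del: funpow.simps)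
    also have "(\<Sum>n<N. \<integral>x. ?D n x \<partial>M) \<le> (\<Sum>n<N. \<integral>x. \<bar>\<phi> x - t k x\<bar> \<partial>M)"
      using \<phi> tL by (intro sum_mono markov_L1_contraction[OF Q_pow]) auto
    also have "\<dots> \<le> \<epsilon>" using k by simp
    also have "(\<integral>x. Z x \<partial>M) \<le> maximal_const * (entropy_excess M \<epsilon> \<phi> + \<epsilon>)"
      using Z(3) excess maximal_const_pos by (meson add_right_mono mult_left_mono order_less_imp_le order_trans)
    finally show ?thesis by simp
  qed
  moreover have "integrable M ?Z" using Z(1) D by auto
  ultimately show ?thesis unfolding d_def[symmetric] by blast
qed

lemma LlogL_integrable:
  assumes "\<phi> \<in> LlogL M" shows "integrable M \<phi>"
proof (rule Bochner_Integration.integrable_bound)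
  show "integrable M (\<lambda>x. 3 + \<bar>\<phi> x\<bar> * max 0 (ln \<bar>\<phi> x\<bar>))"
    using assms by (auto simp: LlogL_def)
  show "\<phi> \<in> borel_measurable M" using assms by (auto simp: LlogL_def)
  show "AE x in M. norm (\<phi> x) \<le> norm (3 + \<bar>\<phi> x\<bar> * max 0 (ln \<bar>\<phi> x\<bar>))"
  proof (rule AE_I2)
    fix x
    have "\<bar>\<phi> x\<bar> \<le> 3 + \<bar>\<phi> x\<bar> * max 0 (ln \<bar>\<phi> x\<bar>)"
    proof (cases "\<bar>\<phi> x\<bar> \<le> 3")
      case False
      then have "exp 1 \<le> \<bar>\<phi> x\<bar>" using exp_le by linarith
      then have "1 \<le> ln \<bar>\<phi> x\<bar>" using False by (subst ln_ge_iff) auto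
      then have "\<bar>\<phi> x\<bar> * 1 \<le> \<bar>\<phi> x\<bar> * max 0 (ln \<bar>\<phi> x\<bar>)" by (intro mult_left_mono) auto
      then show ?thesis by simp
    qed (simp add: add_increasing2)
    then show "norm (\<phi> x) \<le> norm (3 + \<bar>\<phi> x\<bar> * max 0 (ln \<bar>\<phi> x\<bar>))" by simp
  qed
qed

lemma LlogL_excess_integrable:
  assumes "\<phi> \<in> LlogL M" and \<epsilon>: "\<epsilon> > 0"
  shows "integrable M (\<lambda>x. \<bar>\<phi> x\<bar> * max 0 (ln (\<bar>\<phi> x\<bar> / \<epsilon>)))"
proof (rule Bochner_Integration.integrable_bound)
  have [measurable]: "\<phi> \<in> borel_measurable M" using assms by (auto simp: LlogL_def)
  show "integrable M (\<lambda>x. \<bar>\<phi> x\<bar> * max 0 (ln \<bar>\<phi> x\<bar>) + \<bar>ln \<epsilon>\<bar> * \<bar>\<phi> x\<bar>)"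
    using assms LlogL_integrable[OF assms(1)] by (auto simp: LlogL_def)
  show "(\<lambda>x. \<bar>\<phi> x\<bar> * max 0 (ln (\<bar>\<phi> x\<bar> / \<epsilon>))) \<in> borel_measurable M" by measurable
  show "AE x in M. norm (\<bar>\<phi> x\<bar> * max 0 (ln (\<bar>\<phi> x\<bar> / \<epsilon>)))
      \<le> norm (\<bar>\<phi> x\<bar> * max 0 (ln \<bar>\<phi> x\<bar>) + \<bar>ln \<epsilon>\<bar> * \<bar>\<phi> x\<bar>)"
  proof (rule AE_I2)
    fix x
    have "\<bar>\<phi> x\<bar> * max 0 (ln (\<bar>\<phi> x\<bar> / \<epsilon>)) \<le> \<bar>\<phi> x\<bar> * (max 0 (ln \<bar>\<phi> x\<bar>) + \<bar>ln \<epsilon>\<bar>)"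
    proof (cases "\<phi> x = 0")
      case False
      then have "ln (\<bar>\<phi> x\<bar> / \<epsilon>) = ln \<bar>\<phi> x\<bar> - ln \<epsilon>" using \<epsilon> by (simp add: ln_div)
      then show ?thesis by (intro mult_left_mono) auto
    qed simp
    then show "norm (\<bar>\<phi> x\<bar> * max 0 (ln (\<bar>\<phi> x\<bar> / \<epsilon>)))
      \<le> norm (\<bar>\<phi> x\<bar> * max 0 (ln \<bar>\<phi> x\<bar>) + \<bar>ln \<epsilon>\<bar> * \<bar>\<phi> x\<bar>)"
      by (simp add: algebra_simps)
  qed
qed

text \<open>
  Dominated convergence: the truncation error vanishes at each point for large \<open>k\<close>.
\<close>

lemma tail_excess:
  assumes \<phi>: "\<phi> \<in> LlogL M" and \<epsilon>: "\<epsilon> > 0"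
  defines "r \<equiv> \<lambda>k x. \<bar>\<phi> x - max (- real k) (min (real k) (\<phi> x))\<bar>"
  shows "integrable M (\<lambda>x. r k x * max 0 (ln (r k x / \<epsilon>)))"
    and "(\<lambda>k. entropy_excess M \<epsilon> (r k)) \<longlonglongrightarrow> 0"
proof -
  have [measurable]: "\<phi> \<in> borel_measurable M" using \<phi> by (auto simp: LlogL_def)
  have [measurable]: "r k \<in> borel_measurable M" for k unfolding r_def by measurable
  let ?w = "\<lambda>x. \<bar>\<phi> x\<bar> * max 0 (ln (\<bar>\<phi> x\<bar> / \<epsilon>))"
  have w: "integrable M ?w" using \<phi> \<epsilon> by (rule LlogL_excess_integrable)
  have le: "norm (r k x * max 0 (ln (r k x / \<epsilon>))) \<le> ?w x" for k x
  proof (cases "r k x = 0")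
    case False
    have r: "0 < r k x" "r k x \<le> \<bar>\<phi> x\<bar>" using False unfolding r_def by auto
    then have "ln (r k x / \<epsilon>) \<le> ln (\<bar>\<phi> x\<bar> / \<epsilon>)" using \<epsilon> by (simp add: divide_right_mono)
    then have "r k x * max 0 (ln (r k x / \<epsilon>)) \<le> ?w x" using r by (intro mult_mono max.mono) auto
    then show ?thesis using r by (simp add: abs_mult)
  qed simp
  show "integrable M (\<lambda>x. r k x * max 0 (ln (r k x / \<epsilon>)))"
    by (rule Bochner_Integration.integrable_bound[OF w])
      (use le in \<open>auto intro!: AE_I2 intro: order_trans[OF _ abs_ge_self]\<close>)
  have "(\<lambda>k. \<integral>x. r k x * max 0 (ln (r k x / \<epsilon>)) \<partial>M) \<longlonglongrightarrow> (\<integral>x. 0 \<partial>M)"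
  proof (rule integral_dominated_convergence[OF _ _ w])
    show "AE x in M. (\<lambda>k. r k x * max 0 (ln (r k x / \<epsilon>))) \<longlonglongrightarrow> 0"
    proof (rule AE_I2)
      fix x
      obtain K :: nat where "\<bar>\<phi> x\<bar> \<le> real K" using real_arch_simple by blast
      then have "\<forall>k\<ge>K. r k x * max 0 (ln (r k x / \<epsilon>)) = 0" by (auto simp: r_def)
      then show "(\<lambda>k. r k x * max 0 (ln (r k x / \<epsilon>))) \<longlonglongrightarrow> 0"
        by (intro tendsto_eventually) (auto simp: eventually_sequentially)
    qed
  qed (use le in \<open>auto intro!: AE_I2\<close>)
  then show "(\<lambda>k. entropy_excess M \<epsilon> (r k)) \<longlonglongrightarrow> 0" by (simp add: entropy_excess_def)
qed

lemma entropy_excess_bounded_le: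
  assumes g: "g \<in> Linf M" "AE x in M. 0 \<le> g x" "AE x in M. g x \<le> B" and \<epsilon>: "\<epsilon> > 0"
  shows "entropy_excess M \<epsilon> g \<le> max 0 (ln (B / \<epsilon>)) * (\<integral>x. g x \<partial>M)"
proof -
  have "entropy_excess M \<epsilon> g \<le> (\<integral>x. g x * max 0 (ln (B / \<epsilon>)) \<partial>M)"
    unfolding entropy_excess_def
  proof (rule integral_mono_AE)
    show "AE x in M. g x * max 0 (ln (g x / \<epsilon>)) \<le> g x * max 0 (ln (B / \<epsilon>))"
      using g(2,3)
    proof eventually_elim
      case (elim x)
      show ?case
      proof (cases "g x = 0")
        case False
        then have "ln (g x / \<epsilon>) \<le> ln (B / \<epsilon>)" using elim \<epsilon> by (simp add: divide_right_mono)
        then show ?thesis using elim by (intro mult_left_mono max.mono) auto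
      qed simp
    qed
  qed (use g Linf_entropy_integrable[OF g(1,2) \<epsilon>] in auto)
  then show ?thesis by (simp add: mult.commute)
qed

section \<open>Convergence from mean convergence of bounded functions\<close>

context
  assumes mean: "\<And>f. f \<in> Linf M \<Longrightarrow> (\<lambda>n. \<integral>x. \<bar>(Q ^^ n) f x - (\<integral>z. f z \<partial>M)\<bar> \<partial>M) \<longlonglongrightarrow> 0"
begin

text \<open>
  Split \<open>\<phi> = f + h\<close> with \<open>f\<close> a truncation. The maximal inequality is applied to \<open>|h|\<close>, which has small excess
  when the truncation level is high, and to \<open>g = |Q\<^sup>k f - \<integral> f|\<close>, which is bounded and, by mean convergence,
  small in \<open>L\<^sup>1\<close> for large \<open>k\<close>, so that it has small excess too. First \<open>\<epsilon>\<close> is chosen, then the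
  level, then \<open>k\<close>.
\<close>

lemma eventually_small_domination:
  assumes \<phi>: "\<phi> \<in> LlogL M" and \<delta>: "\<delta> > 0"
  shows "\<exists>k. \<forall>N. \<exists>Z. integrable M Z \<and>
    (AE x in M. \<forall>n<N. \<bar>(Q ^^ (k + n)) \<phi> x - (\<integral>z. \<phi> z \<partial>M)\<bar> \<le> Z x) \<and> (\<integral>x. Z x \<partial>M) \<le> \<delta>"
proof -
  define d where "d = 2 * m0 - a + 1"
  let ?K = maximal_const
  define \<epsilon> where "\<epsilon> = \<delta> / (4 * (2 * ?K + 1))"
  have Kpos: "2 * ?K + 1 > 0" using maximal_const_pos by simp
  then have \<epsilon>: "\<epsilon> > 0" "(2 * ?K + 1) * \<epsilon> = \<delta> / 4"
    using \<delta> by (auto simp: \<epsilon>_def field_simps)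
  note int = LlogL_integrable[OF \<phi>]
  define t where "t k x = max (- real k) (min (real k) (\<phi> x))" for k x
  have "(\<lambda>k. ?K * entropy_excess M \<epsilon> (\<lambda>x. \<bar>\<phi> x - t k x\<bar>)) \<longlonglongrightarrow> ?K * 0"
    unfolding t_def by (intro tendsto_intros tail_excess \<phi> \<epsilon>)
  then have "eventually (\<lambda>k. ?K * entropy_excess M \<epsilon> (\<lambda>x. \<bar>\<phi> x - t k x\<bar>) < \<delta> / 4) sequentially"
    using \<delta> by (intro order_tendstoD(2)[where y = "?K * 0"]) auto
  moreover have "(\<lambda>k. \<integral>x. \<bar>\<phi> x - t k x\<bar> \<partial>M) \<longlonglongrightarrow> 0"
    unfolding t_def by (intro truncation_tendsto int)
  then have "eventually (\<lambda>k. (\<integral>x. \<bar>\<phi> x - t k x\<bar> \<partial>M) < \<delta> / 4) sequentially"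
    using \<delta> by (intro order_tendstoD(2)[where y = 0]) auto
  ultimately have "eventually (\<lambda>k. ?K * entropy_excess M \<epsilon> (\<lambda>x. \<bar>\<phi> x - t k x\<bar>) < \<delta> / 4 \<and>
      (\<integral>x. \<bar>\<phi> x - t k x\<bar> \<partial>M) < \<delta> / 4) sequentially"
    by (rule eventually_conj)
  then obtain l where l: "?K * entropy_excess M \<epsilon> (\<lambda>x. \<bar>\<phi> x - t l x\<bar>) < \<delta> / 4"
      "(\<integral>x. \<bar>\<phi> x - t l x\<bar> \<partial>M) < \<delta> / 4"
    by (auto simp: eventually_sequentially)
  define f where "f = t l"
  define \<mu> where "\<mu> = (\<integral>x. f x \<partial>M)"
  define h where "h x = \<phi> x - f x" for x
  have f: "f \<in> Linf M" unfolding f_def t_def by (rule Linf_truncation[OF int])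
  have h: "integrable M h" unfolding h_def using int f by auto
  have hent: "integrable M (\<lambda>x. \<bar>h x\<bar> * max 0 (ln (\<bar>h x\<bar> / \<epsilon>)))"
    unfolding h_def f_def t_def using \<phi> \<epsilon>(1) by (rule tail_excess(1))
  have lh: "?K * entropy_excess M \<epsilon> (\<lambda>x. \<bar>h x\<bar>) < \<delta> / 4" "(\<integral>x. \<bar>h x\<bar> \<partial>M) < \<delta> / 4"
    using l by (auto simp: h_def f_def)
  obtain B where B: "AE x in M. \<bar>f x\<bar> \<le> B" "B > 0" using f by (elim LinfE)
  define D where "D = ?K * max 0 (ln ((B + \<bar>\<mu>\<bar>) / \<epsilon>))"
  define g where "g k x = \<bar>(Q ^^ k) f x - \<mu>\<bar>" for k x
  have gL: "g k \<in> Linf M" for k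
    unfolding g_def using f by (intro Linf_abs Linf_diff Q_pow_Linf) auto
  have g0: "AE x in M. 0 \<le> g k x" for k by (auto simp: g_def)
  have gB: "AE x in M. g k x \<le> B + \<bar>\<mu>\<bar>" for k
  proof -
    have "AE x in M. \<bar>(Q ^^ k) f x\<bar> \<le> B" using f B by (intro markov_bounded[OF Q_pow]) auto
    then show ?thesis by eventually_elim (auto simp: g_def)
  qed
  have "(\<lambda>k. D * (\<integral>x. g k x \<partial>M)) \<longlonglongrightarrow> D * 0"
    unfolding g_def \<mu>_def by (intro tendsto_intros mean f)
  then have "eventually (\<lambda>k. D * (\<integral>x. g k x \<partial>M) < \<delta> / 4) sequentially"
    using \<delta> by (intro order_tendstoD(2)[where y = "D * 0"]) auto
  then obtain k where k: "D * (\<integral>x. g k x \<partial>M) < \<delta> / 4" by (auto simp: eventually_sequentially)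
  have kg: "?K * entropy_excess M \<epsilon> (g k) < \<delta> / 4"
  proof -
    have "?K * entropy_excess M \<epsilon> (g k) \<le> ?K * (max 0 (ln ((B + \<bar>\<mu>\<bar>) / \<epsilon>)) * (\<integral>x. g k x \<partial>M))"
      using maximal_const_pos by (intro mult_left_mono entropy_excess_bounded_le gL g0 gB \<epsilon>) auto
    with k show ?thesis by (simp add: D_def mult.assoc)
  qed
  show ?thesis
  proof (intro exI[of _ "d + k"] allI)
    fix N
    from maximal_bounded[OF gL g0 \<epsilon>(1), of N k] obtain Z1 where Z1: "integrable M Z1"
      "AE x in M. \<forall>n<N. (Q ^^ (d + n)) (g k) x \<le> Z1 x"
      "(\<integral>x. Z1 x \<partial>M) \<le> ?K * (entropy_excess M \<epsilon> (g k) + \<epsilon>)"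
      unfolding d_def by blast
    have "AE x in M. 0 \<le> \<bar>h x\<bar>" by simp
    from maximal_LlogL[OF integrable_abs[OF h] this \<epsilon>(1) hent, of "N + k"] obtain Z2 where Z2:
      "integrable M Z2"
      "AE x in M. \<forall>n<N+k. (Q ^^ (d + n)) (\<lambda>x. \<bar>h x\<bar>) x \<le> Z2 x"
      "(\<integral>x. Z2 x \<partial>M) \<le> ?K * (entropy_excess M \<epsilon> (\<lambda>x. \<bar>h x\<bar>) + \<epsilon>) + \<epsilon>"
      unfolding d_def by blast
    let ?c = "\<integral>x. \<bar>h x\<bar> \<partial>M"
    let ?Z = "\<lambda>x. Z1 x + Z2 x + ?c"
    have c: "(\<integral>z. \<phi> z \<partial>M) = \<mu> + (\<integral>z. h z \<partial>M)"
      using int f by (simp add: h_def \<mu>_def)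
    have step: "AE x in M. \<bar>(Q ^^ (d + k + n)) \<phi> x - (\<integral>z. \<phi> z \<partial>M)\<bar> \<le> ?Z x" if n: "n < N" for n
    proof -
      let ?f = "\<lambda>x. (Q ^^ k) f x - \<mu>"
      have Qk: "(Q ^^ k) f \<in> Linf M" using f by (rule Q_pow_Linf)
      then have fL: "?f \<in> Linf M" by auto
      have eq: "(Q ^^ (d + k + n)) f = (Q ^^ (d + n)) ((Q ^^ k) f)"
        using funpow_add[of "d + n" k Q] by (simp add: add.assoc add.commute[of k n] o_def)
      have "AE x in M. (Q ^^ (d + k + n)) (\<lambda>y. f y + h y) x
          = (Q ^^ (d + k + n)) f x + (Q ^^ (d + k + n)) h x"
        using f h by (intro markov_add[OF Q_pow]) auto
      moreover have "AE x in M. (Q ^^ (d + n)) ?f x = (Q ^^ (d + n)) ((Q ^^ k) f) x - \<mu>"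
        using Qk by (intro markov_shift[OF Q_pow]) auto
      moreover have "AE x in M. \<bar>(Q ^^ (d + n)) ?f x\<bar> \<le> (Q ^^ (d + n)) (g k) x"
        unfolding g_def using fL by (intro markov_abs[OF Q_pow]) auto
      moreover have "AE x in M. \<bar>(Q ^^ (d + (k + n))) h x\<bar> \<le> (Q ^^ (d + (k + n))) (\<lambda>y. \<bar>h y\<bar>) x"
        using h by (intro markov_abs[OF Q_pow])
      ultimately show ?thesis using Z1(2) Z2(2)
      proof eventually_elim
        case (elim x)
        have "(\<lambda>y. f y + h y) = \<phi>" by (auto simp: h_def)
        then have "(Q ^^ (d + k + n)) \<phi> x - (\<integral>z. \<phi> z \<partial>M)
            = (Q ^^ (d + n)) ?f x + ((Q ^^ (d + (k + n))) h x - (\<integral>z. h z \<partial>M))"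
          using elim(1,2) c eq by (simp add: add.assoc)
        also have "\<bar>\<dots>\<bar> \<le> \<bar>(Q ^^ (d + n)) ?f x\<bar> + (\<bar>(Q ^^ (d + (k + n))) h x\<bar> + \<bar>\<integral>z. h z \<partial>M\<bar>)"
          by (intro order_trans[OF abs_triangle_ineq] add_left_mono abs_triangle_ineq4)
        also have "\<dots> \<le> Z1 x + (Z2 x + ?c)"
        proof (intro add_mono)
          have "(Q ^^ (d + n)) (g k) x \<le> Z1 x" using elim n by blast
          with elim(3) show "\<bar>(Q ^^ (d + n)) ?f x\<bar> \<le> Z1 x" by (rule order_trans)
          have "(Q ^^ (d + (k + n))) (\<lambda>y. \<bar>h y\<bar>) x \<le> Z2 x" using elim n by auto
          with elim(4) show "\<bar>(Q ^^ (d + (k + n))) h x\<bar> \<le> Z2 x" by (rule order_trans)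
        qed (rule integral_abs_bound)
        finally show ?case by (simp only: add.assoc)
      qed
    qed
    then have "AE x in M. \<forall>n\<in>{..<N}. \<bar>(Q ^^ (d + k + n)) \<phi> x - (\<integral>z. \<phi> z \<partial>M)\<bar> \<le> ?Z x"
      by (intro AE_finite_allI) auto
    moreover have "integrable M ?Z" using Z1 Z2 by auto
    moreover have "(\<integral>x. ?Z x \<partial>M) \<le> \<delta>"
    proof -
      have "(\<integral>x. ?Z x \<partial>M) = (\<integral>x. Z1 x \<partial>M) + (\<integral>x. Z2 x \<partial>M) + ?c"
        using Z1 Z2 by (simp add: prob_space)
      also have "\<dots> \<le> ?K * (entropy_excess M \<epsilon> (g k) + \<epsilon>)
          + (?K * (entropy_excess M \<epsilon> (\<lambda>x. \<bar>h x\<bar>) + \<epsilon>) + \<epsilon>) + ?c"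
        using Z1 Z2 by (intro add_mono) auto
      also have "\<dots> = ?K * entropy_excess M \<epsilon> (g k) + ?K * entropy_excess M \<epsilon> (\<lambda>x. \<bar>h x\<bar>)
          + (2 * ?K + 1) * \<epsilon> + ?c"
        by (simp add: algebra_simps)
      also have "\<dots> \<le> \<delta> / 4 + \<delta> / 4 + \<delta> / 4 + \<delta> / 4"
        using kg lh \<epsilon>(2) by (intro add_mono) auto
      finally show ?thesis by simp
    qed
    ultimately show "\<exists>Z. integrable M Z \<and>
      (AE x in M. \<forall>n<N. \<bar>(Q ^^ (d + k + n)) \<phi> x - (\<integral>z. \<phi> z \<partial>M)\<bar> \<le> Z x) \<and> (\<integral>x. Z x \<partial>M) \<le> \<delta>"
      by (intro exI[of _ ?Z]) auto
  qed
qed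

lemma convergence_LlogL:
  assumes \<phi>: "\<phi> \<in> LlogL M"
  shows "AE x in M. (\<lambda>n. (Q ^^ n) \<phi> x) \<longlonglongrightarrow> (\<integral>z. \<phi> z \<partial>M)"
    and "(\<lambda>n. \<integral>x. \<bar>(Q ^^ n) \<phi> x - (\<integral>z. \<phi> z \<partial>M)\<bar> \<partial>M) \<longlonglongrightarrow> 0"
proof -
  let ?Y = "\<lambda>n x. \<bar>(Q ^^ n) \<phi> x - (\<integral>z. \<phi> z \<partial>M)\<bar>"
  have int: "integrable M (?Y n)" for n
    using markov_integrable[OF Q_pow LlogL_integrable[OF \<phi>]] by auto
  note dom = eventually_small_domination[OF \<phi>]
  show "(\<lambda>n. \<integral>x. ?Y n x \<partial>M) \<longlonglongrightarrow> 0"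
    by (rule AE_and_mean_tendsto_0(2)[OF int _ dom]) auto
  have "AE x in M. (\<lambda>n. ?Y n x) \<longlonglongrightarrow> 0"
    by (rule AE_and_mean_tendsto_0(1)[OF int _ dom]) auto
  then show "AE x in M. (\<lambda>n. (Q ^^ n) \<phi> x) \<longlonglongrightarrow> (\<integral>z. \<phi> z \<partial>M)"
    by eventually_elim (simp add: tendsto_rabs_zero_iff LIM_zero_iff)
qed

end

end

section \<open>Triviality of the tail\<close>

text \<open>
  If \<open>R\<close> nearly preserves the \<open>L\<^sup>2\<close> norm of \<open>w\<close>, then it nearly commutes with the lattice operations on \<open>w\<close>:
  \<open>|R w| \<le> R |w|\<close>, and the \<open>L\<^sup>2\<close> norm of the right-hand side is at most that of \<open>w\<close>.
\<close>

lemma (in prob_space) markov_positive_part: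
  assumes R: "markov_operator M R" and w: "w \<in> Linf M"
  shows "(\<integral>x. \<bar>R (\<lambda>y. max 0 (w y)) x - max 0 (R w x)\<bar> \<partial>M)
           \<le> sqrt ((\<integral>x. (w x)\<^sup>2 \<partial>M) - (\<integral>x. (R w x)\<^sup>2 \<partial>M))"
proof -
  let ?a = "\<lambda>y. \<bar>w y\<bar>"
  have a: "?a \<in> Linf M" "R ?a \<in> Linf M" and Rw: "R w \<in> Linf M"
    using w by (auto intro!: markov_Linf[OF R] Linf_abs)
  let ?D = "\<lambda>x. R ?a x - \<bar>R w x\<bar>"
  have D: "?D \<in> Linf M" using a Rw by (intro Linf_diff Linf_abs)
  have "AE x in M. R (\<lambda>y. 1/2 * ?a y + 1/2 * w y) x = 1/2 * R ?a x + 1/2 * R w x"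
    using a(1) w by (intro markov_lincomb[OF R] Linf_integrable)
  moreover have "(\<lambda>y. 1/2 * ?a y + 1/2 * w y) = (\<lambda>y. max 0 (w y))" by (auto simp: max_def)
  ultimately have "AE x in M. R (\<lambda>y. max 0 (w y)) x = 1/2 * R ?a x + 1/2 * R w x" by simp
  then have "AE x in M. \<bar>R (\<lambda>y. max 0 (w y)) x - max 0 (R w x)\<bar> \<le> \<bar>?D x\<bar>"
    by eventually_elim (auto simp: max_def abs_if)
  then have "(\<integral>x. \<bar>R (\<lambda>y. max 0 (w y)) x - max 0 (R w x)\<bar> \<partial>M) \<le> (\<integral>x. \<bar>?D x\<bar> \<partial>M)"
    by (rule integral_mono_AE[rotated 2])
      (intro Linf_integrable Linf_abs D Linf_diff Linf_max0 markov_Linf[OF R] w Rw)+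
  also have "\<dots> \<le> sqrt (\<integral>x. (?D x)\<^sup>2 \<partial>M)" using D by (rule L1_le_sqrt_L2)
  also have "\<dots> \<le> sqrt ((\<integral>x. (w x)\<^sup>2 \<partial>M) - (\<integral>x. (R w x)\<^sup>2 \<partial>M))"
  proof (rule real_sqrt_le_mono)
    have "(\<integral>x. (?D x)\<^sup>2 \<partial>M) \<le> (\<integral>x. (R ?a x)\<^sup>2 - (R w x)\<^sup>2 \<partial>M)"
    proof (rule integral_mono_AE)
      show "AE x in M. (?D x)\<^sup>2 \<le> (R ?a x)\<^sup>2 - (R w x)\<^sup>2"
        using markov_abs[OF R Linf_integrable[OF w]]
      proof eventually_elim
        case (elim x)
        have "(?D x)\<^sup>2 \<le> ?D x * (R ?a x + \<bar>R w x\<bar>)"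
          unfolding power2_eq_square using elim by (intro mult_left_mono) auto
        then show ?case by (simp add: power2_eq_square algebra_simps)
      qed
    qed (intro Linf_integrable Linf_power Linf_diff D a Rw)+
    also have "\<dots> = (\<integral>x. (R ?a x)\<^sup>2 \<partial>M) - (\<integral>x. (R w x)\<^sup>2 \<partial>M)"
      by (intro Bochner_Integration.integral_diff Linf_integrable Linf_power a Rw)
    also have "(\<integral>x. (R ?a x)\<^sup>2 \<partial>M) \<le> (\<integral>x. (w x)\<^sup>2 \<partial>M)"
      using markov_L2_contraction[OF R a(1)] by simp
    finally show "(\<integral>x. (?D x)\<^sup>2 \<partial>M) \<le> (\<integral>x. (w x)\<^sup>2 \<partial>M) - (\<integral>x. (R w x)\<^sup>2 \<partial>M)" by simp
  qed
  finally show ?thesis .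
qed

text \<open>
  Used for \<open>s = 1\<close> and \<open>s = -1\<close>, that is, for the parts of \<open>u\<close> above and below a level. An affine change of
  \<open>u\<close> with slope of modulus \<open>1\<close> does not alter the loss of energy.
\<close>

lemma (in prob_space) markov_positive_part_affine:
  assumes R: "markov_operator M R" and u: "u \<in> Linf M" and s: "s\<^sup>2 = 1"
  shows "(\<integral>x. \<bar>R (\<lambda>y. max 0 (s * u y + c)) x - max 0 (s * R u x + c)\<bar> \<partial>M)
           \<le> sqrt ((\<integral>x. (u x)\<^sup>2 \<partial>M) - (\<integral>x. (R u x)\<^sup>2 \<partial>M))"
proof -
  let ?w = "\<lambda>y. s * u y + c"
  have Ru: "R u \<in> Linf M" and w: "?w \<in> Linf M" and Rw: "R ?w \<in> Linf M"
    using u by (auto intro!: markov_Linf[OF R] Linf_add Linf_cmult)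
  have eq: "AE x in M. R ?w x = s * R u x + c"
    using u by (intro markov_affine[OF R] Linf_integrable)
  have sq: "(\<integral>x. (s * f x + c)\<^sup>2 \<partial>M) = (\<integral>x. (f x)\<^sup>2 \<partial>M) + 2 * s * c * (\<integral>x. f x \<partial>M) + c\<^sup>2"
    if f: "f \<in> Linf M" for f
  proof -
    have "(\<integral>x. (s * f x + c)\<^sup>2 \<partial>M) = (\<integral>x. (f x)\<^sup>2 + 2 * s * c * f x + c\<^sup>2 \<partial>M)"
      using s by (simp add: power2_sum power_mult_distrib algebra_simps)
    then show ?thesis
      using Linf_integrable[OF f] Linf_integrable[OF Linf_power[OF f, of 2]] by (simp add: prob_space)
  qed
  have "(\<integral>x. \<bar>R ?w x\<bar>\<^sup>2 \<partial>M) = (\<integral>x. (s * R u x + c)\<^sup>2 \<partial>M)"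
  proof (rule integral_cong_AE)
    show "AE x in M. \<bar>R ?w x\<bar>\<^sup>2 = (s * R u x + c)\<^sup>2" using eq by eventually_elim simp
  qed (use Linf_measurable[OF Rw] Linf_measurable[OF Ru] in auto)
  then have 1: "(\<integral>x. (?w x)\<^sup>2 \<partial>M) - (\<integral>x. (R ?w x)\<^sup>2 \<partial>M) = (\<integral>x. (u x)\<^sup>2 \<partial>M) - (\<integral>x. (R u x)\<^sup>2 \<partial>M)"
    using sq[OF u] sq[OF Ru] markov_integral[OF R Linf_integrable[OF u]] by simp
  have Rp: "R (\<lambda>y. max 0 (?w y)) \<in> Linf M" using w by (intro markov_Linf[OF R] Linf_max0)
  have "(\<integral>x. \<bar>R (\<lambda>y. max 0 (?w y)) x - max 0 (s * R u x + c)\<bar> \<partial>M)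
      = (\<integral>x. \<bar>R (\<lambda>y. max 0 (?w y)) x - max 0 (R ?w x)\<bar> \<partial>M)"
  proof (rule integral_cong_AE)
    show "AE x in M. \<bar>R (\<lambda>y. max 0 (?w y)) x - max 0 (s * R u x + c)\<bar>
        = \<bar>R (\<lambda>y. max 0 (?w y)) x - max 0 (R ?w x)\<bar>"
      using eq by eventually_elim simp
  qed (use Linf_measurable[OF Rp] Linf_measurable[OF Rw] Linf_measurable[OF Ru] in auto)
  then show ?thesis using markov_positive_part[OF R w] 1 by simp
qed

context dominated_markov
begin

text \<open>
  \<open>W Q = W V W = S W\<close>.
\<close>

lemma W_intertwines:
  assumes f: "f \<in> Linf M" shows "AE x in M. W ((Q ^^ n) f) x = (S ^^ n) (W f) x"
proof (induction n)
  case (Suc n)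
  let ?g = "(Q ^^ n) f"
  have g: "?g \<in> Linf M" using f by (rule Q_pow_Linf)
  have Wg: "W ?g \<in> Linf M" using g by (rule markov_Linf[OF W])
  have "AE x in M. W (Q ?g) x = W (V (W ?g)) x"
    using g by (intro markov_cong[OF W] Q_VW Linf_integrable markov_Linf[OF V] markov_Linf[OF W] dual_Linf(1)[OF dual])
  moreover have "AE x in M. S (W ?g) x = W (V (W ?g)) x" using Wg by (intro S_WV Linf_integrable)
  moreover have "AE x in M. S (W ?g) x = S ((S ^^ n) (W f)) x"
    using Suc.IH Wg f g by (intro markov_cong[OF S] Linf_integrable S_pow_Linf markov_Linf[OF W])
  ultimately show ?case by auto
qed simp

context
  assumes mixing: "\<And>f g. f \<in> Linf M \<Longrightarrow> g \<in> Linf M \<Longrightarrow>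
    (\<lambda>n. \<integral>x. (Q ^^ n) f x * g x \<partial>M) \<longlonglongrightarrow> (\<integral>x. f x \<partial>M) * (\<integral>x. g x \<partial>M)"
begin

text \<open>
  The domination hypothesis is paired with \<open>g\<close>. On the left, \<open>W Q\<^sup>N = S\<^sup>N W\<close> turns the pairing into
  \<open>\<integral> (Q\<^sup>N g) (W \<phi>)\<close>, which tends to \<open>\<integral> g \<integral> \<phi>\<close> by mixing; on the right the error operators disappear because
  \<open>\<alpha>\<^sub>n\<close> tends to \<open>0\<close>.
\<close>

lemma product_of_means_le:
  assumes \<phi>: "\<phi> \<in> Linf M" "AE x in M. 0 \<le> \<phi> x" and g: "g \<in> Linf M" "AE x in M. 0 \<le> g x"
    and le: "\<And>n j. n \<ge> b \<Longrightarrow> \<bar>j\<bar> \<le> int b \<Longrightarrow>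
      (\<integral>x. (Q ^^ nat (int n + j)) \<phi> x * (Q ^^ n) g x \<partial>M) \<le> \<kappa>"
  shows "(\<integral>x. \<phi> x \<partial>M) * (\<integral>x. g x \<partial>M) \<le> C * (2 * b + 1) * \<kappa>"
proof -
  obtain B where B: "AE x in M. \<bar>g x\<bar> \<le> B" "B > 0" using g by (elim LinfE)
  let ?I = "{- int b..int b}"
  let ?c = "\<integral>x. \<bar>\<phi> x\<bar> \<partial>M"
  have Wphi: "W \<phi> \<in> Linf M" using \<phi> by (intro markov_Linf[OF W])
  have lhs: "(\<integral>x. W ((Q ^^ (2 * n - a)) \<phi>) x * g x \<partial>M) = (\<integral>x. (Q ^^ (2 * n - a)) g x * W \<phi> x \<partial>M)" for n
  proof -
    let ?N = "2 * n - a"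
    have L: "W ((Q ^^ ?N) \<phi>) \<in> Linf M" "(S ^^ ?N) (W \<phi>) \<in> Linf M"
      using \<phi> Wphi by (auto intro!: markov_Linf[OF W] Q_pow_Linf S_pow_Linf)
    have "(\<integral>x. W ((Q ^^ ?N) \<phi>) x * g x \<partial>M) = (\<integral>x. g x * (S ^^ ?N) (W \<phi>) x \<partial>M)"
    proof (rule integral_cong_AE)
      show "AE x in M. W ((Q ^^ ?N) \<phi>) x * g x = g x * (S ^^ ?N) (W \<phi>) x"
        using W_intertwines[OF \<phi>(1), of ?N] by eventually_elim simp
    qed (use Linf_measurable[OF L(1)] Linf_measurable[OF L(2)] Linf_measurable[OF g(1)] in auto)
    also have "\<dots> = (\<integral>x. (Q ^^ ?N) g x * W \<phi> x \<partial>M)"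
      using g Wphi by (intro dual_adjoint_pow[OF dual, symmetric])
    finally show ?thesis .
  qed
  have "filterlim (\<lambda>n. 2 * n - a) sequentially sequentially"
    by (rule filterlim_at_top_mono[OF filterlim_minus_const_nat_at_top[of a]])
      (auto intro: always_eventually)
  then have lim: "(\<lambda>n. \<integral>x. (Q ^^ (2 * n - a)) g x * W \<phi> x \<partial>M) \<longlonglongrightarrow> (\<integral>x. g x \<partial>M) * (\<integral>x. W \<phi> x \<partial>M)"
    using mixing[OF g(1) Wphi] by (rule filterlim_compose[rotated])
  have "(\<lambda>n. \<alpha> (n + m0)) \<longlonglongrightarrow> 0" using \<alpha>_summable by (rule summable_LIMSEQ_zero)
  then have \<alpha>0: "\<alpha> \<longlonglongrightarrow> 0" by (rule LIMSEQ_offset)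
  have ub: "(\<integral>x. (Q ^^ (2 * n - a)) g x * W \<phi> x \<partial>M) \<le> C * (2 * b + 1) * \<kappa> + B * (\<alpha> n * ?c)"
    if n: "n \<ge> m0 + b" for n
  proof -
    have all: "{j \<in> ?I. 0 \<le> int n + j} = ?I" using n by auto
    let ?X = "\<lambda>j. (S ^^ n) ((Q ^^ nat (int n + j)) \<phi>)"
    have X: "?X j \<in> Linf M" for j using \<phi> by (intro S_pow_Linf Q_pow_Linf)
    have A: "integrable M (A n \<phi>)" using n \<phi> by (intro A_integrable) auto
    have Ag: "integrable M (\<lambda>x. A n \<phi> x * g x)"
    proof (rule Bochner_Integration.integrable_bound)
      show "integrable M (\<lambda>x. B * \<bar>A n \<phi> x\<bar>)" using A by auto
      show "(\<lambda>x. A n \<phi> x * g x) \<in> borel_measurable M" using A Linf_measurable[OF g(1)] by auto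
      show "AE x in M. norm (A n \<phi> x * g x) \<le> norm (B * \<bar>A n \<phi> x\<bar>)"
        using B(1) by eventually_elim (use B(2) in \<open>simp add: abs_mult mult.commute[of B] mult_left_mono\<close>)
    qed
    have "AE x in M. W ((Q ^^ (2 * n - a)) \<phi>) x \<le> C * (\<Sum>j\<in>?I. ?X j x) + A n \<phi> x"
      using domination[of n \<phi>] n \<phi> unfolding all by auto
    then have "AE x in M. W ((Q ^^ (2 * n - a)) \<phi>) x * g x \<le> C * (\<Sum>j\<in>?I. ?X j x * g x) + A n \<phi> x * g x"
      using g(2)
    proof eventually_elim
      case (elim x)
      have "W ((Q ^^ (2 * n - a)) \<phi>) x * g x \<le> (C * (\<Sum>j\<in>?I. ?X j x) + A n \<phi> x) * g x"
        using elim by (intro mult_right_mono)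
      also have "\<dots> = C * (\<Sum>j\<in>?I. ?X j x * g x) + A n \<phi> x * g x"
        by (simp only: distrib_right sum_distrib_right mult.assoc)
      finally show ?case .
    qed
    then have "(\<integral>x. W ((Q ^^ (2 * n - a)) \<phi>) x * g x \<partial>M)
        \<le> (\<integral>x. C * (\<Sum>j\<in>?I. ?X j x * g x) + A n \<phi> x * g x \<partial>M)"
    proof (rule integral_mono_AE[rotated 2])
      show "integrable M (\<lambda>x. W ((Q ^^ (2 * n - a)) \<phi>) x * g x)"
        using \<phi> g by (intro Linf_integrable Linf_mult markov_Linf[OF W] Q_pow_Linf)
      show "integrable M (\<lambda>x. C * (\<Sum>j\<in>?I. ?X j x * g x) + A n \<phi> x * g x)"
        using X g by (intro Bochner_Integration.integrable_add[OF _ Ag] Linf_integrable Linf_cmult Linf_sum Linf_mult)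
    qed
    also have "\<dots> = C * (\<Sum>j\<in>?I. \<integral>x. ?X j x * g x \<partial>M) + (\<integral>x. A n \<phi> x * g x \<partial>M)"
    proof -
      have Xg: "integrable M (\<lambda>x. ?X j x * g x)" for j using X g by (intro Linf_integrable Linf_mult)
      have "integrable M (\<lambda>x. C * (\<Sum>j\<in>?I. ?X j x * g x))" using Xg by auto
      then show ?thesis using Ag Xg
        by (simp only: Bochner_Integration.integral_add integral_mult_right_zero)
          (subst Bochner_Integration.integral_sum, auto)
    qed
    also have "(\<Sum>j\<in>?I. \<integral>x. ?X j x * g x \<partial>M) \<le> (\<Sum>j\<in>?I. \<kappa>)"
    proof (rule sum_mono)
      fix j assume j: "j \<in> ?I"
      have "(\<integral>x. ?X j x * g x \<partial>M) = (\<integral>x. g x * ?X j x \<partial>M)" by (simp only: mult.commute)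
      also have "\<dots> = (\<integral>x. (Q ^^ n) g x * (Q ^^ nat (int n + j)) \<phi> x \<partial>M)"
        by (rule dual_adjoint_pow[OF dual g(1) Q_pow_Linf[OF \<phi>(1)], symmetric])
      also have "\<dots> \<le> \<kappa>" using le[of n j] n j by (simp add: mult.commute abs_le_iff)
      finally show "(\<integral>x. ?X j x * g x \<partial>M) \<le> \<kappa>" .
    qed
    also have "(\<integral>x. A n \<phi> x * g x \<partial>M) \<le> B * (\<alpha> n * ?c)"
    proof -
      have "(\<integral>x. A n \<phi> x * g x \<partial>M) \<le> (\<integral>x. B * \<bar>A n \<phi> x\<bar> \<partial>M)"
      proof (rule integral_mono_AE)
        show "AE x in M. A n \<phi> x * g x \<le> B * \<bar>A n \<phi> x\<bar>"
          using B(1)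
        proof eventually_elim
          case (elim x)
          have "A n \<phi> x * g x \<le> \<bar>A n \<phi> x\<bar> * \<bar>g x\<bar>" by (simp add: abs_mult[symmetric])
          also have "\<dots> \<le> \<bar>A n \<phi> x\<bar> * B" using elim by (intro mult_left_mono) auto
          finally show ?case by (simp add: mult.commute)
        qed
      qed (use Ag A in auto)
      also have "\<dots> = B * (\<integral>x. \<bar>A n \<phi> x\<bar> \<partial>M)" by simp
      also have "\<dots> \<le> B * (\<alpha> n * ?c)"
        using A_norm[of n \<phi>] n \<phi> B by (intro mult_left_mono) auto
      finally show ?thesis .
    qed
    finally show ?thesis using C by (simp add: lhs mult.assoc add.commute[of 1])
  qed
  have "(\<lambda>n. C * (2 * b + 1) * \<kappa> + B * (\<alpha> n * ?c)) \<longlonglongrightarrow> C * (2 * b + 1) * \<kappa> + B * (0 * ?c)"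
    by (intro tendsto_intros \<alpha>0)
  then have "(\<integral>x. g x \<partial>M) * (\<integral>x. W \<phi> x \<partial>M) \<le> C * (2 * b + 1) * \<kappa> + B * (0 * ?c)"
    by (rule LIMSEQ_le[OF lim]) (use ub in blast)
  then show ?thesis using \<phi> markov_integral[OF W, of \<phi>] by (simp add: mult.commute)
qed

text \<open>
  Let \<open>\<mu>\<close> be the mean of \<open>f\<close> and \<open>c = 2 (2b + 1) \<mu>\<close>. Since the energy exceeds \<open>c \<mu>\<close>, the functions
  \<open>u\<^sub>k = Q\<^sup>k f\<close> exceed the level \<open>c\<close> on a set that does not vanish as \<open>k\<close> grows; let \<open>g\<close> be the excess \<open>(u\<^sub>k - c)\<^sup>+\<close>. The function
  \<open>\<phi> = (c - \<Sum> u\<^bsub>k-j\<^esub>)\<^sup>+\<close>, summed over \<open>|j| \<le> b\<close>, has mean at least \<open>c / 2\<close> and is at most \<open>(c - u\<^bsub>k-j\<^esub>)\<^sup>+\<close> for each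
  \<open>j\<close>. As \<open>Q\<^bsup>n+j\<^esup>\<close> and \<open>Q\<^sup>n\<close> nearly commute with positive parts, \<open>Q\<^bsup>n+j\<^esup> \<phi>\<close> is nearly bounded by \<open>(c - u\<^bsub>n+k\<^esub>)\<^sup>+\<close> and
  \<open>Q\<^sup>n g\<close> is nearly \<open>(u\<^bsub>n+k\<^esub> - c)\<^sup>+\<close>. These have disjoint supports, which contradicts the lower bound for
  the products.
\<close>

lemma not_spread:
  "\<not> spread Q f (2 * (2 * b + 1) + 1)"
proof
  assume "spread Q f (2 * (2 * b + 1) + 1)"
  define \<mu> where "\<mu> = (\<integral>x. f x \<partial>M)"
  define D :: real where "D = 2 * (2 * b + 1)"
  have fL: "f \<in> Linf M" and f0: "AE x in M. 0 \<le> f x" and \<mu>: "\<mu> > 0"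
    and fq: "\<And>n. (D + 1) * \<mu>\<^sup>2 \<le> energy Q f n"
    using \<open>spread Q f _\<close> by (auto simp: spread_def \<mu>_def D_def)
  obtain B where B: "AE x in M. \<bar>f x\<bar> \<le> B" "B > 0" using fL by (elim LinfE)
  define c where "c = D * \<mu>"
  have c: "c > 0" using \<mu> by (simp add: c_def D_def)
  define G where "G = C * (2 * b + 1) * (B + c)"
  have G: "G > 0" unfolding G_def using C B c by (intro mult_pos_pos) auto
  \<comment> \<open>chosen so that the upper bound \<open>G \<sigma>\<close> is half of the lower bound for \<open>\<integral> \<phi> \<integral> g\<close>\<close>
  define \<sigma> where "\<sigma> = (c / 2) * (\<mu>\<^sup>2 / B) / (2 * G)"
  have \<sigma>: "\<sigma> > 0" using c \<mu> B G by (simp add: \<sigma>_def)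
  obtain k0 where k0: "\<And>k N. k \<ge> k0 \<Longrightarrow> energy Q f k - energy Q f (k + N) \<le> \<sigma>\<^sup>2"
    using energy_Cauchy[OF dual fL, of "\<sigma>\<^sup>2"] \<sigma> by auto
  define u where "u n = (Q ^^ n) f" for n
  have u: "u n \<in> Linf M" for n unfolding u_def using fL by (rule Q_pow_Linf)
  have u0: "AE x in M. 0 \<le> u n x" for n
    unfolding u_def using fL f0 by (intro markov_nonneg[OF Q_pow]) auto
  have uB: "AE x in M. \<bar>u n x\<bar> \<le> B" for n
    unfolding u_def using fL B by (intro markov_bounded[OF Q_pow]) auto
  have u_int: "(\<integral>x. u n x \<partial>M) = \<mu>" for n
    unfolding u_def \<mu>_def using fL by (intro markov_integral[OF Q_pow]) auto
  have Qu: "(Q ^^ N) (u n) = u (N + n)" for N n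
    unfolding u_def by (simp add: funpow_add)
  have defect: "sqrt ((\<integral>x. (u n x)\<^sup>2 \<partial>M) - (\<integral>x. ((Q ^^ N) (u n) x)\<^sup>2 \<partial>M)) \<le> \<sigma>" if "n \<ge> k0" for n N
  proof -
    have "(\<integral>x. (u n x)\<^sup>2 \<partial>M) - (\<integral>x. ((Q ^^ N) (u n) x)\<^sup>2 \<partial>M) \<le> \<sigma>\<^sup>2"
      using k0[OF that, of N] unfolding Qu by (simp add: energy_def u_def add.commute)
    then show ?thesis using \<sigma> by (intro real_le_lsqrt) auto
  qed
  define k where "k = k0 + b"
  let ?I = "{- int b..int b}"
  define \<phi> where "\<phi> x = max 0 (c - (\<Sum>j\<in>?I. u (nat (int k - j)) x))" for x
  define g where "g x = max 0 (u k x - c)" for x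
  define m where "m l x = max 0 (c - u l x)" for l x
  have L: "\<phi> \<in> Linf M" "g \<in> Linf M" "m l \<in> Linf M" for l
    unfolding \<phi>_def g_def m_def using u by (auto intro!: Linf_max0 Linf_diff Linf_sum)
  have mean_\<phi>: "c / 2 \<le> (\<integral>x. \<phi> x \<partial>M)"
  proof -
    have s: "(\<lambda>x. \<Sum>j\<in>?I. u (nat (int k - j)) x) \<in> Linf M" using u by (intro Linf_sum)
    have "(\<integral>x. c - (\<Sum>j\<in>?I. u (nat (int k - j)) x) \<partial>M) = c - (\<Sum>j\<in>?I. \<mu>)"
      using Linf_integrable[OF s] Linf_integrable[OF u]
      by (simp add: prob_space u_int Bochner_Integration.integral_sum)
    also have "\<dots> = c / 2" by (simp add: c_def D_def)
    finally have "c / 2 = (\<integral>x. c - (\<Sum>j\<in>?I. u (nat (int k - j)) x) \<partial>M)" by simp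
    also have "\<dots> \<le> (\<integral>x. \<phi> x \<partial>M)"
      unfolding \<phi>_def using s by (intro integral_mono Linf_integrable Linf_max0 Linf_diff Linf_const) auto
    finally show ?thesis .
  qed
  have mean_g: "\<mu>\<^sup>2 / B \<le> (\<integral>x. g x \<partial>M)"
  proof -
    have "(D + 1) * \<mu>\<^sup>2 - c * \<mu> \<le> (\<integral>x. (u k x)\<^sup>2 \<partial>M) - c * (\<integral>x. u k x \<partial>M)"
      using fq[of k] by (simp add: u_int) (simp add: energy_def u_def)
    also have "\<dots> = (\<integral>x. (u k x)\<^sup>2 - c * u k x \<partial>M)"
      using Linf_integrable[OF u[of k]] Linf_integrable[OF Linf_power[OF u[of k], of 2]] by simp
    also have "\<dots> \<le> (\<integral>x. B * g x \<partial>M)"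
    proof (rule integral_mono_AE)
      show "AE x in M. (u k x)\<^sup>2 - c * u k x \<le> B * g x"
        using u0[of k] uB[of k]
      proof eventually_elim
        case (elim x)
        have "u k x * (u k x - c) \<le> u k x * g x" using elim by (intro mult_left_mono) (auto simp: g_def)
        also have "\<dots> \<le> B * g x" using elim by (intro mult_right_mono) (auto simp: g_def)
        finally show ?case by (simp add: power2_eq_square algebra_simps)
      qed
    qed (intro Linf_integrable Linf_diff Linf_power Linf_cmult u L)+
    also have "\<dots> = B * (\<integral>x. g x \<partial>M)" by simp
    finally have "\<mu>\<^sup>2 \<le> B * (\<integral>x. g x \<partial>M)" by (simp add: c_def power2_eq_square algebra_simps)
    then show ?thesis using B by (simp add: field_simps)
  qed
  have "(\<integral>x. \<phi> x \<partial>M) * (\<integral>x. g x \<partial>M) \<le> C * (2 * b + 1) * ((B + c) * \<sigma>)"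
  proof (rule product_of_means_le[OF L(1) _ L(2)])
    show "AE x in M. 0 \<le> \<phi> x" "AE x in M. 0 \<le> g x" by (auto simp: \<phi>_def g_def)
    fix n j assume n: "n \<ge> b" and j: "\<bar>j\<bar> \<le> int b"
    define l where "l = nat (int n + j)"
    define i where "i = nat (int k - j)"
    have i: "i \<ge> k0" using j by (auto simp: i_def k_def)
    have li: "l + i = n + k" using j n by (auto simp: l_def i_def k_def)
    have \<phi>_le: "AE x in M. \<phi> x \<le> m i x"
    proof -
      have "AE x in M. \<forall>j\<in>?I. 0 \<le> u (nat (int k - j)) x" using u0 by (intro AE_finite_allI) auto
      then show ?thesis
      proof eventually_elim
        case (elim x)
        have "u (nat (int k - j)) x \<le> (\<Sum>j\<in>?I. u (nat (int k - j)) x)"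
          using elim j by (intro member_le_sum) auto
        then show ?case by (auto simp: \<phi>_def m_def i_def)
      qed
    qed
    let ?a = "(Q ^^ l) (m i)" and ?b = "(Q ^^ n) g" and ?a' = "m (n + k)" and ?b' = "\<lambda>x. max 0 (u (n + k) x - c)"
    have ab: "?a \<in> Linf M" "?b \<in> Linf M" "?a' \<in> Linf M" "?b' \<in> Linf M" "(Q ^^ l) \<phi> \<in> Linf M"
      using L u by (auto intro!: Q_pow_Linf Linf_max0 Linf_diff)
    have a1: "AE x in M. (Q ^^ l) \<phi> x \<le> ?a x"
      using L \<phi>_le by (intro markov_mono[OF Q_pow] Linf_integrable)
    have b0: "AE x in M. 0 \<le> ?b x"
      using L by (intro markov_nonneg[OF Q_pow] Linf_integrable) (auto simp: g_def)
    have bB: "AE x in M. \<bar>?b x\<bar> \<le> B"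
    proof (rule markov_bounded[OF Q_pow Linf_measurable[OF L(2)]])
      show "AE x in M. \<bar>g x\<bar> \<le> B" using uB[of k] by eventually_elim (use c B in \<open>auto simp: g_def\<close>)
    qed
    have a'c: "AE x in M. \<bar>?a' x\<bar> \<le> c"
      using u0[of "n + k"] by eventually_elim (use c in \<open>auto simp: m_def\<close>)
    have da: "(\<integral>x. \<bar>?a x - ?a' x\<bar> \<partial>M) \<le> \<sigma>"
      using order_trans[OF markov_positive_part_affine[OF Q_pow u, of "-1" l i c] defect[OF i, of l]]
      by (simp add: m_def[abs_def] Qu li)
    have "k \<ge> k0" by (simp add: k_def)
    have db: "(\<integral>x. \<bar>?b x - ?b' x\<bar> \<partial>M) \<le> \<sigma>"
      using order_trans[OF markov_positive_part_affine[OF Q_pow u, of 1 n k "-c"] defect[OF \<open>k \<ge> k0\<close>, of n]]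
      by (simp add: g_def[abs_def] Qu)
    have "(\<integral>x. (Q ^^ l) \<phi> x * ?b x \<partial>M) \<le> (\<integral>x. (?a x - ?a' x) * ?b x + (?b x - ?b' x) * ?a' x \<partial>M)"
    proof (rule integral_mono_AE)
      show "AE x in M. (Q ^^ l) \<phi> x * ?b x \<le> (?a x - ?a' x) * ?b x + (?b x - ?b' x) * ?a' x"
        using a1 b0
      proof eventually_elim
        case (elim x)
        have "(Q ^^ l) \<phi> x * ?b x \<le> ?a x * ?b x" using elim by (intro mult_right_mono)
        moreover have "?a' x * ?b' x = 0" by (auto simp: m_def max_def)
        moreover have "(?a x - ?a' x) * ?b x + (?b x - ?b' x) * ?a' x = ?a x * ?b x - ?a' x * ?b' x"
          by algebra
        ultimately show ?case by linarith
      qed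
    qed (intro Linf_integrable Linf_mult Linf_add Linf_diff ab)+
    also have "\<dots> = (\<integral>x. (?a x - ?a' x) * ?b x \<partial>M) + (\<integral>x. (?b x - ?b' x) * ?a' x \<partial>M)"
      by (intro Bochner_Integration.integral_add Linf_integrable Linf_mult Linf_diff ab)
    also have "\<dots> \<le> B * (\<integral>x. \<bar>?a x - ?a' x\<bar> \<partial>M) + c * (\<integral>x. \<bar>?b x - ?b' x\<bar> \<partial>M)"
      using abs_integral_mult_le[OF Linf_diff[OF ab(1,3)] ab(2) bB]
        abs_integral_mult_le[OF Linf_diff[OF ab(2,4)] ab(3) a'c] by linarith
    also have "\<dots> \<le> B * \<sigma> + c * \<sigma>"
      using da db B c by (intro add_mono mult_left_mono) auto
    finally show "(\<integral>x. (Q ^^ nat (int n + j)) \<phi> x * (Q ^^ n) g x \<partial>M) \<le> (B + c) * \<sigma>"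
      by (simp add: l_def distrib_right)
  qed
  also have "\<dots> = G * \<sigma>" by (simp only: G_def mult.assoc)
  also have "\<dots> = (c / 2) * (\<mu>\<^sup>2 / B) / 2" using G by (simp add: \<sigma>_def)
  also have "\<dots> < (c / 2) * (\<mu>\<^sup>2 / B)"
  proof -
    have "0 < (c / 2) * (\<mu>\<^sup>2 / B)" using c \<mu> B(2) by simp
    moreover have "x / 2 < x" if "0 < x" for x :: real using that by simp
    ultimately show ?thesis by blast
  qed
  also have "\<dots> \<le> (\<integral>x. \<phi> x \<partial>M) * (\<integral>x. g x \<partial>M)"
    using mean_\<phi> mean_g c B by (intro mult_mono) auto
  finally show False by simp
qed

end

text \<open>
  Adding a constant makes \<open>f\<close> nonnegative.
\<close>

lemma mean_convergence:
  assumes fixed: "only_constant_L2_fixed_points M ((S ^^ m) \<circ> (Q ^^ m))" and f: "f \<in> Linf M"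
  shows "(\<lambda>n. \<integral>x. \<bar>(Q ^^ n) f x - (\<integral>z. f z \<partial>M)\<bar> \<partial>M) \<longlonglongrightarrow> 0"
proof -
  obtain B where B: "AE x in M. \<bar>f x\<bar> \<le> B" "B > 0" using f by (elim LinfE)
  let ?h = "\<lambda>x. 1 * f x + B"
  have h: "?h \<in> Linf M" "AE x in M. 0 \<le> ?h x"
  proof -
    show "?h \<in> Linf M" using f by (intro Linf_add Linf_cmult Linf_const)
    show "AE x in M. 0 \<le> ?h x" using B(1) by eventually_elim auto
  qed
  have "\<not> spread Q h q" if "q > 1" for h q
    using spread_unbounded[OF dual fixed _ that] not_spread[OF powers_mixing[OF dual fixed]] by blast
  from mean_convergence_nonneg[OF dual h this]
  have "(\<lambda>n. \<integral>x. \<bar>(Q ^^ n) ?h x - (\<integral>z. ?h z \<partial>M)\<bar> \<partial>M) \<longlonglongrightarrow> 0" .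
  moreover have "(\<integral>x. \<bar>(Q ^^ n) ?h x - (\<integral>z. ?h z \<partial>M)\<bar> \<partial>M) = (\<integral>x. \<bar>(Q ^^ n) f x - (\<integral>z. f z \<partial>M)\<bar> \<partial>M)" for n
  proof (rule integral_cong_AE)
    have mean: "(\<integral>z. ?h z \<partial>M) = (\<integral>z. f z \<partial>M) + B" using Linf_integrable[OF f] by (simp add: prob_space)
    show "AE x in M. \<bar>(Q ^^ n) ?h x - (\<integral>z. ?h z \<partial>M)\<bar> = \<bar>(Q ^^ n) f x - (\<integral>z. f z \<partial>M)\<bar>"
      unfolding mean using markov_affine[OF Q_pow Linf_integrable[OF f], of n 1 B]
      by eventually_elim simp
    show "(\<lambda>x. \<bar>(Q ^^ n) ?h x - (\<integral>z. ?h z \<partial>M)\<bar>) \<in> borel_measurable M"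
      by (intro Linf_measurable Linf_abs Linf_diff Linf_const Q_pow_Linf h)
    show "(\<lambda>x. \<bar>(Q ^^ n) f x - (\<integral>z. f z \<partial>M)\<bar>) \<in> borel_measurable M"
      by (intro Linf_measurable Linf_abs Linf_diff Linf_const Q_pow_Linf f)
  qed
  ultimately show ?thesis by simp
qed

end

section \<open>The convergence theorem\<close>

theorem theorem8p6:
  fixes M :: "'a measure"
    and Q Qadj V W :: "('a \<Rightarrow> real) \<Rightarrow> ('a \<Rightarrow> real)"
    and A :: "nat \<Rightarrow> ('a \<Rightarrow> real) \<Rightarrow> ('a \<Rightarrow> real)"
    and \<alpha> :: "nat \<Rightarrow> real"
    and C K :: real
    and a b m0 :: nat
  assumes "lebesgue_prob_space M"
    and "mp_markov_op M Q"
    and "is_L2_adjoint M Q Qadj"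
    and "mp_markov_op M V" and "mp_markov_op M W"
    and "L1_op_eq M Q (V \<circ> W)" and "L1_op_eq M Qadj (W \<circ> V)"
    and "\<forall>n\<ge>1. only_constant_L2_fixed_points M (Q ^^ n)"
    and "\<exists>m. only_constant_L2_fixed_points M ((Qadj ^^ m) \<circ> (Q ^^ m))"
    and "m0 = nat \<lceil>real a / 2\<rceil>"
    and "C > 0" and "K > 0"
    and "\<forall>n\<ge>m0. L1_linear M (A n) \<and> positive_op M (A n) \<and>
           (\<forall>p\<ge>1. Lp_bounded_by M p (\<alpha> n) (A n))"
    and "summable (\<lambda>n. \<alpha> (n + m0))" and "(\<Sum>n. \<alpha> (n + m0)) \<le> K"
    and "\<forall>n\<ge>m0. \<forall>\<phi> \<in> Lp M 1. (AE x in M. 0 \<le> \<phi> x) \<longrightarrow>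
           (AE x in M. W ((Q ^^ (2 * n - a)) \<phi>) x
              \<le> C * (\<Sum>j \<in> {j \<in> {- int b..int b}. 0 \<le> int n + j}.
                        (Qadj ^^ n) ((Q ^^ nat (int n + j)) \<phi>) x)
                + A n \<phi> x)"
    and "\<phi> \<in> LlogL M"
  shows "(AE x in M. (\<lambda>n. (Q ^^ n) \<phi> x) \<longlonglongrightarrow> (\<integral>z. \<phi> z \<partial>M)) \<and>
         (\<lambda>n. Lp_norm M 1 (\<lambda>x. (Q ^^ n) \<phi> x - (\<integral>z. \<phi> z \<partial>M))) \<longlonglongrightarrow> 0"
proof -
  interpret prob_space M using assms(1) by (simp add: lebesgue_prob_space_def)
  have V: "markov_operator M V" and W: "markov_operator M W" and Q: "markov_operator M Q"
    using assms(2,4,5) by (auto intro: mp_markov_op_imp_markov_operator)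
  have Qadj: "markov_operator M Qadj"
    using markov_operator_cong[OF markov_operator_comp[OF W V] _ assms(7)] assms(3)
    by (simp add: is_L2_adjoint_def)
  have dual: "dual_pair M Q Qadj"
    unfolding dual_pair_def using Q Qadj assms(3) Linf_Lp2 by (auto simp: is_L2_adjoint_def)
  have A: "L1_linear M (A n)" "positive_op M (A n)" "Lp_bounded_by M 1 (\<alpha> n) (A n)" if "n \<ge> m0" for n
    using assms(13) that by auto
  interpret dominated_markov M Q Qadj V W A \<alpha> C K a b m0
  proof unfold_locales
    show "a \<le> 2 * m0" unfolding assms(10) by linarith
    show "\<And>f. integrable M f \<Longrightarrow> AE x in M. Q f x = V (W f) x"
      using assms(6) by (simp add: L1_op_eq_def Lp_1_iff)
    show "\<And>f. integrable M f \<Longrightarrow> AE x in M. Qadj f x = W (V f) x"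
      using assms(7) by (simp add: L1_op_eq_def Lp_1_iff)
    show "\<And>n f. n \<ge> m0 \<Longrightarrow> integrable M f \<Longrightarrow> integrable M (A n f)"
      using A(1) by (simp add: L1_linear_def Lp_1_iff)
    show "\<And>n f. n \<ge> m0 \<Longrightarrow> integrable M f \<Longrightarrow> AE x in M. 0 \<le> f x \<Longrightarrow> AE x in M. 0 \<le> A n f x"
      using A(2) by (simp add: positive_op_def Lp_1_iff)
    show "\<And>n f. n \<ge> m0 \<Longrightarrow> integrable M f \<Longrightarrow> (\<integral>x. \<bar>A n f x\<bar> \<partial>M) \<le> \<alpha> n * (\<integral>x. \<bar>f x\<bar> \<partial>M)"
      using A(3) by (simp add: Lp_bounded_by_def Lp_1_iff Lp_norm_1)
    show "AE x in M. W ((Q ^^ (2 * n - a)) f) x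
              \<le> C * (\<Sum>j \<in> {j \<in> {- int b..int b}. 0 \<le> int n + j}.
                        (Qadj ^^ n) ((Q ^^ nat (int n + j)) f) x) + A n f x"
      if "n \<ge> m0" "integrable M f" "AE x in M. 0 \<le> f x" for n f
      using assms(16)[rule_format, OF that(1) _ that(3)] that(2) by (simp only: Lp_1_iff)
  qed (use dual V W assms(11,12,14,15) in auto)
  obtain m where m: "only_constant_L2_fixed_points M ((Qadj ^^ m) \<circ> (Q ^^ m))" using assms(9) by blast
  from convergence_LlogL[OF mean_convergence[OF m] assms(17)] show ?thesis
    unfolding Lp_norm_1 by (rule conjI)
qed

end
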